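(* Let $h$ satisfy the conditions in the context. There exists a sequence of functions $(U^k)_{0\le k\le n}$ defined by $$U^0=h\quad\text{and}\quad U^{k+1}=T_{b_{k+1}}[U^k],\qquad 0\le k\le n-1,$$ where the sequence of positive numbers $(b_k)_{1\le k\le n}$ is uniquely defined by $$\beta[U^k](b_{k+1})=U^k(b_{k+1}),$$ so that $U^{k+1}$ solves $$-\tfrac12x^2\sigma_2^2U^{k+1}_{xx}+\tfrac nT(U^{k+1}-U^k)=0\ \text{ for }x\le b_{k+1},\qquad -\tfrac12x^2\sigma_1^2U^{k+1}_{xx}+\tfrac nT(U^{k+1}-U^k)=0\ \text{ for }x>b_{k+1}.$$ Moreover, for all $1\le k\le n$: (i) $U^k$ is strictly convex on $(0,b_k)$ and strictly concave on $(b_k,\infty)$; (ii) $(b_k-x)(U^k-U^{k-1})(x)>0$ for all $x\in(0,\infty)\setminus\{b_k\}$; (iii) $U^k$ is a strictly increasing function with values in $[0,1)$, and is $C^2$ on $(0,\infty)$; (iv) $U^k(x)\sim_\infty1-a_1^kx^{\gamma_1}(\ln x)^{\delta_1^k}$ and $U^k(x)\sim_0a_2^kx^{\gamma_2}(\ln x)^{\delta_2^k}$, for some constants $a_1^k,a_2^k$ and some integers $\delta_1^k,\delta_2^k$.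
   Context: Let $0<\sigma_1<\sigma_2$, $T>0$ and an integer $n\ge1$ be fixed. Set $$\gamma_1:=\tfrac12\Big(1-\sqrt{1+\tfrac{8n}{T\sigma_1^2}}\Big),\qquad\gamma_2:=\tfrac12\Big(1+\sqrt{1+\tfrac{8n}{T\sigma_2^2}}\Big).$$ The function $h:\mathbb R_+\to\mathbb R$ is bounded and satisfies: $h$ is continuous; there is $x_0\in(0,1)$ such that $h(x)=1-h(x^{-1})=0$ for $0<x\le x_0$; and there is $b_0$ with $x_0<b_0<x_0^{-1}$ such that $h$ is convex on $[0,b_0]$ and concave on $[b_0,\infty)$. For a bounded (measurable) function $\varphi:\mathbb R_+\to\mathbb R$ and $b>0$ define $$\beta[\varphi](b):=\int_0^\infty\varphi(br)f(r)\,dr,\qquad f(r)=\frac1{\gamma_2-\gamma_1}\big[\gamma_2(\gamma_2-1)r^{\gamma_2-2}\mathbf 1_{0\le r\le1}+\gamma_1(\gamma_1-1)r^{\gamma_1-2}\mathbf 1_{r>1}\big],$$ $$H_b^i[\varphi](x):=\gamma_i(1-\gamma_i)\int_1^xr^{-2\gamma_i}\int_{x_i}^r\varphi(bs)s^{\gamma_i-2}\,ds\,dr,\quad i=1,2,\qquad x_1:=\infty,\ x_2:=0,$$ $$T_b[\varphi](x):=\begin{cases}\left(\frac xb\right)^{\gamma_1}\left[\beta[\varphi](b)+H_b^1[\varphi]\left(\frac xb\right)\right],&x>b,\\[2pt]\left(\frac xb\right)^{\gamma_2}\left[\beta[\varphi](b)+H_b^2[\varphi]\left(\frac xb\right)\right],&x\le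 b,\end{cases}$$ with the value at $x=0$ understood as the limit as $x\searrow0$. Asymptotic notation: $\varphi(x)\sim_\infty1-a x^{\gamma_1}(\ln x)^{\delta}$ means that $1-\varphi(x)$ is equivalent to $a x^{\gamma_1}(\ln x)^\delta$ (ratio tending to 1) as $x\to\infty$; $\varphi(x)\sim_0a x^{\gamma_2}(\ln x)^\delta$ means that the ratio tends to 1 as $x\searrow0$. *)

theory Defs
  imports "HOL-Analysis.Analysis" "HOL-Library.Landau_Symbols"
begin

text \<open>
  Functions on the half-line \<open>[0,\<infinity>)\<close> are represented by total functions on the reals; only
  their values at nonnegative arguments are relevant.
\<close>

definition gamma1 :: "nat \<Rightarrow> real \<Rightarrow> real \<Rightarrow> real" where
  "gamma1 n T \<sigma>1 = (1 - sqrt (1 + 8 * real n / (T * \<sigma>1\<^sup>2))) / 2"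

definition gamma2 :: "nat \<Rightarrow> real \<Rightarrow> real \<Rightarrow> real" where
  "gamma2 n T \<sigma>2 = (1 + sqrt (1 + 8 * real n / (T * \<sigma>2\<^sup>2))) / 2"

definition dens :: "real \<Rightarrow> real \<Rightarrow> real \<Rightarrow> real" where
  "dens \<gamma>1 \<gamma>2 r =
     1 / (\<gamma>2 - \<gamma>1) *
       (\<gamma>2 * (\<gamma>2 - 1) * r powr (\<gamma>2 - 2) * indicator {0..1} r
        + \<gamma>1 * (\<gamma>1 - 1) * r powr (\<gamma>1 - 2) * indicator {1<..} r)"

definition beta_op :: "real \<Rightarrow> real \<Rightarrow> (real \<Rightarrow> real) \<Rightarrow> real \<Rightarrow> real" where
  "beta_op \<gamma>1 \<gamma>2 \<phi> b = (LBINT r=0..\<infinity>. \<phi> (b * r) * dens \<gamma>1 \<gamma>2 r)"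

text \<open>
  The parameter \<open>e\<close> is the base point of the inner integral: \<open>\<infinity>\<close> for \<open>\<gamma>1\<close> and \<open>0\<close> for \<open>\<gamma>2\<close>.
  Interval integrals are oriented, so both integrals below may run backwards.
\<close>

definition H_op :: "real \<Rightarrow> ereal \<Rightarrow> real \<Rightarrow> (real \<Rightarrow> real) \<Rightarrow> real \<Rightarrow> real" where
  "H_op \<gamma> e b \<phi> x =
     \<gamma> * (1 - \<gamma>) *
       (LBINT r=1..ereal x. r powr (- 2 * \<gamma>) *
          (LBINT s=e..ereal r. \<phi> (b * s) * s powr (\<gamma> - 2)))"

definition T_branch ::
  "real \<Rightarrow> real \<Rightarrow> real \<Rightarrow> ereal \<Rightarrow> real \<Rightarrow> (real \<Rightarrow> real) \<Rightarrow> real \<Rightarrow> real" where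
  "T_branch \<gamma>1 \<gamma>2 \<gamma> e b \<phi> x =
     (x / b) powr \<gamma> * (beta_op \<gamma>1 \<gamma>2 \<phi> b + H_op \<gamma> e b \<phi> (x / b))"

definition T_op :: "real \<Rightarrow> real \<Rightarrow> real \<Rightarrow> (real \<Rightarrow> real) \<Rightarrow> real \<Rightarrow> real" where
  "T_op \<gamma>1 \<gamma>2 b \<phi> x =
     (if x > b then T_branch \<gamma>1 \<gamma>2 \<gamma>1 \<infinity> b \<phi> x
      else if x = 0 then Lim (at_right 0) (T_branch \<gamma>1 \<gamma>2 \<gamma>2 0 b \<phi>)
      else T_branch \<gamma>1 \<gamma>2 \<gamma>2 0 b \<phi> x)"

definition strictly_convex_on :: "real set \<Rightarrow> (real \<Rightarrow> real) \<Rightarrow> bool" where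
  "strictly_convex_on S f \<longleftrightarrow> convex S \<and>
     (\<forall>x\<in>S. \<forall>y\<in>S. \<forall>t. x \<noteq> y \<longrightarrow> 0 < t \<longrightarrow> t < 1 \<longrightarrow>
        f ((1 - t) * x + t * y) < (1 - t) * f x + t * f y)"

definition strictly_concave_on :: "real set \<Rightarrow> (real \<Rightarrow> real) \<Rightarrow> bool" where
  "strictly_concave_on S f \<longleftrightarrow> strictly_convex_on S (\<lambda>x. - f x)"

text \<open>Intended for open \<open>S\<close>, since \<open>deriv\<close> is the two-sided derivative.\<close>

definition C2_on :: "real set \<Rightarrow> (real \<Rightarrow> real) \<Rightarrow> bool" where
  "C2_on S f \<longleftrightarrow>
     (\<forall>x\<in>S. f differentiable (at x)) \<and>
     (\<forall>x\<in>S. deriv f differentiable (at x)) \<and>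
     continuous_on S (deriv (deriv f))"

definition admissible :: "(real \<Rightarrow> real) \<Rightarrow> bool" where
  "admissible h \<longleftrightarrow>
     bounded (h ` {0..}) \<and> continuous_on {0..} h \<and>
     (\<exists>x0 b0. 0 < x0 \<and> x0 < 1 \<and>
        (\<forall>x. 0 < x \<and> x \<le> x0 \<longrightarrow> 1 - h (inverse x) = 0 \<and> h x = 0) \<and>
        x0 < b0 \<and> b0 < inverse x0 \<and>
        convex_on {0..b0} h \<and> concave_on {b0..} h)"

end

theory Submission
  imports Defs
begin

text \<open>
  Write \<open>\<kappa> = \<gamma> (\<gamma> - 1)\<close>. The formula defining a branch of \<open>T\<^sub>b\<close> is variation of constants for the Euler
  equation \<open>x\<^sup>2 u'' = \<kappa> (u - g)\<close>: each branch solves it on all of \<open>(0,\<infinity>)\<close>, the one with \<open>\<gamma>2\<close> being the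
  solution that stays bounded at \<open>0\<close> and the one with \<open>\<gamma>1\<close> the solution that stays bounded at \<open>\<infinity>\<close>.
  Both take the value \<open>\<beta>[g](b)\<close> at \<open>b\<close>, and \<open>\<beta>\<close> is the only value for which their slopes at \<open>b\<close> agree.
  The glued function \<open>u\<close> is therefore always \<open>C\<^sup>1\<close>; it is \<open>C\<^sup>2\<close>, with \<open>u''(b) = 0\<close>, exactly when
  \<open>\<beta>[g](b) = g b\<close> (\<open>T_op_switched_solution\<close>). Everything else about \<open>u\<close> follows from the switched
  equation; the integrals return only for the existence of the root.

  \<^emph>\<open>Signs and shape.\<close> By the equation, \<open>u\<close> is strictly convex where \<open>u > g\<close> and strictly concave where
  \<open>u < g\<close>. So (i) is equivalent to (ii), and (ii) is a statement about the sign of \<open>w = u - g\<close>. Let \<open>g\<close> be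
  convex on \<open>(0,b0)\<close> and concave on \<open>(b0,\<infinity>)\<close>. Then \<open>w\<close> has no negative local minimum in \<open>(0,b0)\<close> and no
  positive local maximum in \<open>(b0,\<infinity>)\<close>; moreover it vanishes at \<open>0\<close>, \<open>b\<close> and \<open>\<infinity>\<close>. If \<open>b0 \<le> b\<close>, this
  gives \<open>w \<le> 0\<close> to the right of \<open>b\<close>, and if \<open>w\<close> were negative somewhere to the left of \<open>b\<close>, then \<open>w \<le> 0\<close> would hold
  on a whole neighbourhood of \<open>b\<close> although \<open>w b = 0\<close>. A strong maximum principle
  (\<open>concave_touching_eq\<close>) excludes this touching; it only uses concavity of \<open>g\<close>, so it also covers the
  first step, where \<open>g = h\<close> may have kinks. The case \<open>b < b0\<close> is the mirror image.

  \<^emph>\<open>The switching point.\<close> If \<open>b < c\<close> were two roots with solutions \<open>u\<close> and \<open>v\<close>, then \<open>u < g < v\<close> on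
  \<open>(b,c)\<close>, while \<open>d = u - v\<close> satisfies \<open>d'' < 0\<close> wherever \<open>d < 0\<close>, which contradicts \<open>d\<close> having a negative minimum
  (\<open>switched_solution_unique\<close>). A root exists by the intermediate value theorem. The density in \<open>\<beta>\<close> has mass
  one and mean one. Where \<open>h\<close> equals \<open>0\<close> or \<open>1\<close>, its average \<open>\<beta>[h]\<close> lies strictly between these values,
  which gives both signs for \<open>g = h\<close>. A later iterate \<open>g\<close> varies regularly near \<open>0\<close> with exponent \<open>\<gamma>2 > 1\<close>, so that by
  Fatou's lemma \<open>\<beta>[g](x) / g x\<close> is asymptotically at least the \<open>\<gamma>2\<close>-th moment of the density, which exceeds one by the strict
  Jensen inequality. In the same way \<open>1 - g\<close> varies regularly at \<open>\<infinity>\<close> with exponent \<open>\<gamma>1 < 0\<close>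
  (\<open>beta_op_exceeds\<close>).

  \<^emph>\<open>Tails.\<close> In the variable \<open>t = \<plusminus> ln x\<close> and after division by the homogeneous solution, both ends lead to
  the same resonant first-order system, in which a forcing term of order \<open>t ^ j\<close> produces a response of order
  \<open>t ^ Suc j\<close> (\<open>resonant_growth\<close>). Since \<open>h\<close> is constant near both ends, the first step has no logarithm
  and every further step adds one power of it.
\<close>

section \<open>Convexity, the minimum principle and touching graphs\<close>

lemma strictly_convex_onI:
  fixes f f' f'' :: "real \<Rightarrow> real"
  assumes S: "convex S"
    and f: "\<And>x. x \<in> S \<Longrightarrow> (f has_real_derivative f' x) (at x)"
    and f': "\<And>x. x \<in> S \<Longrightarrow> (f' has_real_derivative f'' x) (at x)"
    and pos: "\<And>x. x \<in> S \<Longrightarrow> f'' x > 0"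
  shows "strictly_convex_on S f"
proof -
  have ivl: "z \<in> S" if "x \<in> S" "y \<in> S" "x \<le> z" "z \<le> y" for x y z
    using S that by (meson atLeastAtMost_iff connected_contains_Icc convex_connected subsetD)
  have mono: "f' x < f' y" if "x \<in> S" "y \<in> S" "x < y" for x y
    using that by (intro DERIV_pos_imp_increasing[of x y f']) (meson f' pos ivl)+
  have main: "f ((1 - t) * x + t * y) < (1 - t) * f x + t * f y"
    if xy: "x \<in> S" "y \<in> S" "x < y" and t: "0 < t" "t < 1" for x y t
  proof -
    define z where "z = (1 - t) * x + t * y"
    have zx: "z - x = t * (y - x)" and yz: "y - z = (1 - t) * (y - x)"
      by (simp_all add: z_def algebra_simps)
    have "x < z" "z < y"
      using zx yz xy t by (smt (verit) mult_pos_pos)+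
    obtain p where p: "x < p" "p < z" "f z - f x = (z - x) * f' p"
      using MVT2[of x z f f'] \<open>x < z\<close> \<open>z < y\<close> xy f ivl by (metis less_imp_le order.trans)
    obtain q where q: "z < q" "q < y" "f y - f z = (y - z) * f' q"
      using MVT2[of z y f f'] \<open>x < z\<close> \<open>z < y\<close> xy f ivl by (metis less_imp_le order.trans)
    have "f' p < f' q"
      using p q xy by (intro mono) (auto intro: ivl[of x y])
    have "t * (f y - f z) - (1 - t) * (f z - f x) = t * (1 - t) * (y - x) * (f' q - f' p)"
      unfolding p q zx yz by (simp add: algebra_simps)
    also have "\<dots> > 0"
      using \<open>f' p < f' q\<close> xy t by simp
    finally show ?thesis
      unfolding z_def[symmetric] by (simp add: algebra_simps)
  qed
  show ?thesis
    unfolding strictly_convex_on_def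
  proof (intro conjI ballI allI impI S)
    fix x y t :: real
    assume *: "x \<in> S" "y \<in> S" "x \<noteq> y" "0 < t" "t < 1"
    show "f ((1 - t) * x + t * y) < (1 - t) * f x + t * f y"
    proof (cases "x < y")
      case False
      then show ?thesis
        using main[of y x "1 - t"] * by (simp add: algebra_simps)
    qed (use main * in auto)
  qed
qed

lemma strictly_concave_onI:
  fixes f f' f'' :: "real \<Rightarrow> real"
  assumes S: "convex S"
    and f: "\<And>x. x \<in> S \<Longrightarrow> (f has_real_derivative f' x) (at x)"
    and f': "\<And>x. x \<in> S \<Longrightarrow> (f' has_real_derivative f'' x) (at x)"
    and neg: "\<And>x. x \<in> S \<Longrightarrow> f'' x < 0"
  shows "strictly_concave_on S f"
  unfolding strictly_concave_on_def
  using assms by (intro strictly_convex_onI[where f' = "\<lambda>x. - f' x" and f'' = "\<lambda>x. - f'' x"])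
    (auto intro!: derivative_intros)

lemma strictly_convex_on_imp_convex_on: "strictly_convex_on S f \<Longrightarrow> convex_on S f"
  unfolding strictly_convex_on_def
proof (intro convex_onI)
  fix t x y :: real
  assume *: "convex S \<and> (\<forall>x\<in>S. \<forall>y\<in>S. \<forall>t. x \<noteq> y \<longrightarrow> 0 < t \<longrightarrow> t < 1 \<longrightarrow>
        f ((1 - t) * x + t * y) < (1 - t) * f x + t * f y)" "0 < t" "t < 1" "x \<in> S" "y \<in> S"
  show "f ((1 - t) *\<^sub>R x + t *\<^sub>R y) \<le> (1 - t) * f x + t * f y"
  proof (cases "x = y")
    case True
    then show ?thesis by (simp flip: distrib_right)
  qed (use * in \<open>simp add: less_imp_le\<close>)
qed auto

lemma strictly_concave_on_imp_concave_on: "strictly_concave_on S f \<Longrightarrow> concave_on S f"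
  unfolding strictly_concave_on_def concave_on_def by (rule strictly_convex_on_imp_convex_on)

text \<open>
  Strict convexity is used locally only through this midpoint form, which can be compared with the
  midpoint form of the merely convex function \<open>g\<close>.
\<close>

lemma strictly_convex_on_midpoint:
  "strictly_convex_on S f \<Longrightarrow> x - t \<in> S \<Longrightarrow> x + t \<in> S \<Longrightarrow> t > 0 \<Longrightarrow> 2 * f x < f (x - t) + f (x + t)"
  unfolding strictly_convex_on_def
  by (elim conjE) (drule bspec[of _ _ "x - t"], assumption, drule bspec[of _ _ "x + t"],
     assumption, drule spec[of _ "1/2"], simp add: field_simps)

lemma convex_on_midpoint:
  "convex_on S f \<Longrightarrow> x - t \<in> S \<Longrightarrow> x + t \<in> S \<Longrightarrow> 2 * f x \<le> f (x - t) + f (x + t)" for f :: "real \<Rightarrow> real"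
  using convex_onD[of S f "1/2" "x - t" "x + t"] by (simp add: field_simps)

text \<open>
  At a negative interior minimum the midpoint inequality in the hypothesis would fail. Asking for it at a single step \<open>t\<close>
  keeps the principle applicable to functions without a second derivative, such as \<open>u - g\<close>.
\<close>

lemma minimum_principle:
  fixes f :: "real \<Rightarrow> real"
  assumes cont: "continuous_on {p..q} f" and x: "x \<in> {p..q}"
    and local: "\<And>y. p < y \<Longrightarrow> y < q \<Longrightarrow> f y < 0 \<Longrightarrow>
      \<exists>t. p \<le> y - t \<and> y + t \<le> q \<and> t > 0 \<and> f (y - t) + f (y + t) < 2 * f y"
  shows "min 0 (min (f p) (f q)) \<le> f x"
proof (rule ccontr)
  assume neg: "\<not> ?thesis"
  obtain m where m: "m \<in> {p..q}" "\<And>y. y \<in> {p..q} \<Longrightarrow> f m \<le> f y"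
    using continuous_attains_inf[OF compact_Icc _ cont] x by blast
  have "f m \<le> f x" using m x by blast
  then have "m \<noteq> p" "m \<noteq> q" "f m < 0" using neg by auto
  then obtain t where "p \<le> m - t" "m + t \<le> q" "t > 0" "f (m - t) + f (m + t) < 2 * f m"
    using local[of m] m by force
  moreover have "f m \<le> f (m - t)" "f m \<le> f (m + t)"
    using calculation m(1) by (intro m(2); simp)+
  ultimately show False by simp
qed

text \<open>
  If \<open>f x < 0\<close>, then \<open>f\<close> exceeds \<open>f x\<close> at some later point \<open>q\<close> because of its limit, and the compact
  version applies on \<open>{p..q}\<close>.
\<close>

lemma minimum_principle_at_top:
  fixes f :: "real \<Rightarrow> real"
  assumes cont: "continuous_on {p..} f" and x: "p \<le> x" and p: "0 \<le> f p"
    and lim: "(f \<longlongrightarrow> l) at_top" "0 \<le> l"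
    and local: "\<And>y. p < y \<Longrightarrow> f y < 0 \<Longrightarrow>
      \<exists>e>0. \<forall>t. 0 < t \<longrightarrow> t < e \<longrightarrow> f (y - t) + f (y + t) < 2 * f y"
  shows "0 \<le> f x"
proof (rule ccontr)
  assume neg: "\<not> 0 \<le> f x"
  then have "eventually (\<lambda>q. f q > f x) at_top"
    using lim by (intro order_tendstoD) auto
  then obtain q where q: "q \<ge> x" "f q > f x"
    by (metis eventually_at_top_linorder linorder_linear order.trans)
  have "min 0 (min (f p) (f q)) \<le> f x"
  proof (rule minimum_principle[where f = f])
    show "continuous_on {p..q} f" using cont by (rule continuous_on_subset) auto
    fix y assume y: "p < y" "y < q" "f y < 0"
    from local[OF y(1,3)] obtain e where "e > 0" and
      e: "\<And>t. 0 < t \<Longrightarrow> t < e \<Longrightarrow> f (y - t) + f (y + t) < 2 * f y" by blast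
    show "\<exists>t. p \<le> y - t \<and> y + t \<le> q \<and> t > 0 \<and> f (y - t) + f (y + t) < 2 * f y"
      using y \<open>e > 0\<close> by (intro exI[of _ "min (e / 2) (min (y - p) (q - y))"]) (auto intro!: e)
  qed (use x q in auto)
  then show False using p neg q by (auto simp: min_def split: if_splits)
qed

text \<open>
  When a differentiable \<open>u\<close> touches a concave \<open>g\<close> from below, the slopes of \<open>g\<close> near \<open>p\<close> are squeezed by those of
  \<open>u\<close>, which makes the tangent of \<open>u\<close> a supporting line of \<open>g\<close>.
\<close>

lemma concave_on_touching_tangent:
  fixes g u :: "real \<Rightarrow> real"
  assumes S: "open S" and g: "concave_on S g" and le: "\<And>x. x \<in> S \<Longrightarrow> u x \<le> g x"
    and p: "p \<in> S" "u p = g p" and u: "(u has_real_derivative D) (at p)" and x: "x \<in> S"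
  shows "g x \<le> g p + D * (x - p)"
proof (cases "x = p")
  case False
  define h where "h = x - p"
  \<comment> \<open>Slopes are compared on the side of \<open>p\<close> away from \<open>x\<close>.\<close>
  have line: "((\<lambda>t. u (p - t * h)) has_real_derivative D * (0 - 1 * h)) (at 0)"
    using u by (intro DERIV_chain2[where f = u and g = "\<lambda>t. p - t * h"]) (auto intro!: derivative_eq_intros)
  then have "((\<lambda>t. (u (p - t * h) - u p) / t) \<longlongrightarrow> - D * h) (at_right 0)"
    by (auto simp: has_field_derivative_iff intro: tendsto_within_subset)
  moreover have "eventually (\<lambda>t. (u (p - t * h) - u p) / t \<le> g p - g x) (at_right 0)"
  proof -
    have "((\<lambda>t. p - t * h) \<longlongrightarrow> p - 0 * h) (at_right 0)" by (intro tendsto_intros)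
    then have "eventually (\<lambda>t. p - t * h \<in> S) (at_right 0)"
      using S p by (intro topological_tendstoD) auto
    moreover have "eventually (\<lambda>t::real. 0 < t) (at_right 0)"
      by (simp add: eventually_at_filter)
    ultimately show ?thesis
    proof eventually_elim
      case (elim t)
      define c where "c = 1 / (1 + t)"
      have c: "0 < c" "c < 1" using elim by (auto simp: c_def)
      have "c * (t + 1) = 1" using elim by (simp add: c_def)
      have "c * (p - t * h) + (1 - c) * x = p + h * (1 - c * (t + 1))"
        by (simp add: h_def algebra_simps)
      then have eq: "c * (p - t * h) + (1 - c) * x = p"
        using \<open>c * (t + 1) = 1\<close> by simp
      have "g p \<ge> c * g (p - t * h) + (1 - c) * g x"
        using convex_onD[OF g[unfolded concave_on_def], of "1 - c" "p - t * h" x] c elim x eq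
        by simp
      then have "(1 + t) * (c * g (p - t * h) + (1 - c) * g x) \<le> (1 + t) * g p"
        using elim by (intro mult_left_mono) auto
      also have "(1 + t) * (c * g (p - t * h) + (1 - c) * g x) =
          (c * (t + 1)) * (g (p - t * h) - g x) + (1 + t) * g x"
        by (simp add: algebra_simps)
      finally have "(1 + t) * g p \<ge> g (p - t * h) + t * g x"
        unfolding \<open>c * (t + 1) = 1\<close> by (simp add: algebra_simps)
      moreover have "u (p - t * h) \<le> g (p - t * h)" using le elim by auto
      ultimately have "u (p - t * h) - u p \<le> t * (g p - g x)"
        using p by (simp add: algebra_simps)
      then show ?case using elim by (simp add: field_simps)
    qed
  qed
  ultimately have "- D * h \<le> g p - g x"
    by (intro tendsto_upperbound) auto
  then show ?thesis by (simp add: h_def)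
qed simp

lemma second_order_Taylor:
  fixes u u' u'' :: "real \<Rightarrow> real"
  assumes u: "\<And>x. x \<in> {a..b} \<Longrightarrow> (u has_real_derivative u' x) (at x)"
    and u': "\<And>x. x \<in> {a..b} \<Longrightarrow> (u' has_real_derivative u'' x) (at x)"
    and "p \<in> {a..b}" "x \<in> {a..b}"
  shows "\<exists>\<xi>\<in>{a..b}. u x = u p + u' p * (x - p) + u'' \<xi> / 2 * (x - p)\<^sup>2"
proof -
  define D where "D = (\<lambda>m. if m = 0 then u else if m = Suc 0 then u' else u'')"
  have D: "\<forall>m t. m < 2 \<and> a \<le> t \<and> t \<le> b \<longrightarrow> DERIV (D m) t :> D (Suc m) t"
    using u u' by (auto simp: D_def less_2_cases_iff)
  have D2: "D 2 = u''" by (simp add: D_def)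
  consider "x = p" | "p < x" | "x < p" by linarith
  then show ?thesis
  proof cases
    case 2
    obtain t where "p < t" "t < x"
      and "u x = (\<Sum>m<2. (D m p / fact m) * (x - p) ^ m) + (D 2 t / fact 2) * (x - p)^2"
      using Taylor_up[of 2 D u a x p] D assms(3,4) 2 by (auto simp: D_def)
    then show ?thesis
      using assms(3,4) by (intro bexI[of _ t]) (simp_all add: D2, simp add: numeral_2_eq_2 D_def)
  next
    case 3
    obtain t where "x < t" "t < p"
      and "u x = (\<Sum>m<2. (D m p / fact m) * (x - p) ^ m) + (D 2 t / fact 2) * (x - p)^2"
      using Taylor_down[of 2 D u x b p] D assms(3,4) 3 by (auto simp: D_def)
    then show ?thesis
      using assms(3,4) by (intro bexI[of _ t]) (simp_all add: D2, simp add: numeral_2_eq_2 D_def)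
  qed (use assms in auto)
qed

text \<open>
  A strong maximum principle for \<open>w = u - g\<close>, where \<open>u\<close> is a subsolution and \<open>g\<close> is concave. The set
  where \<open>w\<close> vanishes is closed in \<open>S\<close>. It is also open: around a touching point the common tangent cancels, and
  Taylor's formula leaves \<open>w m \<ge> c \<xi> w \<xi> (m - p)\<^sup>2 / 2\<close> at the minimiser \<open>m\<close> of \<open>w\<close> over a small interval. If the
  interval is so short that \<open>c (m - p)\<^sup>2 \<le> 1\<close>, the right-hand side is at least \<open>w m / 2\<close>, which forces \<open>w m = 0\<close>.
\<close>

lemma concave_touching_eq:
  fixes g u u' u'' c :: "real \<Rightarrow> real"
  assumes S: "open S" "connected S" and g: "concave_on S g"
    and u: "\<And>x. x \<in> S \<Longrightarrow> (u has_real_derivative u' x) (at x)"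
    and u': "\<And>x. x \<in> S \<Longrightarrow> (u' has_real_derivative u'' x) (at x)"
    and ode: "\<And>x. x \<in> S \<Longrightarrow> c x * (u x - g x) \<le> u'' x"
    and c: "\<And>x. x \<in> S \<Longrightarrow> 0 \<le> c x"
      "\<And>p. p \<in> S \<Longrightarrow> \<exists>C. eventually (\<lambda>x. c x \<le> C) (nhds p)"
    and le: "\<And>x. x \<in> S \<Longrightarrow> u x \<le> g x"
    and p: "p \<in> S" "u p = g p" and x: "x \<in> S"
  shows "u x = g x"
proof -
  define w where "w = (\<lambda>x. u x - g x)"
  have contg: "continuous_on S g"
    using convex_on_continuous[OF S(1) g[unfolded concave_on_def]] continuous_on_minus[of S "\<lambda>x. - g x"] by simp
  have contu: "continuous_on S u"
    using u by (meson DERIV_isCont continuous_at_imp_continuous_on)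
  have contw: "continuous_on S w"
    unfolding w_def by (intro continuous_intros contg contu)
  have step: "\<exists>e>0. \<forall>y. \<bar>y - p\<bar> \<le> e \<longrightarrow> y \<in> S \<and> w y = 0" if p: "p \<in> S" "w p = 0" for p
  proof -
    obtain C where C: "eventually (\<lambda>x. c x \<le> C) (nhds p)" using c p by blast
    obtain d1 where d1: "d1 > 0" "\<And>y. dist y p < d1 \<Longrightarrow> c y \<le> C"
      using C unfolding eventually_nhds_metric by blast
    obtain d2 where d2: "d2 > 0" "\<And>y. dist y p < d2 \<Longrightarrow> y \<in> S"
      using S p by (auto simp: open_dist)
    \<comment> \<open>The radius is chosen so that \<open>K * e\<^sup>2 \<le> 1\<close> although \<open>C\<close> may be small or negative.\<close>
    define K where "K = max C 1"
    define e where "e = min (min (d1/2) (d2/2)) (1 / K)"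
    have K: "K \<ge> 1" "K \<ge> C" by (auto simp: K_def)
    have e: "e > 0" "K * e * e \<le> 1"
    proof -
      show "e > 0" using d1 d2 K by (simp add: e_def)
      have "K * e \<le> 1" "e \<le> 1 / K" using K by (auto simp: e_def min_def field_simps)
      moreover have "1 / K \<le> 1" using K by simp
      then have "e \<le> 1" using \<open>e \<le> 1 / K\<close> by linarith
      ultimately have "(K * e) * e \<le> 1 * 1" using \<open>e > 0\<close> K by (intro mult_mono) auto
      then show "K * e * e \<le> 1" by simp
    qed
    have inS: "y \<in> S" "c y \<le> K" if "y \<in> {p-e..p+e}" for y
    proof -
      have "dist y p < d1" "dist y p < d2"
        using that d1 d2 by (auto simp: e_def dist_real_def)
      then show "y \<in> S" "c y \<le> K" using d1 d2 K by (auto intro: order.trans)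
    qed
    have sub: "{p-e..p+e} \<subseteq> S" using inS by blast
    obtain m where m: "m \<in> {p-e..p+e}" "\<And>y. y \<in> {p-e..p+e} \<Longrightarrow> w m \<le> w y"
      using continuous_attains_inf[of "{p-e..p+e}" w] continuous_on_subset[OF contw sub] e
      by auto
    obtain \<xi> where \<xi>: "\<xi> \<in> {p-e..p+e}" "u m = u p + u' p * (m - p) + u'' \<xi> / 2 * (m - p)\<^sup>2"
      using second_order_Taylor[of "p-e" "p+e" u u' u'' p m] m u u' inS e by force
    have tang: "g m \<le> g p + u' p * (m - p)"
      using p m inS by (intro concave_on_touching_tangent[OF S(1) g le _ _ u]) (auto simp: w_def)
    have "w m \<ge> u'' \<xi> / 2 * (m - p)\<^sup>2"
      using \<xi>(2) tang p by (simp add: w_def)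
    moreover have "u'' \<xi> \<ge> c \<xi> * w \<xi>" using ode inS \<xi> by (auto simp: w_def)
    then have "u'' \<xi> / 2 * (m - p)\<^sup>2 \<ge> (c \<xi> * w \<xi>) / 2 * (m - p)\<^sup>2"
      by (intro mult_right_mono) auto
    moreover have "c \<xi> * w \<xi> / 2 * (m - p)\<^sup>2 \<ge> w m / 2"
    proof -
      have wm: "w m \<le> w \<xi>" "w \<xi> \<le> 0" "w m \<le> 0" using m(2) \<xi>(1) le inS m(1) by (auto simp: w_def)
      have "c \<xi> * (m - p)\<^sup>2 \<le> K * (e * e)"
      proof (intro mult_mono)
        have "\<bar>m - p\<bar> \<le> e" using m by auto
        then show "(m - p)\<^sup>2 \<le> e * e"
          by (metis abs_ge_zero mult_mono' power2_abs power2_eq_square)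
      qed (use inS \<xi> K c in auto)
      also have "\<dots> \<le> 1" using e by (simp add: algebra_simps)
      finally have *: "c \<xi> * (m - p)\<^sup>2 \<le> 1" .
      moreover have "0 \<le> c \<xi> * (m - p)\<^sup>2" using c inS \<xi> by simp
      ultimately have "(c \<xi> * (m - p)\<^sup>2) * w \<xi> \<ge> w \<xi>"
        using wm mult_left_le_one_le[of "- w \<xi>" "c \<xi> * (m - p)\<^sup>2"] by simp
      then show ?thesis using wm by (simp add: algebra_simps)
    qed
    ultimately have "w m \<ge> w m / 2" by linarith
    then have "w y = 0" if "y \<in> {p-e..p+e}" for y
      using m(2)[OF that] le[OF inS(1)[OF that]] by (simp add: w_def)
    then show ?thesis
      using e inS by (intro exI[of _ e]) (auto simp: abs_le_iff)
  qed
  define Z where "Z = {x \<in> S. w x = 0}"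
  have "openin (top_of_set S) Z"
  proof (rule open_subset)
    show "open Z"
      unfolding open_dist
    proof
      fix q assume "q \<in> Z"
      with step[of q] obtain e where "e > 0" "\<And>y. \<bar>y - q\<bar> \<le> e \<Longrightarrow> y \<in> S \<and> w y = 0"
        by (auto simp: Z_def)
      then show "\<exists>e>0. \<forall>y. dist y q < e \<longrightarrow> y \<in> Z"
        by (auto simp: Z_def dist_real_def intro!: exI[of _ e])
    qed
  qed (auto simp: Z_def)
  moreover have "closedin (top_of_set S) Z"
    unfolding Z_def by (rule continuous_closedin_preimage_constant[OF contw])
  moreover have "p \<in> Z" using p by (simp add: Z_def w_def)
  ultimately have "Z = S" using S(2) by (metis connected_clopen empty_iff)
  then show ?thesis using x by (auto simp: Z_def w_def)
qed

section \<open>Power integrals and the inner integrals of the operators\<close>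

text \<open>
  The case \<open>0/0\<close> of L'Hopital's rule at infinity, obtained from the one at \<open>0\<close> through \<open>x \<mapsto> 1 / x\<close>.
\<close>

lemma lhopital_at_top_zero:
  fixes f g :: "real \<Rightarrow> real"
  assumes f_0: "(f \<longlongrightarrow> 0) at_top" and g_0: "(g \<longlongrightarrow> 0) at_top"
    and g: "eventually (\<lambda>x. g x \<noteq> 0) at_top" and g': "eventually (\<lambda>x. g' x \<noteq> 0) at_top"
    and Df: "eventually (\<lambda>x. DERIV f x :> f' x) at_top"
    and Dg: "eventually (\<lambda>x. DERIV g x :> g' x) at_top"
    and lim: "((\<lambda> x. (f' x / g' x)) \<longlongrightarrow> x) at_top"
  shows "((\<lambda> x. f x / g x) \<longlongrightarrow> x) at_top"
  unfolding filterlim_at_top_to_right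
proof (rule lhopital_right_0)
  let ?R = "at_right (0::real)"
  let ?D = "\<lambda>f' x. f' (inverse x) * - (inverse x ^ Suc (Suc 0))"
  show "((\<lambda>x. f (inverse x)) \<longlongrightarrow> 0) ?R" "((\<lambda>x. g (inverse x)) \<longlongrightarrow> 0) ?R"
    using f_0 g_0 unfolding filterlim_at_top_to_right .
  show "eventually (\<lambda>x. g (inverse x) \<noteq> 0) ?R"
    using g unfolding eventually_at_right_to_top by simp
  show "eventually (\<lambda>x. DERIV (\<lambda>x. g (inverse x)) x  :> ?D g' x) ?R"
    unfolding eventually_at_right_to_top
    using Dg eventually_ge_at_top[where c=1]
    by eventually_elim (rule derivative_eq_intros DERIV_chain'[where f=inverse] | simp)+
  show "eventually (\<lambda>x. DERIV (\<lambda>x. f (inverse x)) x  :> ?D f' x) ?R"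
    unfolding eventually_at_right_to_top
    using Df eventually_ge_at_top[where c=1]
    by eventually_elim (rule derivative_eq_intros DERIV_chain'[where f=inverse] | simp)+
  show "eventually (\<lambda>x. ?D g' x \<noteq> 0) ?R"
    unfolding eventually_at_right_to_top
    using g' eventually_ge_at_top[where c=1]
    by eventually_elim auto
  show "((\<lambda>x. ?D f' x / ?D g' x) \<longlongrightarrow> x) ?R"
    unfolding filterlim_at_right_to_top
    apply (intro filterlim_cong[THEN iffD2, OF refl refl _ lim])
    using eventually_ge_at_top[where c=1]
    by eventually_elim simp
qed

text \<open>
  The fundamental theorem of calculus with a base point \<open>e\<close> that may be \<open>0\<close> or \<open>\<infinity>\<close> and may lie on either side
  of the upper limit, as the operators require.
\<close>

lemma interval_integral_has_real_derivative:
  fixes f :: "real \<Rightarrow> real" and e :: ereal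
  assumes cont: "continuous_on {0<..} f" and x: "0 < x"
    and int: "\<And>c u. 0 < c \<Longrightarrow> 0 < u \<Longrightarrow>
      interval_lebesgue_integrable lborel (min e (min (ereal c) (ereal u))) (max e (max (ereal c) (ereal u))) f"
  shows "((\<lambda>u. LBINT y=e..ereal u. f y) has_real_derivative f x) (at x)"
proof -
  have "((\<lambda>u. LBINT y=ereal x..ereal u. f y) has_vector_derivative (f x)) (at x within {x/2..2*x})"
    using x by (intro interval_integral_FTC2 continuous_on_subset[OF cont]) auto
  then have "((\<lambda>u. LBINT y=ereal x..ereal u. f y) has_vector_derivative (f x)) (at x)"
    using x by (subst (asm) at_within_Icc_at) auto
  then have "((\<lambda>u. (LBINT y=e..ereal x. f y) + (LBINT y=ereal x..ereal u. f y)) has_real_derivative 0 + f x) (at x)"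
    unfolding has_real_derivative_iff_has_vector_derivative[symmetric] by (intro derivative_intros)
  moreover have "eventually (\<lambda>u. u > 0) (nhds x)"
    using x by (intro order_tendstoD[where y=x]) (auto simp: filterlim_ident)
  then have "eventually (\<lambda>u. (LBINT y=e..ereal x. f y) + (LBINT y=ereal x..ereal u. f y) = (LBINT y=e..ereal u. f y)) (nhds x)"
    by eventually_elim (use x in \<open>intro interval_integral_sum int\<close>)
  ultimately show ?thesis
    by (subst DERIV_cong_ev[OF refl _ refl, symmetric]) auto
qed

lemma powr_integral_from_0:
  fixes \<gamma> r :: real
  assumes "1 < \<gamma>" "0 < r"
  shows "set_integrable lborel {0<..<r} (\<lambda>s. s powr (\<gamma> - 2))"
    and "(LBINT s:{0<..<r}. s powr (\<gamma> - 2)) = r powr (\<gamma> - 1) / (\<gamma> - 1)"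
proof -
  have A: "(((\<lambda>s. s powr (\<gamma> - 1) / (\<gamma> - 1)) \<circ> real_of_ereal) \<longlongrightarrow> 0) (at_right (ereal 0))"
    unfolding comp_def using assms
    by (intro iffD2[OF ereal_tendsto_simps1(2)[unfolded comp_def]]) 
       (auto intro!: tendsto_eq_intros tendsto_powr' simp: eventually_at_filter)
  have B: "(((\<lambda>s. s powr (\<gamma> - 1) / (\<gamma> - 1)) \<circ> real_of_ereal) \<longlongrightarrow> r powr (\<gamma> - 1) / (\<gamma> - 1)) (at_left (ereal r))"
    using assms by (auto simp: ereal_tendsto_simps1 intro!: tendsto_eq_intros)
  have D: "DERIV (\<lambda>s. s powr (\<gamma> - 1) / (\<gamma> - 1)) s :> s powr (\<gamma> - 2)" if "ereal 0 < ereal s" for s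
    using DERIV_cdivide[OF has_real_derivative_powr[of s "\<gamma> - 1"], of "\<gamma> - 1"] assms that by simp
  have C: "isCont (\<lambda>s. s powr (\<gamma> - 2)) s" if "ereal 0 < ereal s" for s
    using that by (auto intro!: continuous_intros)
  note F = interval_integral_FTC_nonneg[of "ereal 0" "ereal r", OF _ D C _ A B]
  show "set_integrable lborel {0<..<r} (\<lambda>s. s powr (\<gamma> - 2))"
    using F(1) assms by simp
  show "(LBINT s:{0<..<r}. s powr (\<gamma> - 2)) = r powr (\<gamma> - 1) / (\<gamma> - 1)"
    using F(2) assms by (simp add: interval_lebesgue_integral_def)
qed

lemma powr_integral_to_infinity:
  fixes \<gamma> r :: real
  assumes "\<gamma> < 1" "0 < r"
  shows "set_integrable lborel {r<..} (\<lambda>s. s powr (\<gamma> - 2))"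
    and "(LBINT s:{r<..}. s powr (\<gamma> - 2)) = r powr (\<gamma> - 1) / (1 - \<gamma>)"
proof -
  have lim: "((\<lambda>s. s powr (\<gamma> - 1)) \<longlongrightarrow> 0) at_top"
    using assms by (intro tendsto_neg_powr filterlim_ident) auto
  have A: "(((\<lambda>s. s powr (\<gamma> - 1) / (\<gamma> - 1)) \<circ> real_of_ereal) \<longlongrightarrow> 0) (at_left \<infinity>)"
    unfolding ereal_tendsto_simps1
    using tendsto_divide[OF lim tendsto_const[of "\<gamma> - 1"]] assms by simp
  have B: "(((\<lambda>s. s powr (\<gamma> - 1) / (\<gamma> - 1)) \<circ> real_of_ereal) \<longlongrightarrow> r powr (\<gamma> - 1) / (\<gamma> - 1)) (at_right (ereal r))"
    using assms by (auto simp: ereal_tendsto_simps1 intro!: tendsto_eq_intros)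
  have D: "DERIV (\<lambda>s. s powr (\<gamma> - 1) / (\<gamma> - 1)) s :> s powr (\<gamma> - 2)" if "ereal r < ereal s" for s
    using DERIV_cdivide[OF has_real_derivative_powr[of s "\<gamma> - 1"], of "\<gamma> - 1"] assms that by simp
  have C: "isCont (\<lambda>s. s powr (\<gamma> - 2)) s" if "ereal r < ereal s" for s
    using that assms by (auto intro!: continuous_intros)
  note F = interval_integral_FTC_nonneg[of "ereal r" "\<infinity>", OF _ D C _ B A]
  show "set_integrable lborel {r<..} (\<lambda>s. s powr (\<gamma> - 2))"
    using F(1) assms by simp
  show "(LBINT s:{r<..}. s powr (\<gamma> - 2)) = r powr (\<gamma> - 1) / (1 - \<gamma>)"
    using F(2) assms by (simp add: interval_lebesgue_integral_def field_simps)
qed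

text \<open>
  The inner integral of \<open>H_op\<close>, an antiderivative of \<open>\<phi> s * s powr (\<gamma> - 2)\<close>.
\<close>

definition moment :: "real \<Rightarrow> ereal \<Rightarrow> (real \<Rightarrow> real) \<Rightarrow> real \<Rightarrow> real" where
  "moment \<gamma> e \<phi> r = (LBINT s=e..ereal r. \<phi> s * s powr (\<gamma> - 2))"

lemma set_integrable_bounded_mult:
  fixes \<phi> f :: "real \<Rightarrow> real"
  assumes f: "set_integrable lborel A f" and A: "A \<in> sets borel" "A \<subseteq> B" "B \<in> sets borel"
    and cont: "continuous_on B \<phi>" and bd: "\<And>s. s \<in> A \<Longrightarrow> \<bar>\<phi> s\<bar> \<le> M"
  shows "set_integrable lborel A (\<lambda>s. \<phi> s * f s)"
proof (rule set_integrable_bound[where f = "\<lambda>s. M * f s"])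
  show "set_integrable lborel A (\<lambda>s. M * f s)" using f by simp
  have "(\<lambda>s. indicator B s *\<^sub>R \<phi> s) \<in> borel_measurable borel"
    using cont A by (intro borel_measurable_continuous_on_indicator) auto
  moreover have "(\<lambda>s. indicator A s *\<^sub>R f s) \<in> borel_measurable borel"
    using f by (auto simp: set_integrable_def dest: borel_measurable_integrable)
  ultimately have "(\<lambda>s. (indicator B s *\<^sub>R \<phi> s) * (indicator A s *\<^sub>R f s)) \<in> borel_measurable borel"
    by measurable
  also have "(\<lambda>s. (indicator B s *\<^sub>R \<phi> s) * (indicator A s *\<^sub>R f s)) = (\<lambda>s. indicator A s *\<^sub>R (\<phi> s * f s))"
    using A by (auto simp: indicator_def fun_eq_iff)
  finally show "set_borel_measurable lborel A (\<lambda>s. \<phi> s * f s)"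
    by (simp add: set_borel_measurable_def)
  show "AE s in lborel. s \<in> A \<longrightarrow> norm (\<phi> s * f s) \<le> norm (M * f s)"
    by (auto simp: abs_mult intro!: mult_right_mono order.trans[OF bd])
qed

locale euler_exponents =
  fixes \<gamma>1 \<gamma>2 :: real
  assumes \<gamma>1: "\<gamma>1 < 0" and \<gamma>2: "1 < \<gamma>2"

text \<open>
  Boundedness makes the integrals of \<open>\<phi>\<close> against the two power weights converge. The locale is instantiated
  with \<open>g\<close>, with \<open>1 - g\<close> and with their rescalings by \<open>b\<close>.
\<close>

locale bounded_profile =
  fixes \<phi> :: "real \<Rightarrow> real" and M :: real
  assumes cont: "continuous_on {0<..} \<phi>" and bounded: "\<And>s. 0 < s \<Longrightarrow> \<bar>\<phi> s\<bar> \<le> M"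
begin

lemma integrable_0: "1 < \<gamma> \<Longrightarrow> 0 < r \<Longrightarrow> set_integrable lborel {0<..<r} (\<lambda>s. \<phi> s * s powr (\<gamma> - 2))"
  by (rule set_integrable_bounded_mult[OF powr_integral_from_0(1) _ _ _ cont, where M = M])
     (auto intro: bounded)

lemma integrable_inf: "\<gamma> < 1 \<Longrightarrow> 0 < r \<Longrightarrow> set_integrable lborel {r<..} (\<lambda>s. \<phi> s * s powr (\<gamma> - 2))"
  by (rule set_integrable_bounded_mult[OF powr_integral_to_infinity(1) _ _ _ cont, where M = M])
     (auto intro: bounded)

lemma moment_0: "0 < r \<Longrightarrow> moment \<gamma> 0 \<phi> r = (LBINT s:{0<..<r}. \<phi> s * s powr (\<gamma> - 2))"
  by (simp add: moment_def zero_ereal_def interval_lebesgue_integral_def)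

lemma moment_inf: "moment \<gamma> \<infinity> \<phi> r = - (LBINT s:{r<..}. \<phi> s * s powr (\<gamma> - 2))"
  by (simp add: moment_def interval_lebesgue_integral_def)

lemma moment_0_deriv:
  assumes "1 < \<gamma>" "0 < r"
  shows "(moment \<gamma> 0 \<phi> has_real_derivative \<phi> r * r powr (\<gamma> - 2)) (at r)"
  unfolding moment_def
proof (rule interval_integral_has_real_derivative[OF _ assms(2)])
  show "continuous_on {0<..} (\<lambda>r. \<phi> r * r powr (\<gamma> - 2))"
    by (intro continuous_intros cont) auto
  fix c u :: real assume "0 < c" "0 < u"
  then have "set_integrable lborel {0<..<max c u} (\<lambda>s. \<phi> s * s powr (\<gamma> - 2))"
    using assms by (intro integrable_0) auto
  then show "interval_lebesgue_integrable lborel (min 0 (min (ereal c) (ereal u))) (max 0 (max (ereal c) (ereal u)))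
           (\<lambda>r. \<phi> r * r powr (\<gamma> - 2))"
    using \<open>0 < c\<close> \<open>0 < u\<close>
    by (auto simp: interval_lebesgue_integrable_def zero_ereal_def min_def max_def split: if_splits)
qed

lemma moment_inf_deriv:
  assumes "\<gamma> < 1" "0 < r"
  shows "(moment \<gamma> \<infinity> \<phi> has_real_derivative \<phi> r * r powr (\<gamma> - 2)) (at r)"
  unfolding moment_def
proof (rule interval_integral_has_real_derivative[OF _ assms(2)])
  show "continuous_on {0<..} (\<lambda>r. \<phi> r * r powr (\<gamma> - 2))"
    by (intro continuous_intros cont) auto
  fix c u :: real assume "0 < c" "0 < u"
  then have "set_integrable lborel {min c u<..} (\<lambda>s. \<phi> s * s powr (\<gamma> - 2))"
    using assms by (intro integrable_inf) auto
  then show "interval_lebesgue_integrable lborel (min \<infinity> (min (ereal c) (ereal u))) (max \<infinity> (max (ereal c) (ereal u)))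
           (\<lambda>r. \<phi> r * r powr (\<gamma> - 2))"
    using \<open>0 < c\<close> \<open>0 < u\<close>
    by (auto simp: interval_lebesgue_integrable_def min_def max_def split: if_splits)
qed

lemma moment_0_bound:
  assumes "1 < \<gamma>" "0 < r"
  shows "\<bar>moment \<gamma> 0 \<phi> r\<bar> \<le> M * (r powr (\<gamma> - 1) / (\<gamma> - 1))"
proof -
  have "\<bar>moment \<gamma> 0 \<phi> r\<bar> \<le> (LBINT s:{0<..<r}. \<bar>\<phi> s * s powr (\<gamma> - 2)\<bar>)"
    unfolding moment_0[OF assms(2)]
    using set_integral_norm_bound[OF integrable_0[OF assms]] by simp
  also have "\<dots> \<le> (LBINT s:{0<..<r}. M * s powr (\<gamma> - 2))"
    using assms powr_integral_from_0(1)[OF assms]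
    by (intro set_integral_mono set_integrable_abs integrable_0)
       (auto simp: abs_mult intro!: mult_right_mono bounded)
  finally show ?thesis using powr_integral_from_0(2)[OF assms] by simp
qed

lemma moment_inf_bound:
  assumes "\<gamma> < 1" "0 < r"
  shows "\<bar>moment \<gamma> \<infinity> \<phi> r\<bar> \<le> M * (r powr (\<gamma> - 1) / (1 - \<gamma>))"
proof -
  have "\<bar>moment \<gamma> \<infinity> \<phi> r\<bar> \<le> (LBINT s:{r<..}. \<bar>\<phi> s * s powr (\<gamma> - 2)\<bar>)"
    unfolding moment_inf
    using set_integral_norm_bound[OF integrable_inf[OF assms]] by simp
  also have "\<dots> \<le> (LBINT s:{r<..}. M * s powr (\<gamma> - 2))"
    using assms powr_integral_to_infinity(1)[OF assms]
    by (intro set_integral_mono set_integrable_abs integrable_inf)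
       (auto simp: abs_mult intro!: mult_right_mono bounded)
  finally show ?thesis using powr_integral_to_infinity(2)[OF assms] by simp
qed

end

section \<open>The two branches as solutions of Euler equations\<close>

lemma powr_at_top:
  fixes p :: real
  assumes "0 < p"
  shows "LIM x at_top. x powr p :> at_top"
proof -
  have "LIM x at_top. exp (p * ln x) :> at_top"
    using assms by (intro filterlim_compose[OF exp_at_top] filterlim_tendsto_pos_mult_at_top[OF tendsto_const _ ln_at_top])
  then show ?thesis
    by (rule filterlim_mono_eventually)
       (auto intro!: eventually_mono[OF eventually_gt_at_top[of 0]] simp: powr_def)
qed

lemma neg_powr_at_right_0:
  fixes p :: real
  assumes "p < 0"
  shows "LIM x at_right 0. x powr p :> at_top"
proof -
  have "LIM x at_top. x powr (- p) :> at_top" using assms by (intro powr_at_top) simp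
  then have "LIM x at_right 0. inverse x powr (- p) :> at_top"
    by (rule filterlim_compose[OF _ filterlim_inverse_at_top_right])
  then show ?thesis
    by (rule filterlim_mono_eventually)
       (auto simp: powr_def ln_inverse eventually_at_filter)
qed

context euler_exponents
begin

text \<open>
  This ties \<open>\<beta>\<close> to the inner integrals of the two branches and thereby yields the matching of their slopes.
\<close>

lemma beta_op_eq_moments:
  assumes "bounded_profile \<phi> M" "b > 0"
  shows "beta_op \<gamma>1 \<gamma>2 \<phi> b = 1 / (\<gamma>2 - \<gamma>1) *
     (\<gamma>2 * (\<gamma>2 - 1) * moment \<gamma>2 0 (\<lambda>s. \<phi> (b * s)) 1 - \<gamma>1 * (\<gamma>1 - 1) * moment \<gamma>1 \<infinity> (\<lambda>s. \<phi> (b * s)) 1)"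
proof -
  interpret bounded_profile "\<lambda>s. \<phi> (b * s)" M
    using assms unfolding bounded_profile_def
    by (auto intro!: continuous_on_compose2[of "{0<..}" \<phi>] continuous_intros)
  let ?f = "\<lambda>r. \<phi> (b * r) * dens \<gamma>1 \<gamma>2 r"
  let ?c = "1 / (\<gamma>2 - \<gamma>1)"
  define L where "L = (\<lambda>r. ?c * (\<gamma>2 * (\<gamma>2 - 1)) * (\<phi> (b * r) * r powr (\<gamma>2 - 2)))"
  define R where "R = (\<lambda>r. ?c * (\<gamma>1 * (\<gamma>1 - 1)) * (\<phi> (b * r) * r powr (\<gamma>1 - 2)))"
  have i: "set_integrable lborel {0<..<1} L" "set_integrable lborel {1<..} R"
    unfolding L_def R_def using \<gamma>1 \<gamma>2 by (intro set_integrable_mult_right integrable_0 integrable_inf; simp)+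
  have Lf: "indicator {0<..<1} r *\<^sub>R ?f r = indicator {0<..<1} r *\<^sub>R L r" 
     and Rf: "indicator {1<..} r *\<^sub>R ?f r = indicator {1<..} r *\<^sub>R R r" for r
    by (auto simp: L_def R_def dens_def indicator_def)
  have ii: "set_integrable lborel {0<..<1} ?f" "set_integrable lborel {1<..} ?f"
    using i unfolding set_integrable_def Lf Rf by auto
  have "beta_op \<gamma>1 \<gamma>2 \<phi> b = (LBINT r:{0<..}. ?f r)"
    unfolding beta_op_def by (simp add: interval_lebesgue_integral_def zero_ereal_def)
  also have "\<dots> = (LBINT r:{0<..<1}\<union>{1<..}. ?f r)"
    unfolding set_lebesgue_integral_def
  proof (rule integral_discrete_difference[where X="{1}"])
    fix r assume "r \<notin> {1::real}" 
    then show "indicator {0<..} r *\<^sub>R ?f r = indicator ({0<..<1}\<union>{1<..}) r *\<^sub>R ?f r"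
      by (auto simp: indicator_def)
  qed auto
  also have "\<dots> = (LBINT r:{0<..<1}. ?f r) + (LBINT r:{1<..}. ?f r)"
    by (rule set_integral_Un) (use ii in auto)
  also have "\<dots> = (LBINT r:{0<..<1}. L r) + (LBINT r:{1<..}. R r)"
    unfolding set_lebesgue_integral_def Lf Rf ..
  also have "\<dots> = ?c * (\<gamma>2 * (\<gamma>2 - 1)) * moment \<gamma>2 0 (\<lambda>s. \<phi> (b * s)) 1
      - ?c * (\<gamma>1 * (\<gamma>1 - 1)) * moment \<gamma>1 \<infinity> (\<lambda>s. \<phi> (b * s)) 1"
    unfolding L_def R_def moment_0[OF zero_less_one] moment_inf by simp
  finally show ?thesis by (simp only: right_diff_distrib[of "?c"] mult.assoc)
qed

end

text \<open>
  The product rule for \<open>(x / b) powr \<gamma> * N (x / b)\<close>, with the derivative of the first factor expressed through the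
  branch itself.
\<close>

definition T_branch_deriv ::
  "real \<Rightarrow> real \<Rightarrow> real \<Rightarrow> ereal \<Rightarrow> real \<Rightarrow> (real \<Rightarrow> real) \<Rightarrow> real \<Rightarrow> real" where
  "T_branch_deriv \<gamma>1 \<gamma>2 \<gamma> e b \<phi> x =
     \<gamma> / x * T_branch \<gamma>1 \<gamma>2 \<gamma> e b \<phi> x
     + \<gamma> * (1 - \<gamma>) / b * (x / b) powr (- \<gamma>) * moment \<gamma> e (\<lambda>s. \<phi> (b * s)) (x / b)"

text \<open>
  Variation of constants. In the second derivative the terms containing the inner integral cancel,
  because \<open>x powr \<gamma>\<close> and \<open>x powr (1 - \<gamma>)\<close> both solve the homogeneous equation \<open>x\<^sup>2 u'' = \<gamma> (\<gamma> - 1) u\<close>.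
\<close>

lemma T_branch_ode:
  assumes b: "b > 0" and x: "x > 0" and cont: "continuous_on {0<..} \<phi>"
    and m: "\<And>r. r > 0 \<Longrightarrow> (moment \<gamma> e (\<lambda>s. \<phi> (b * s)) has_real_derivative \<phi> (b * r) * r powr (\<gamma> - 2)) (at r)"
  shows "(T_branch \<gamma>1 \<gamma>2 \<gamma> e b \<phi> has_real_derivative T_branch_deriv \<gamma>1 \<gamma>2 \<gamma> e b \<phi> x) (at x)"
    and "(T_branch_deriv \<gamma>1 \<gamma>2 \<gamma> e b \<phi> has_real_derivative
            \<gamma> * (\<gamma> - 1) / x\<^sup>2 * (T_branch \<gamma>1 \<gamma>2 \<gamma> e b \<phi> x - \<phi> x)) (at x)"
proof -
  define \<mu> where "\<mu> = moment \<gamma> e (\<lambda>s. \<phi> (b * s))"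
  define N where "N = (\<lambda>y. beta_op \<gamma>1 \<gamma>2 \<phi> b + H_op \<gamma> e b \<phi> y)"
  let ?V = "T_branch \<gamma>1 \<gamma>2 \<gamma> e b \<phi>" and ?V' = "T_branch_deriv \<gamma>1 \<gamma>2 \<gamma> e b \<phi>"
  have contm: "continuous_on {0<..} \<mu>"
    unfolding \<mu>_def using m by (intro DERIV_atLeastAtMost_imp_continuous_on | meson greaterThan_iff DERIV_isCont continuous_at_imp_continuous_on)+
  have N: "(N has_real_derivative \<gamma> * (1 - \<gamma>) * (y powr (- 2 * \<gamma>) * \<mu> y)) (at y)" if "y > 0" for y
  proof -
    have c: "continuous_on {0<..} (\<lambda>r. r powr (- 2 * \<gamma>) * \<mu> r)"
      by (intro continuous_intros contm) auto
    have "((\<lambda>u. LBINT r=1..ereal u. r powr (- 2 * \<gamma>) * \<mu> r) has_real_derivative y powr (- 2 * \<gamma>) * \<mu> y) (at y)"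
    proof (rule interval_integral_has_real_derivative[OF c that])
      fix c u :: real assume "0 < c" "0 < u"
      then have "interval_lebesgue_integrable lborel (ereal (min 1 (min c u))) (ereal (max 1 (max c u))) (\<lambda>r. r powr (- 2 * \<gamma>) * \<mu> r)"
        by (intro interval_integrable_continuous_on continuous_on_subset[OF c]) auto
      then show "interval_lebesgue_integrable lborel (min 1 (min (ereal c) (ereal u))) (max 1 (max (ereal c) (ereal u))) (\<lambda>r. r powr (- 2 * \<gamma>) * \<mu> r)"
        by (auto simp: one_ereal_def min_def max_def)
    qed
    then have "((\<lambda>u. beta_op \<gamma>1 \<gamma>2 \<phi> b + \<gamma> * (1 - \<gamma>) * (LBINT r=1..ereal u. r powr (- 2 * \<gamma>) * \<mu> r)) has_real_derivative
       0 + \<gamma> * (1 - \<gamma>) * (y powr (- 2 * \<gamma>) * \<mu> y)) (at y)"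
      by (intro DERIV_add DERIV_const DERIV_cmult)
    then show ?thesis
      unfolding N_def H_op_def \<mu>_def moment_def by simp
  qed
  have V: "?V = (\<lambda>x. (x / b) powr \<gamma> * N (x / b))"
    by (simp add: fun_eq_iff T_branch_def N_def)
  have scale: "((\<lambda>x. x / b) has_real_derivative 1 / b) (at x)" for x
    by (rule DERIV_cdivide) (rule DERIV_ident)
  have pw: "((\<lambda>x. (x / b) powr p) has_real_derivative p / x * (x / b) powr p) (at x)" if "x > 0" for p x
    using DERIV_chain2[OF has_real_derivative_powr[of "x / b" p] scale] that b
    by (simp add: powr_diff)
  have V': "(?V has_real_derivative ?V' x) (at x)" if x: "x > 0" for x
  proof -
    have "((\<lambda>x. N (x / b)) has_real_derivative \<gamma> * (1 - \<gamma>) * ((x / b) powr (- 2 * \<gamma>) * \<mu> (x / b)) * (1 / b)) (at x)"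
      using x b by (intro DERIV_chain2[OF N scale]) auto
    from DERIV_mult[OF pw[OF x] this]
    have "(?V has_real_derivative
       \<gamma> / x * (x / b) powr \<gamma> * N (x / b) + \<gamma> * (1 - \<gamma>) * ((x / b) powr (- 2 * \<gamma>) * \<mu> (x / b)) * (1 / b) * (x / b) powr \<gamma>) (at x)"
      unfolding V .
    moreover have "(x / b) powr (- \<gamma>) = (x / b) powr (- 2 * \<gamma>) * (x / b) powr \<gamma>"
      by (simp flip: powr_add)
    ultimately show ?thesis
      unfolding T_branch_deriv_def V \<mu>_def[symmetric]
      by (elim DERIV_cong) (use x b in \<open>simp add: field_simps\<close>)
  qed
  show "(?V has_real_derivative ?V' x) (at x)" using V' x .
  have "((\<lambda>x. \<gamma> / x * ?V x) has_real_derivative (- \<gamma> / x\<^sup>2) * ?V x + ?V' x * (\<gamma> / x)) (at x)"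
    using x by (intro DERIV_mult V') (auto intro!: derivative_eq_intros simp: power2_eq_square)
  moreover have "((\<lambda>x. (x / b) powr (- \<gamma>) * \<mu> (x / b)) has_real_derivative
     (- \<gamma> / x * (x / b) powr (- \<gamma>)) * \<mu> (x / b) + (\<phi> (b * (x / b)) * (x / b) powr (\<gamma> - 2) * (1 / b)) * (x / b) powr (- \<gamma>)) (at x)"
    using x b m[of "x / b"] unfolding \<mu>_def by (intro DERIV_mult pw DERIV_chain2[OF _ scale]) auto
  ultimately have "((\<lambda>x. \<gamma> / x * ?V x + \<gamma> * (1 - \<gamma>) / b * ((x / b) powr (- \<gamma>) * \<mu> (x / b))) has_real_derivative
      ((- \<gamma> / x\<^sup>2) * ?V x + ?V' x * (\<gamma> / x)) + \<gamma> * (1 - \<gamma>) / b * ((- \<gamma> / x * (x / b) powr (- \<gamma>)) * \<mu> (x / b) +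
       (\<phi> (b * (x / b)) * (x / b) powr (\<gamma> - 2) * (1 / b)) * (x / b) powr (- \<gamma>))) (at x)"
    by (intro DERIV_add DERIV_cmult)
  moreover have "?V' = (\<lambda>x. \<gamma> / x * ?V x + \<gamma> * (1 - \<gamma>) / b * ((x / b) powr (- \<gamma>) * \<mu> (x / b)))"
    by (simp add: fun_eq_iff T_branch_deriv_def \<mu>_def)
  moreover have "((- \<gamma> / x\<^sup>2) * ?V x + ?V' x * (\<gamma> / x)) + \<gamma> * (1 - \<gamma>) / b * ((- \<gamma> / x * (x / b) powr (- \<gamma>)) * \<mu> (x / b) +
       (\<phi> (b * (x / b)) * (x / b) powr (\<gamma> - 2) * (1 / b)) * (x / b) powr (- \<gamma>))
     = \<gamma> * (\<gamma> - 1) / x\<^sup>2 * (?V x - \<phi> x)"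
  proof -
    have "(x / b) powr (\<gamma> - 2) * (x / b) powr (- \<gamma>) = (x / b) powr (real_of_int (- 2))"
      by (simp flip: powr_add)
    also have "\<dots> = b\<^sup>2 / x\<^sup>2"
      using x b by (subst powr_real_of_int) (auto simp: power_divide)
    finally have *: "(x / b) powr (\<gamma> - 2) * (x / b) powr (- \<gamma>) = b\<^sup>2 / x\<^sup>2" .
    have Q: "\<phi> (b * (x / b)) * (x / b) powr (\<gamma> - 2) * (1 / b) * (x / b) powr (- \<gamma>) = \<phi> x * b / x\<^sup>2"
    proof -
      have "\<phi> (b * (x / b)) * (x / b) powr (\<gamma> - 2) * (1 / b) * (x / b) powr (- \<gamma>)
          = \<phi> x / b * ((x / b) powr (\<gamma> - 2) * (x / b) powr (- \<gamma>))"
        using b by simp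
      then show ?thesis unfolding * using b by (simp add: power2_eq_square)
    qed
    show ?thesis
      unfolding T_branch_deriv_def \<mu>_def[symmetric] Q using x b by (simp add: field_simps power2_eq_square)
  qed
  ultimately show "(?V' has_real_derivative \<gamma> * (\<gamma> - 1) / x\<^sup>2 * (?V x - \<phi> x)) (at x)"
    by simp
qed

lemma T_branch_at_base:
  assumes "b > 0"
  shows "T_branch \<gamma>1 \<gamma>2 \<gamma> e b \<phi> b = beta_op \<gamma>1 \<gamma>2 \<phi> b"
    and "T_branch_deriv \<gamma>1 \<gamma>2 \<gamma> e b \<phi> b = (\<gamma> * beta_op \<gamma>1 \<gamma>2 \<phi> b + \<gamma> * (1 - \<gamma>) * moment \<gamma> e (\<lambda>s. \<phi> (b * s)) 1) / b"
proof -
  show *: "T_branch \<gamma>1 \<gamma>2 \<gamma> e b \<phi> b = beta_op \<gamma>1 \<gamma>2 \<phi> b"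
    using assms by (simp add: T_branch_def H_op_def one_ereal_def)
  show "T_branch_deriv \<gamma>1 \<gamma>2 \<gamma> e b \<phi> b = (\<gamma> * beta_op \<gamma>1 \<gamma>2 \<phi> b + \<gamma> * (1 - \<gamma>) * moment \<gamma> e (\<lambda>s. \<phi> (b * s)) 1) / b"
    using assms by (simp add: T_branch_deriv_def * field_simps)
qed

text \<open>
  Equality of the slopes is a linear equation for the common value of the branches at \<open>b\<close>, and its
  solution is \<open>\<beta>\<close>.
\<close>

lemma (in euler_exponents) T_branch_derivs_match:
  assumes "bounded_profile \<phi> M" "b > 0"
  shows "T_branch_deriv \<gamma>1 \<gamma>2 \<gamma>1 \<infinity> b \<phi> b = T_branch_deriv \<gamma>1 \<gamma>2 \<gamma>2 0 b \<phi> b"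
proof -
  define \<beta> m1 m2 where "\<beta> = beta_op \<gamma>1 \<gamma>2 \<phi> b" and "m1 = moment \<gamma>1 \<infinity> (\<lambda>s. \<phi> (b * s)) 1"
    and "m2 = moment \<gamma>2 0 (\<lambda>s. \<phi> (b * s)) 1"
  have "\<beta> * (\<gamma>2 - \<gamma>1) = \<gamma>2 * (\<gamma>2 - 1) * m2 - \<gamma>1 * (\<gamma>1 - 1) * m1"
    using beta_op_eq_moments[OF assms] \<gamma>1 \<gamma>2 by (simp add: \<beta>_def m1_def m2_def)
  then have "\<gamma>1 * \<beta> + \<gamma>1 * (1 - \<gamma>1) * m1 = \<gamma>2 * \<beta> + \<gamma>2 * (1 - \<gamma>2) * m2"
    by (simp add: algebra_simps)
  then show ?thesis
    unfolding T_branch_at_base(2)[OF assms(2)] \<beta>_def m1_def m2_def by simp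
qed

text \<open>
  L'Hopital's rule, applied to the inner integral divided by \<open>r powr (\<gamma> - 1)\<close> and then to the
  branch written as \<open>(x powr (- \<gamma>) * V x) / x powr (- \<gamma>)\<close>: the solution inherits the limit of the right-hand side.
\<close>

lemma T_branch_tendsto_at_top:
  assumes b: "b > 0" and \<gamma>: "\<gamma> < 0" and \<phi>: "bounded_profile \<phi> M" and lim: "(\<phi> \<longlongrightarrow> l) at_top"
  shows "(T_branch \<gamma>1 \<gamma>2 \<gamma> \<infinity> b \<phi> \<longlongrightarrow> l) at_top"
proof -
  interpret bounded_profile "\<lambda>s. \<phi> (b * s)" M
    using assms unfolding bounded_profile_def
    by (auto intro!: continuous_on_compose2[of "{0<..}" \<phi>] continuous_intros)
  have cont': "continuous_on {0<..} \<phi>" using \<phi> by (simp add: bounded_profile_def)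
  define \<mu> where "\<mu> = moment \<gamma> \<infinity> (\<lambda>s. \<phi> (b * s))"
  have m: "(\<mu> has_real_derivative \<phi> (b * r) * r powr (\<gamma> - 2)) (at r)" if "r > 0" for r
    unfolding \<mu>_def using \<gamma> that by (intro moment_inf_deriv) auto
  have pos: "eventually (\<lambda>r::real. r > 0) at_top" by (rule eventually_gt_at_top)
  have p0: "((\<lambda>r. r powr (\<gamma> - 1)) \<longlongrightarrow> 0) at_top"
    using \<gamma> by (intro tendsto_neg_powr filterlim_ident) auto
  have \<mu>0: "(\<mu> \<longlongrightarrow> 0) at_top"
  proof (rule Lim_null_comparison)
    show "eventually (\<lambda>r. norm (\<mu> r) \<le> M * (r powr (\<gamma> - 1) / (1 - \<gamma>))) at_top"
      using pos by eventually_elim (use moment_inf_bound \<gamma> in \<open>auto simp: \<mu>_def\<close>)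
    show "((\<lambda>r. M * (r powr (\<gamma> - 1) / (1 - \<gamma>))) \<longlongrightarrow> 0) at_top"
      using tendsto_mult_left[OF tendsto_divide[OF p0 tendsto_const[of "1 - \<gamma>"]], of M] \<gamma> by simp
  qed
  have blim: "((\<lambda>r. \<phi> (b * r)) \<longlongrightarrow> l) at_top"
    by (rule filterlim_compose[OF lim filterlim_tendsto_pos_mult_at_top[OF tendsto_const b filterlim_ident]])
  have \<mu>lim: "((\<lambda>r. \<mu> r / r powr (\<gamma> - 1)) \<longlongrightarrow> l / (\<gamma> - 1)) at_top"
  proof (rule lhopital_at_top_zero[OF \<mu>0 p0])
    show "eventually (\<lambda>r. DERIV \<mu> r :> \<phi> (b * r) * r powr (\<gamma> - 2)) at_top"
      using pos by eventually_elim (rule m)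
    show "eventually (\<lambda>r. DERIV (\<lambda>r. r powr (\<gamma> - 1)) r :> (\<gamma> - 1) * r powr (\<gamma> - 2)) at_top"
      using pos by eventually_elim (use has_real_derivative_powr[of _ "\<gamma> - 1"] in simp)
    show "eventually (\<lambda>r. (\<gamma> - 1) * r powr (\<gamma> - 2) \<noteq> 0) at_top"
      using pos by eventually_elim (use \<gamma> in simp)
    show "((\<lambda>r. \<phi> (b * r) * r powr (\<gamma> - 2) / ((\<gamma> - 1) * r powr (\<gamma> - 2))) \<longlongrightarrow> l / (\<gamma> - 1)) at_top"
      using \<gamma> by (intro Lim_transform_eventually[OF tendsto_divide[OF blim tendsto_const[of "\<gamma> - 1"]]]
         eventually_mono[OF pos]) auto
  qed (use pos in \<open>eventually_elim, simp\<close>)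
  define V where "V = T_branch \<gamma>1 \<gamma>2 \<gamma> \<infinity> b \<phi>"
  have V': "(V has_real_derivative T_branch_deriv \<gamma>1 \<gamma>2 \<gamma> \<infinity> b \<phi> x) (at x)" if "x > 0" for x
    unfolding V_def using m by (intro T_branch_ode[OF b that cont']) (auto simp: \<mu>_def)
  have "((\<lambda>x. (x powr (-\<gamma>) * V x) / x powr (-\<gamma>)) \<longlongrightarrow> l) at_top"
  proof (rule lhospital_at_top_at_top)
    show "LIM x at_top. x powr (-\<gamma>) :> at_top"
      using \<gamma> by (intro powr_at_top) auto
    show "eventually (\<lambda>x. DERIV (\<lambda>x. x powr (-\<gamma>)) x :> -\<gamma> * x powr (-\<gamma> - 1)) at_top"
      using pos by eventually_elim (use has_real_derivative_powr[of _ "-\<gamma>"] in simp)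
    show "eventually (\<lambda>x. -\<gamma> * x powr (-\<gamma> - 1) \<noteq> 0) at_top"
      using pos by eventually_elim (use \<gamma> in simp)
    show "eventually (\<lambda>x. DERIV (\<lambda>x. x powr (-\<gamma>) * V x) x :>
        x powr (-\<gamma>) * (\<gamma> * (1 - \<gamma>) / b * (x / b) powr (- \<gamma>) * \<mu> (x / b))) at_top"
      using pos
    proof eventually_elim
      case (elim x)
      show ?case
        by (rule DERIV_cong[OF DERIV_mult[OF has_real_derivative_powr[OF elim] V'[OF elim]]])
           (use elim in \<open>simp add: T_branch_deriv_def V_def \<mu>_def powr_diff algebra_simps\<close>)
    qed
    have "((\<lambda>x. \<mu> (x / b) / (x / b) powr (\<gamma> - 1)) \<longlongrightarrow> l / (\<gamma> - 1)) at_top"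
      using filterlim_compose[OF \<mu>lim, of "\<lambda>x. x / b" at_top]
        filterlim_tendsto_pos_mult_at_top[OF tendsto_const[of "1 / b"] _ filterlim_ident] b by simp
    then have "((\<lambda>x. (\<gamma> - 1) * (\<mu> (x / b) / (x / b) powr (\<gamma> - 1))) \<longlongrightarrow> (\<gamma> - 1) * (l / (\<gamma> - 1))) at_top"
      by (rule tendsto_mult_left)
    then have "((\<lambda>x. (\<gamma> - 1) * (\<mu> (x / b) / (x / b) powr (\<gamma> - 1))) \<longlongrightarrow> l) at_top"
      using \<gamma> by simp
    then show "((\<lambda>x. x powr (-\<gamma>) * (\<gamma> * (1 - \<gamma>) / b * (x / b) powr (- \<gamma>) * \<mu> (x / b)) / (-\<gamma> * x powr (-\<gamma> - 1))) \<longlongrightarrow> l) at_top"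
    proof (rule Lim_transform_eventually)
      show "eventually (\<lambda>x. (\<gamma> - 1) * (\<mu> (x / b) / (x / b) powr (\<gamma> - 1)) =
        x powr (-\<gamma>) * (\<gamma> * (1 - \<gamma>) / b * (x / b) powr (- \<gamma>) * \<mu> (x / b)) / (-\<gamma> * x powr (-\<gamma> - 1))) at_top"
        using pos
      proof eventually_elim
        case (elim x)
        have 1: "(x / b) powr (\<gamma> - 1) = (x / b) powr \<gamma> * b / x" "x powr (-\<gamma> - 1) = x powr (-\<gamma>) / x"
          "(x / b) powr (-\<gamma>) = 1 / (x / b) powr \<gamma>"
          using elim b by (simp_all add: powr_diff powr_minus field_simps)
        have 2: "(x / b) powr \<gamma> > 0" "x powr (-\<gamma>) > 0" using elim b by simp_all
        show ?case
          unfolding 1 using elim b \<gamma> 2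
          by (simp add: divide_simps del: powr_gt_zero) (simp add: algebra_simps)
      qed
    qed
  qed
  then show ?thesis
    unfolding V_def
    by (rule Lim_transform_eventually) (use pos in \<open>eventually_elim, simp\<close>)
qed

text \<open>
  The counterpart at \<open>0\<close>, where \<open>1 < \<gamma>\<close> makes the powers vanish or blow up in the same pattern.
\<close>

lemma T_branch_tendsto_at_right_0:
  assumes b: "b > 0" and \<gamma>: "1 < \<gamma>" and \<phi>: "bounded_profile \<phi> M" and lim: "(\<phi> \<longlongrightarrow> l) (at_right 0)"
  shows "(T_branch \<gamma>1 \<gamma>2 \<gamma> 0 b \<phi> \<longlongrightarrow> l) (at_right 0)"
proof -
  interpret bounded_profile "\<lambda>s. \<phi> (b * s)" M
    using assms unfolding bounded_profile_def
    by (auto intro!: continuous_on_compose2[of "{0<..}" \<phi>] continuous_intros)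
  have cont': "continuous_on {0<..} \<phi>" using \<phi> by (simp add: bounded_profile_def)
  define \<mu> where "\<mu> = moment \<gamma> 0 (\<lambda>s. \<phi> (b * s))"
  have m: "(\<mu> has_real_derivative \<phi> (b * r) * r powr (\<gamma> - 2)) (at r)" if "r > 0" for r
    unfolding \<mu>_def using \<gamma> that by (intro moment_0_deriv) auto
  have pos: "eventually (\<lambda>r::real. r > 0) (at_right 0)" by (simp add: eventually_at_filter)
  have p0: "((\<lambda>r. r powr (\<gamma> - 1)) \<longlongrightarrow> 0) (at_right 0)"
    using \<gamma> pos by (auto intro!: tendsto_eq_intros tendsto_powr' simp: eventually_at_filter)
  have scale: "filterlim (\<lambda>r. c * r) (at_right 0) (at_right 0)" if "c > 0" for c :: real
    using that by (auto simp: filterlim_at eventually_at_filter intro!: tendsto_eq_intros)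
  have \<mu>0: "(\<mu> \<longlongrightarrow> 0) (at_right 0)"
  proof (rule Lim_null_comparison)
    show "eventually (\<lambda>r. norm (\<mu> r) \<le> M * (r powr (\<gamma> - 1) / (\<gamma> - 1))) (at_right 0)"
      using pos by eventually_elim (use moment_0_bound \<gamma> in \<open>auto simp: \<mu>_def\<close>)
    show "((\<lambda>r. M * (r powr (\<gamma> - 1) / (\<gamma> - 1))) \<longlongrightarrow> 0) (at_right 0)"
      using tendsto_mult_left[OF tendsto_divide[OF p0 tendsto_const[of "\<gamma> - 1"]], of M] \<gamma> by simp
  qed
  have blim: "((\<lambda>r. \<phi> (b * r)) \<longlongrightarrow> l) (at_right 0)"
    by (rule filterlim_compose[OF lim scale[OF b]])
  have \<mu>lim: "((\<lambda>r. \<mu> r / r powr (\<gamma> - 1)) \<longlongrightarrow> l / (\<gamma> - 1)) (at_right 0)"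
  proof (rule lhopital_right[OF \<mu>0 p0])
    show "eventually (\<lambda>r. DERIV \<mu> r :> \<phi> (b * r) * r powr (\<gamma> - 2)) (at_right 0)"
      using pos by eventually_elim (rule m)
    show "eventually (\<lambda>r. DERIV (\<lambda>r. r powr (\<gamma> - 1)) r :> (\<gamma> - 1) * r powr (\<gamma> - 2)) (at_right 0)"
      using pos by eventually_elim (use has_real_derivative_powr[of _ "\<gamma> - 1"] in simp)
    show "eventually (\<lambda>r. (\<gamma> - 1) * r powr (\<gamma> - 2) \<noteq> 0) (at_right 0)"
      using pos by eventually_elim (use \<gamma> in simp)
    show "((\<lambda>r. \<phi> (b * r) * r powr (\<gamma> - 2) / ((\<gamma> - 1) * r powr (\<gamma> - 2))) \<longlongrightarrow> l / (\<gamma> - 1)) (at_right 0)"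
      using \<gamma> by (intro Lim_transform_eventually[OF tendsto_divide[OF blim tendsto_const[of "\<gamma> - 1"]]]
         eventually_mono[OF pos]) auto
  qed (use pos in \<open>eventually_elim, simp\<close>)
  define V where "V = T_branch \<gamma>1 \<gamma>2 \<gamma> 0 b \<phi>"
  have V': "(V has_real_derivative T_branch_deriv \<gamma>1 \<gamma>2 \<gamma> 0 b \<phi> x) (at x)" if "x > 0" for x
    unfolding V_def using m by (intro T_branch_ode[OF b that cont']) (auto simp: \<mu>_def)
  have "((\<lambda>x. (x powr (-\<gamma>) * V x) / x powr (-\<gamma>)) \<longlongrightarrow> l) (at_right 0)"
  proof (rule lhopital_right_at_top)
    show "LIM x at_right 0. x powr (-\<gamma>) :> at_top"
      using \<gamma> by (intro neg_powr_at_right_0) simp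
    show "eventually (\<lambda>x. DERIV (\<lambda>x. x powr (-\<gamma>)) x :> -\<gamma> * x powr (-\<gamma> - 1)) (at_right 0)"
      using pos by eventually_elim (use has_real_derivative_powr[of _ "-\<gamma>"] in simp)
    show "eventually (\<lambda>x. -\<gamma> * x powr (-\<gamma> - 1) \<noteq> 0) (at_right 0)"
      using pos by eventually_elim (use \<gamma> in simp)
    show "eventually (\<lambda>x. DERIV (\<lambda>x. x powr (-\<gamma>) * V x) x :>
        x powr (-\<gamma>) * (\<gamma> * (1 - \<gamma>) / b * (x / b) powr (- \<gamma>) * \<mu> (x / b))) (at_right 0)"
      using pos
    proof eventually_elim
      case (elim x)
      show ?case
        by (rule DERIV_cong[OF DERIV_mult[OF has_real_derivative_powr[OF elim] V'[OF elim]]])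
           (use elim in \<open>simp add: T_branch_deriv_def V_def \<mu>_def powr_diff algebra_simps\<close>)
    qed
    have "((\<lambda>x. \<mu> (x / b) / (x / b) powr (\<gamma> - 1)) \<longlongrightarrow> l / (\<gamma> - 1)) (at_right 0)"
      using filterlim_compose[OF \<mu>lim, of "\<lambda>x. x / b" "at_right 0"] scale[of "1 / b"] b by simp
    then have "((\<lambda>x. (\<gamma> - 1) * (\<mu> (x / b) / (x / b) powr (\<gamma> - 1))) \<longlongrightarrow> (\<gamma> - 1) * (l / (\<gamma> - 1))) (at_right 0)"
      by (rule tendsto_mult_left)
    then have "((\<lambda>x. (\<gamma> - 1) * (\<mu> (x / b) / (x / b) powr (\<gamma> - 1))) \<longlongrightarrow> l) (at_right 0)"
      using \<gamma> by simp
    then show "((\<lambda>x. x powr (-\<gamma>) * (\<gamma> * (1 - \<gamma>) / b * (x / b) powr (- \<gamma>) * \<mu> (x / b)) / (-\<gamma> * x powr (-\<gamma> - 1))) \<longlongrightarrow> l) (at_right 0)"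
    proof (rule Lim_transform_eventually)
      show "eventually (\<lambda>x. (\<gamma> - 1) * (\<mu> (x / b) / (x / b) powr (\<gamma> - 1)) =
        x powr (-\<gamma>) * (\<gamma> * (1 - \<gamma>) / b * (x / b) powr (- \<gamma>) * \<mu> (x / b)) / (-\<gamma> * x powr (-\<gamma> - 1))) (at_right 0)"
        using pos
      proof eventually_elim
        case (elim x)
        have 1: "(x / b) powr (\<gamma> - 1) = (x / b) powr \<gamma> * b / x" "x powr (-\<gamma> - 1) = x powr (-\<gamma>) / x"
          "(x / b) powr (-\<gamma>) = 1 / (x / b) powr \<gamma>"
          using elim b by (simp_all add: powr_diff powr_minus field_simps)
        have 2: "(x / b) powr \<gamma> > 0" "x powr (-\<gamma>) > 0" using elim b by simp_all
        show ?case
          unfolding 1 using elim b \<gamma> 2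
          by (simp add: divide_simps del: powr_gt_zero) (simp add: algebra_simps)
      qed
    qed
  qed
  then show ?thesis
    unfolding V_def
    by (rule Lim_transform_eventually) (use pos in \<open>eventually_elim, simp\<close>)
qed

section \<open>The density: Jensen's inequality and existence of roots\<close>

text \<open>
  Strict convexity of the power function, compared with its tangent at \<open>1\<close>.
\<close>

lemma powr_above_tangent:
  fixes p r :: real
  assumes p: "p < 0 \<or> 1 < p" and r: "0 < r" "r \<noteq> 1"
  shows "1 + p * (r - 1) < r powr p"
proof -
  have D: "((\<lambda>x. x powr p) has_real_derivative p * x powr (p - 1)) (at x)"
    "((\<lambda>x. p * x powr (p - 1)) has_real_derivative p * ((p - 1) * x powr (p - 2))) (at x)"
    if "x \<in> {min r 1..max r 1}" for x
    using that r has_real_derivative_powr[of x p] DERIV_cmult[OF has_real_derivative_powr[of x "p - 1"], of p]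
    by auto
  obtain \<xi> where \<xi>: "\<xi> \<in> {min r 1..max r 1}"
    "r powr p = 1 powr p + p * 1 powr (p - 1) * (r - 1) + p * ((p - 1) * \<xi> powr (p - 2)) / 2 * (r - 1)\<^sup>2"
    using second_order_Taylor[OF D, of _ _ 1 r] by force
  have "p * (p - 1) > 0" using p by (auto simp: zero_less_mult_iff)
  moreover have "\<xi> powr (p - 2) > 0" "(r - 1)\<^sup>2 > 0" using \<xi> r by (auto simp: min_def split: if_splits)
  ultimately have "p * ((p - 1) * \<xi> powr (p - 2)) / 2 * (r - 1)\<^sup>2 > 0"
    by (simp flip: mult.assoc)
  then show ?thesis using \<xi>(2) by simp
qed

context euler_exponents
begin

lemma beta_op_eq_set_integral:
  "beta_op \<gamma>1 \<gamma>2 \<phi> b = (LBINT r:{0<..}. \<phi> (b * r) * dens \<gamma>1 \<gamma>2 r)"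
  unfolding beta_op_def by (simp add: interval_lebesgue_integral_def zero_ereal_def)

lemma dens_nonneg: "0 \<le> dens \<gamma>1 \<gamma>2 r"
  using \<gamma>1 \<gamma>2 by (auto simp: dens_def mult_nonpos_nonpos)

lemma dens_pos: "0 < r \<Longrightarrow> r < 1 \<Longrightarrow> 0 < dens \<gamma>1 \<gamma>2 r"
  using \<gamma>1 \<gamma>2 by (auto simp: dens_def)

text \<open>
  The exponents \<open>p = 0\<close> and \<open>p = 1\<close> show that the density has mass one and mean one.
\<close>

lemma dens_power_integral:
  assumes p: "1 < \<gamma>2 + p" "\<gamma>1 + p < 1"
  shows "set_integrable lborel {0<..} (\<lambda>r. r powr p * dens \<gamma>1 \<gamma>2 r)"
    and "(LBINT r:{0<..}. r powr p * dens \<gamma>1 \<gamma>2 r) =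
      1 / (\<gamma>2 - \<gamma>1) * (\<gamma>2 * (\<gamma>2 - 1) / (\<gamma>2 + p - 1) + \<gamma>1 * (\<gamma>1 - 1) / (1 - \<gamma>1 - p))"
proof -
  let ?f = "\<lambda>r. r powr p * dens \<gamma>1 \<gamma>2 r"
  let ?c = "1 / (\<gamma>2 - \<gamma>1)"
  define L where "L = (\<lambda>r. ?c * (\<gamma>2 * (\<gamma>2 - 1)) * (r powr ((\<gamma>2 + p) - 2)))"
  define R where "R = (\<lambda>r. ?c * (\<gamma>1 * (\<gamma>1 - 1)) * (r powr ((\<gamma>1 + p) - 2)))"
  have i: "set_integrable lborel {0<..<1} L" "set_integrable lborel {1<..} R"
    unfolding L_def R_def using p
    by (intro set_integrable_mult_right powr_integral_from_0 powr_integral_to_infinity; simp)+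
  have Lf: "indicator {0<..<1} r *\<^sub>R ?f r = indicator {0<..<1} r *\<^sub>R L r" 
     and Rf: "indicator {1<..} r *\<^sub>R ?f r = indicator {1<..} r *\<^sub>R R r" for r
    by (auto simp: L_def R_def dens_def indicator_def simp flip: powr_add)
       (simp_all add: algebra_simps)
  have ii: "set_integrable lborel {0<..<1} ?f" "set_integrable lborel {1<..} ?f"
    using i unfolding set_integrable_def Lf Rf by auto
  have iU: "set_integrable lborel ({0<..<1}\<union>{1<..}) ?f"
    by (rule set_integrable_Un[OF ii]) auto
  have i1: "set_integrable lborel {1} ?f"
    using borel_integrable_atLeastAtMost'[of 1 1 ?f] by simp
  have eq: "{0<..} = {0<..<1}\<union>{1<..}\<union>{1::real}" by auto
  show "set_integrable lborel {0<..} ?f"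
    unfolding eq by (rule set_integrable_Un[OF iU i1]) auto
  have "(LBINT r:{0<..}. ?f r) = (LBINT r:{0<..<1}\<union>{1<..}. ?f r)"
    unfolding set_lebesgue_integral_def
  proof (rule integral_discrete_difference[where X="{1}"])
    fix r assume "r \<notin> {1::real}" 
    then show "indicator {0<..} r *\<^sub>R ?f r = indicator ({0<..<1}\<union>{1<..}) r *\<^sub>R ?f r"
      by (auto simp: indicator_def)
  qed auto
  also have "\<dots> = (LBINT r:{0<..<1}. ?f r) + (LBINT r:{1<..}. ?f r)"
    by (rule set_integral_Un) (use ii in auto)
  also have "\<dots> = (LBINT r:{0<..<1}. L r) + (LBINT r:{1<..}. R r)"
    unfolding set_lebesgue_integral_def Lf Rf ..
  also have "\<dots> = ?c * (\<gamma>2 * (\<gamma>2 - 1)) * (1 / (\<gamma>2 + p - 1)) + ?c * (\<gamma>1 * (\<gamma>1 - 1)) * (1 / (1 - (\<gamma>1 + p)))"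
    unfolding L_def R_def
    using powr_integral_from_0(2)[of "\<gamma>2 + p" 1] powr_integral_to_infinity(2)[of "\<gamma>1 + p" 1] p
    by (simp add: mult.commute)
  also have "\<dots> = ?c * (\<gamma>2 * (\<gamma>2 - 1) / (\<gamma>2 + p - 1) + \<gamma>1 * (\<gamma>1 - 1) / (1 - \<gamma>1 - p))"
    by (simp add: distrib_left diff_diff_eq)
  finally show "(LBINT r:{0<..}. ?f r) = \<dots>" .
qed

lemma dens_integral:
  "set_integrable lborel {0<..} (dens \<gamma>1 \<gamma>2)" "(LBINT r:{0<..}. dens \<gamma>1 \<gamma>2 r) = 1"
proof -
  have *: "indicator {0<..} r *\<^sub>R (r powr 0 * dens \<gamma>1 \<gamma>2 r) = indicator {0<..} r *\<^sub>R dens \<gamma>1 \<gamma>2 r" for r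
    by (auto simp: indicator_def)
  have c: "1 / (\<gamma>2 - \<gamma>1) * (\<gamma>2 * (\<gamma>2 - 1) / (\<gamma>2 + 0 - 1) + \<gamma>1 * (\<gamma>1 - 1) / (1 - \<gamma>1 - 0)) = 1"
  proof -
    have "\<gamma>1 * (\<gamma>1 - 1) / (1 - \<gamma>1) = - \<gamma>1" using \<gamma>1 by (simp add: field_simps)
    then show ?thesis using \<gamma>1 \<gamma>2 by simp
  qed
  show "set_integrable lborel {0<..} (dens \<gamma>1 \<gamma>2)" "(LBINT r:{0<..}. dens \<gamma>1 \<gamma>2 r) = 1"
    using dens_power_integral[of 0] \<gamma>1 \<gamma>2
    unfolding set_integrable_def set_lebesgue_integral_def * c by auto
qed

lemma dens_mean:
  "set_integrable lborel {0<..} (\<lambda>r. r * dens \<gamma>1 \<gamma>2 r)" "(LBINT r:{0<..}. r * dens \<gamma>1 \<gamma>2 r) = 1"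
proof -
  have *: "indicator {0<..} r *\<^sub>R (r powr 1 * dens \<gamma>1 \<gamma>2 r) = indicator {0<..} r *\<^sub>R (r * dens \<gamma>1 \<gamma>2 r)" for r
    by (auto simp: indicator_def)
  have c: "1 / (\<gamma>2 - \<gamma>1) * (\<gamma>2 * (\<gamma>2 - 1) / (\<gamma>2 + 1 - 1) + \<gamma>1 * (\<gamma>1 - 1) / (1 - \<gamma>1 - 1)) = 1"
  proof -
    have "\<gamma>1 * (\<gamma>1 - 1) / (1 - \<gamma>1 - 1) = 1 - \<gamma>1" using \<gamma>1 by (simp add: field_simps)
    then show ?thesis using \<gamma>1 \<gamma>2 by simp
  qed
  show "set_integrable lborel {0<..} (\<lambda>r. r * dens \<gamma>1 \<gamma>2 r)" "(LBINT r:{0<..}. r * dens \<gamma>1 \<gamma>2 r) = 1"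
    using dens_power_integral[of 1] \<gamma>1 \<gamma>2
    unfolding set_integrable_def set_lebesgue_integral_def * c by auto
qed

lemma integrable_mult_dens:
  assumes "bounded_profile \<phi> M" "b > 0"
  shows "set_integrable lborel {0<..} (\<lambda>r. \<phi> (b * r) * dens \<gamma>1 \<gamma>2 r)"
  using assms unfolding bounded_profile_def
  by (intro set_integrable_bounded_mult[OF dens_integral(1), of "{0<..}" _ M])
     (auto intro!: continuous_on_compose2[of "{0<..}" \<phi>] continuous_intros)

lemma beta_op_complement:
  assumes "bounded_profile \<phi> M" "b > 0"
  shows "beta_op \<gamma>1 \<gamma>2 (\<lambda>x. 1 - \<phi> x) b = 1 - beta_op \<gamma>1 \<gamma>2 \<phi> b"
  unfolding beta_op_eq_set_integral
  using set_integral_diff(2)[OF dens_integral(1) integrable_mult_dens[OF assms]] dens_integral(2)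
  by (simp add: left_diff_distrib)

lemma continuous_on_beta_op:
  assumes \<phi>: "bounded_profile \<phi> M"
  shows "continuous_on {0<..} (beta_op \<gamma>1 \<gamma>2 \<phi>)"
  unfolding continuous_on_sequentially
proof (intro allI ballI impI, elim conjE)
  fix x :: "nat \<Rightarrow> real" and a :: real
  assume a: "a \<in> {0<..}" and x: "\<forall>n. x n \<in> {0<..}" and lim: "x \<longlonglongrightarrow> a"
  note \<phi>' = \<phi>[unfolded bounded_profile_def]
  show "(beta_op \<gamma>1 \<gamma>2 \<phi> \<circ> x) \<longlonglongrightarrow> beta_op \<gamma>1 \<gamma>2 \<phi> a"
    unfolding comp_def beta_op_eq_set_integral set_lebesgue_integral_def
  proof (rule integral_dominated_convergence[where w = "\<lambda>r. \<bar>M\<bar> * (indicator {0<..} r *\<^sub>R dens \<gamma>1 \<gamma>2 r)"])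
    show "integrable lborel (\<lambda>r. \<bar>M\<bar> * (indicator {0<..} r *\<^sub>R dens \<gamma>1 \<gamma>2 r))"
      using dens_integral(1) unfolding set_integrable_def by simp
    show "(\<lambda>r. indicator {0<..} r *\<^sub>R (\<phi> (a * r) * dens \<gamma>1 \<gamma>2 r)) \<in> borel_measurable lborel"
      "(\<lambda>r. indicator {0<..} r *\<^sub>R (\<phi> (x n * r) * dens \<gamma>1 \<gamma>2 r)) \<in> borel_measurable lborel" for n
      using integrable_mult_dens[OF \<phi>] a x unfolding set_integrable_def
      by (auto intro: borel_measurable_integrable)
    show "AE r in lborel. norm (indicator {0<..} r *\<^sub>R (\<phi> (x n * r) * dens \<gamma>1 \<gamma>2 r))
        \<le> \<bar>M\<bar> * (indicator {0<..} r *\<^sub>R dens \<gamma>1 \<gamma>2 r)" for n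
    proof (rule AE_I2)
      fix r :: real
      have "\<bar>\<phi> (x n * r)\<bar> \<le> \<bar>M\<bar>" if "r > 0"
        using \<phi>' x that by (metis abs_ge_self greaterThan_iff mult_pos_pos order.trans)
      then show "norm (indicator {0<..} r *\<^sub>R (\<phi> (x n * r) * dens \<gamma>1 \<gamma>2 r))
        \<le> \<bar>M\<bar> * (indicator {0<..} r *\<^sub>R dens \<gamma>1 \<gamma>2 r)"
        using dens_nonneg by (auto simp: indicator_def abs_mult intro!: mult_right_mono)
    qed
    have "(\<lambda>n. \<phi> (x n * r)) \<longlonglongrightarrow> \<phi> (a * r)" if "r > 0" for r
      using \<phi>' lim a x that
      by (intro continuous_on_tendsto_compose[of "{0<..}" \<phi>] tendsto_intros) auto
    then show "AE r in lborel. (\<lambda>n. indicator {0<..} r *\<^sub>R (\<phi> (x n * r) * dens \<gamma>1 \<gamma>2 r))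
        \<longlonglongrightarrow> indicator {0<..} r *\<^sub>R (\<phi> (a * r) * dens \<gamma>1 \<gamma>2 r)"
      by (intro AE_I2) (auto simp: indicator_def intro!: tendsto_intros)
  qed
qed

text \<open>
  Since the density has mass one and mean one, the tangent of \<open>r powr p\<close> at \<open>1\<close> integrates to one. The power lies strictly above
  this tangent except at \<open>1\<close>.
\<close>

lemma strict_Jensen_powr:
  assumes p: "p < 0 \<or> 1 < p"
    and int: "set_integrable lborel {0<..} (\<lambda>r. r powr p * dens \<gamma>1 \<gamma>2 r)"
  shows "1 < (LBINT r:{0<..}. r powr p * dens \<gamma>1 \<gamma>2 r)"
proof (rule ccontr)
  assume contr: "\<not> ?thesis"
  define L where "L = (\<lambda>r. (1 - p) * dens \<gamma>1 \<gamma>2 r + p * (r * dens \<gamma>1 \<gamma>2 r))"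
  define K where "K = (\<lambda>r. indicator {0<..} r *\<^sub>R (r powr p * dens \<gamma>1 \<gamma>2 r - L r))"
  have L: "set_integrable lborel {0<..} L"
    unfolding L_def using dens_integral(1) dens_mean(1) by (intro set_integral_add set_integrable_mult_right)
  have "(LBINT r:{0<..}. L r) = (1 - p) * (LBINT r:{0<..}. dens \<gamma>1 \<gamma>2 r) + p * (LBINT r:{0<..}. r * dens \<gamma>1 \<gamma>2 r)"
    unfolding L_def set_integral_mult_right[symmetric]
    by (rule set_integral_add(2)) (intro set_integrable_mult_right dens_integral(1) dens_mean(1))+
  then have "(LBINT r:{0<..}. L r) = 1"
    unfolding dens_integral(2) dens_mean(2) by simp
  then have K1: "integral\<^sup>L lborel K \<le> 0"
    using set_integral_diff(2)[OF int L] contr unfolding K_def set_lebesgue_integral_def by simp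
  have intK: "integrable lborel K"
    using set_integral_diff(1)[OF int L] unfolding K_def set_integrable_def .
  have Kr: "K r = (r powr p - (1 + p * (r - 1))) * dens \<gamma>1 \<gamma>2 r" if "r > 0" for r
    using that by (simp add: K_def L_def algebra_simps)
  have K0: "0 \<le> K r" for r
  proof (cases "r > 0")
    case True
    then show ?thesis
      using powr_above_tangent[OF p True] dens_nonneg[of r] unfolding Kr[OF True]
      by (cases "r = 1") auto
  qed (simp add: K_def)
  have "integral\<^sup>L lborel K = 0"
    using K1 K0 by (intro antisym integral_nonneg_AE) auto
  then have AE: "AE r in lborel. K r = 0"
    using integral_nonneg_eq_0_iff_AE[OF intK] K0 by simp
  have "AE r in lborel. r \<notin> {0<..<1::real}"
    using AE
  proof eventually_elim
    case (elim r)
    show ?case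
    proof
      assume r: "r \<in> {0<..<1}"
      then have "K r > 0" using powr_above_tangent[OF p, of r] dens_pos[of r] by (simp add: Kr)
      then show False using elim by simp
    qed
  qed
  then have "emeasure lborel {0<..<1::real} = 0"
    by (subst (asm) AE_iff_measurable[of "{0<..<1}"]) auto
  then show False by simp
qed

text \<open>
  By Fatou's lemma, \<open>\<beta>[\<phi>] (x n) \<le> \<phi> (x n)\<close> for all \<open>n\<close> would bound the \<open>p\<close>-th moment of the density by one,
  against Jensen's inequality. The moment may be infinite, so integrability has to be part of the conclusion drawn from
  Fatou's lemma.
\<close>

lemma beta_op_exceeds:
  fixes x :: "nat \<Rightarrow> real"
  assumes \<phi>: "bounded_profile \<phi> M" and nonneg: "\<And>r. r > 0 \<Longrightarrow> 0 \<le> \<phi> r"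
    and x: "\<And>n. x n > 0" and pos: "\<And>n. \<phi> (x n) > 0"
    and p: "p < 0 \<or> 1 < p"
    and lim: "\<And>r. r > 0 \<Longrightarrow> (\<lambda>n. \<phi> (x n * r) / \<phi> (x n)) \<longlonglongrightarrow> r powr p"
  shows "\<exists>n. \<phi> (x n) < beta_op \<gamma>1 \<gamma>2 \<phi> (x n)"
proof (rule ccontr)
  assume contr: "\<not> ?thesis"
  define u where "u = (\<lambda>n r. indicator {0<..} r *\<^sub>R (\<phi> (x n * r) * dens \<gamma>1 \<gamma>2 r) / \<phi> (x n))"
  define v where "v = (\<lambda>r. indicator {0<..} r *\<^sub>R (r powr p * dens \<gamma>1 \<gamma>2 r))"
  have int: "integrable lborel (u n)" for n
    using integrable_mult_dens[OF \<phi> x] unfolding u_def set_integrable_def by simp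
  have u0: "0 \<le> u n r" for n r
    using nonneg x pos[of n] dens_nonneg by (auto simp: u_def indicator_def)
  have nnu: "(\<integral>\<^sup>+ r. ennreal (u n r) \<partial>lborel) \<le> 1" for n
  proof -
    have "(\<integral>\<^sup>+ r. ennreal (u n r) \<partial>lborel) = ennreal (integral\<^sup>L lborel (u n))"
      using int u0 by (intro nn_integral_eq_integral) auto
    also have "integral\<^sup>L lborel (u n) = beta_op \<gamma>1 \<gamma>2 \<phi> (x n) / \<phi> (x n)"
      unfolding u_def beta_op_eq_set_integral set_lebesgue_integral_def by simp
    also have "ennreal \<dots> \<le> ennreal 1"
      using contr pos[of n] by (intro ennreal_leI) (auto simp: not_less)
    finally show ?thesis by simp
  qed
  have ulim: "(\<lambda>n. u n r) \<longlonglongrightarrow> v r" for r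
  proof (cases "r > 0")
    case True
    have "(\<lambda>n. \<phi> (x n * r) / \<phi> (x n) * dens \<gamma>1 \<gamma>2 r) \<longlonglongrightarrow> r powr p * dens \<gamma>1 \<gamma>2 r"
      by (intro tendsto_mult lim True tendsto_const)
    then show ?thesis using True by (simp add: u_def v_def)
  qed (simp add: u_def v_def)
  have liminf: "liminf (\<lambda>n. ennreal (u n r)) = ennreal (v r)" for r
    by (intro lim_imp_Liminf tendsto_ennrealI ulim) simp
  have vmeas: "v \<in> borel_measurable lborel"
    by (rule borel_measurable_LIMSEQ_metric[OF _ ulim]) (use int in auto)
  have v0: "0 \<le> v r" for r
    using dens_nonneg by (auto simp: v_def indicator_def)
  have "(\<integral>\<^sup>+ r. ennreal (v r) \<partial>lborel) \<le> liminf (\<lambda>n. \<integral>\<^sup>+ r. ennreal (u n r) \<partial>lborel)"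
    using nn_integral_liminf[of "\<lambda>n r. ennreal (u n r)" lborel] int unfolding liminf by auto
  also have "\<dots> \<le> liminf (\<lambda>n. 1)"
    by (intro Liminf_mono always_eventually allI nnu)
  finally have nnv: "(\<integral>\<^sup>+ r. ennreal (v r) \<partial>lborel) \<le> 1" by (simp add: Liminf_const)
  then have "(\<integral>\<^sup>+ r. ennreal (v r) \<partial>lborel) < \<infinity>"
    by (rule order.strict_trans1) simp
  then have iv: "integrable lborel v"
    using vmeas v0 by (intro integrableI_nonneg) auto
  then have "1 < integral\<^sup>L lborel v"
    using strict_Jensen_powr[OF p] unfolding v_def set_integrable_def set_lebesgue_integral_def by simp
  moreover have "ennreal (integral\<^sup>L lborel v) \<le> 1"
    using nn_integral_eq_integral[OF iv] v0 nnv by simp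
  ultimately show False by simp
qed

lemma beta_op_root:
  assumes \<phi>: "bounded_profile \<phi> M" and s: "0 < s" "s \<le> S"
    and "\<phi> s < beta_op \<gamma>1 \<gamma>2 \<phi> s" "beta_op \<gamma>1 \<gamma>2 \<phi> S < \<phi> S"
  shows "\<exists>b>0. beta_op \<gamma>1 \<gamma>2 \<phi> b = \<phi> b"
proof -
  have "continuous_on {s..S} (\<lambda>b. beta_op \<gamma>1 \<gamma>2 \<phi> b - \<phi> b)"
  proof (rule continuous_on_diff)
    have sub: "{s..S} \<subseteq> {0<..}" using s by auto
    show "continuous_on {s..S} (beta_op \<gamma>1 \<gamma>2 \<phi>)"
      by (rule continuous_on_subset[OF continuous_on_beta_op[OF \<phi>] sub])
    show "continuous_on {s..S} \<phi>"
      by (rule continuous_on_subset[OF bounded_profile.cont[OF \<phi>] sub])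
  qed
  then obtain b where "s \<le> b" "b \<le> S" "beta_op \<gamma>1 \<gamma>2 \<phi> b - \<phi> b = 0"
    using IVT2'[of "\<lambda>b. beta_op \<gamma>1 \<gamma>2 \<phi> b - \<phi> b" S 0 s] assms by auto
  then show ?thesis using s by (intro exI[of _ b]) auto
qed

end

section \<open>The switched equation: signs, shape and uniqueness\<close>

text \<open>
  The equation makes the second derivative negative where \<open>u < g\<close>, and this is an open condition.
\<close>

lemma ode_locally_strictly_concave:
  fixes u u' g c :: "real \<Rightarrow> real"
  assumes S: "open S"
    and u: "\<And>x. x \<in> S \<Longrightarrow> (u has_real_derivative u' x) (at x)"
    and u': "\<And>x. x \<in> S \<Longrightarrow> (u' has_real_derivative c x * (u x - g x)) (at x)"
    and c: "\<And>x. x \<in> S \<Longrightarrow> 0 < c x" and g: "continuous_on S g"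
    and x: "x \<in> S" "u x < g x"
  shows "\<exists>e>0. \<forall>t. 0 < t \<longrightarrow> t < e \<longrightarrow> u (x - t) + u (x + t) < 2 * u x"
proof -
  have "continuous_on S u"
    using u by (meson DERIV_isCont continuous_at_imp_continuous_on)
  then have "continuous_on S (\<lambda>x. g x - u x)" by (intro continuous_intros g)
  then have "open {y \<in> S. 0 < g y - u y}"
    using S continuous_open_preimage[of S "\<lambda>x. g x - u x" "{0<..}"]
    by (simp add: vimage_def Int_def)
  then obtain e where e: "e > 0" "\<And>y. dist y x < e \<Longrightarrow> y \<in> S \<and> 0 < g y - u y"
    using x unfolding open_dist by (metis (mono_tags, lifting) diff_gt_0_iff_gt mem_Collect_eq)
  have "strictly_concave_on {x - e<..<x + e} u"
  proof (rule strictly_concave_onI)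
    fix y assume "y \<in> {x - e<..<x + e}"
    then have y: "y \<in> S" "0 < g y - u y" using e(2)[of y] by (auto simp: dist_real_def)
    show "(u has_real_derivative u' y) (at y)" "(u' has_real_derivative c y * (u y - g y)) (at y)"
      using y u u' by auto
    show "c y * (u y - g y) < 0" using y c by (simp add: mult_pos_neg)
  qed simp
  then have "2 * (- u x) < - u (x - t) + - u (x + t)" if "0 < t" "t < e" for t
    using that unfolding strictly_concave_on_def by (rule_tac strictly_convex_on_midpoint) auto
  then show ?thesis using e(1) by (intro exI[of _ e]) fastforce
qed

lemma ode_locally_strictly_convex:
  fixes u u' g c :: "real \<Rightarrow> real"
  assumes S: "open S"
    and u: "\<And>x. x \<in> S \<Longrightarrow> (u has_real_derivative u' x) (at x)"
    and u': "\<And>x. x \<in> S \<Longrightarrow> (u' has_real_derivative c x * (u x - g x)) (at x)"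
    and c: "\<And>x. x \<in> S \<Longrightarrow> 0 < c x" and g: "continuous_on S g"
    and x: "x \<in> S" "g x < u x"
  shows "\<exists>e>0. \<forall>t. 0 < t \<longrightarrow> t < e \<longrightarrow> 2 * u x < u (x - t) + u (x + t)"
proof -
  have "\<exists>e>0. \<forall>t. 0 < t \<longrightarrow> t < e \<longrightarrow> - u (x - t) + - u (x + t) < 2 * - u x"
  proof (rule ode_locally_strictly_concave[where u = "\<lambda>x. - u x" and u' = "\<lambda>x. - u' x" and g = "\<lambda>x. - g x" and c = c, OF S])
    fix y assume y: "y \<in> S"
    show "((\<lambda>x. - u x) has_real_derivative - u' y) (at y)"
      by (rule DERIV_minus[OF u[OF y]])
    show "((\<lambda>x. - u' x) has_real_derivative c y * (- u y - - g y)) (at y)"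
      using DERIV_minus[OF u'[OF y]] by (simp add: algebra_simps)
  qed (use c x g in \<open>auto intro: continuous_intros\<close>)
  then show ?thesis by fastforce
qed

context euler_exponents
begin

text \<open>
  The coefficient in \<open>u'' = diffusion_coeff b x * (u - g)\<close>; it jumps at the switching point \<open>b\<close>, but there the other
  factor vanishes.
\<close>

definition diffusion_coeff :: "real \<Rightarrow> real \<Rightarrow> real" where
  "diffusion_coeff b x = (if x \<le> b then \<gamma>2 * (\<gamma>2 - 1) else \<gamma>1 * (\<gamma>1 - 1)) / x\<^sup>2"

lemma diffusion_coeff_pos: "0 < x \<Longrightarrow> 0 < diffusion_coeff b x"
  using \<gamma>1 \<gamma>2 by (simp add: diffusion_coeff_def mult_neg_neg)

lemma diffusion_coeff_locally_bounded:
  assumes "0 < p"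
  shows "\<exists>C. eventually (\<lambda>x. diffusion_coeff b x \<le> C) (nhds p)"
proof -
  let ?K = "\<gamma>2 * (\<gamma>2 - 1) + \<gamma>1 * (\<gamma>1 - 1)"
  have "eventually (\<lambda>x. p / 2 < x) (nhds p)"
    using assms by (intro order_tendstoD[OF filterlim_ident]) auto
  then have "eventually (\<lambda>x. diffusion_coeff b x \<le> ?K / (p / 2)\<^sup>2) (nhds p)"
  proof eventually_elim
    case (elim x)
    have "(if x \<le> b then \<gamma>2 * (\<gamma>2 - 1) else \<gamma>1 * (\<gamma>1 - 1)) \<le> ?K" "0 \<le> ?K"
      using \<gamma>1 \<gamma>2 by (auto simp: mult_nonpos_nonpos)
    moreover have "(p / 2)\<^sup>2 \<le> x\<^sup>2" using elim assms by (intro power_mono) auto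
    ultimately show ?case
      unfolding diffusion_coeff_def using assms by (intro frac_le) auto
  qed
  then show ?thesis ..
qed

end

text \<open>
  The properties that each iterate passes on to the next one. The intervals are open so that strict convexity and
  concavity of an iterate, which come from the sign of its second derivative, apply directly. The decay \<open>g x / x \<rightarrow> 0\<close> at \<open>0\<close> excludes functions that are linear near
  \<open>0\<close>, for which \<open>u = g\<close> would be possible there.
\<close>

locale s_shaped = euler_exponents +
  fixes g :: "real \<Rightarrow> real" and b0 :: real
  assumes g_cont: "continuous_on {0..} g" and g_0: "g 0 = 0" and g_lim: "(g \<longlongrightarrow> 1) at_top"
    and g_nonneg: "\<And>x. 0 \<le> x \<Longrightarrow> 0 \<le> g x" and g_le_1: "\<And>x. 0 \<le> x \<Longrightarrow> g x \<le> 1"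
    and b0: "0 < b0"
    and g_convex: "convex_on {0<..<b0} g" and g_concave: "concave_on {b0<..} g"
    and g_sublinear: "((\<lambda>x. g x / x) \<longlongrightarrow> 0) (at_right 0)"

text \<open>
  Bounded solutions of the switched equation that are \<open>C\<^sup>2\<close> across \<open>b\<close>. The assumption \<open>u b = g b\<close> is the root condition
  \<open>\<beta>[g](b) = g b\<close>, since \<open>\<beta>[g](b)\<close> is the value of \<open>u\<close> at \<open>b\<close>.
\<close>

locale switched_solution = s_shaped +
  fixes b :: real and u u' :: "real \<Rightarrow> real"
  assumes b: "0 < b" and u_0: "u 0 = 0" and u_b: "u b = g b"
    and u_lim_0: "(u \<longlongrightarrow> 0) (at_right 0)" and u_lim: "(u \<longlongrightarrow> 1) at_top"
    and u_deriv: "\<And>x. 0 < x \<Longrightarrow> (u has_real_derivative u' x) (at x)"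
    and u'_deriv: "\<And>x. 0 < x \<Longrightarrow> (u' has_real_derivative diffusion_coeff b x * (u x - g x)) (at x)"
begin

lemma g_cont_pos: "continuous_on {0<..} g"
  using g_cont by (rule continuous_on_subset) auto

lemma u_cont: "continuous_on {0..} u"
  unfolding continuous_on_eq_continuous_within
proof
  fix x :: real assume "x \<in> {0..}"
  show "continuous (at x within {0..}) u"
  proof (cases "x = 0")
    case True
    have "at 0 within {0..} = at_right (0::real)"
      by (rule at_within_Ici_at_right)
    then show ?thesis using u_lim_0 u_0 True by (simp add: continuous_within)
  next
    case False
    then show ?thesis
      using \<open>x \<in> {0..}\<close> DERIV_isCont[OF u_deriv[of x]] by (auto intro: continuous_at_imp_continuous_within)
  qed
qed

lemma u_local_concave:
  "0 < x \<Longrightarrow> u x < g x \<Longrightarrow> \<exists>e>0. \<forall>t. 0 < t \<longrightarrow> t < e \<longrightarrow> u (x - t) + u (x + t) < 2 * u x"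
  using u_deriv u'_deriv diffusion_coeff_pos g_cont_pos
  by (intro ode_locally_strictly_concave[of "{0<..}" u u' "diffusion_coeff b" g]) auto

lemma u_local_convex:
  "0 < x \<Longrightarrow> g x < u x \<Longrightarrow> \<exists>e>0. \<forall>t. 0 < t \<longrightarrow> t < e \<longrightarrow> 2 * u x < u (x - t) + u (x + t)"
  using u_deriv u'_deriv diffusion_coeff_pos g_cont_pos
  by (intro ode_locally_strictly_convex[of "{0<..}" u u' "diffusion_coeff b" g]) auto

lemma touching_above:
  assumes S: "open S" "connected S" "S \<subseteq> {0<..}" and k: "concave_on S k"
    and "\<And>x. x \<in> S \<Longrightarrow> g x \<le> k x" "\<And>x. x \<in> S \<Longrightarrow> u x \<le> k x"
    and "p \<in> S" "u p = k p" "x \<in> S"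
  shows "u x = k x"
proof (rule concave_touching_eq[OF S(1,2) k, where u' = u' and u'' = "\<lambda>x. diffusion_coeff b x * (u x - g x)" and c = "diffusion_coeff b"])
  fix y assume y: "y \<in> S"
  then have "0 < y" using S by auto
  then show "(u has_real_derivative u' y) (at y)"
    "(u' has_real_derivative diffusion_coeff b y * (u y - g y)) (at y)" "0 \<le> diffusion_coeff b y"
    "\<exists>C. \<forall>\<^sub>F x in nhds y. diffusion_coeff b x \<le> C"
    using u_deriv u'_deriv diffusion_coeff_pos[of y b] diffusion_coeff_locally_bounded by auto
  then show "diffusion_coeff b y * (u y - k y) \<le> diffusion_coeff b y * (u y - g y)"
    using assms(5)[OF y] by (intro mult_left_mono) auto
qed (use assms in auto)

lemma touching_below:
  assumes S: "open S" "connected S" "S \<subseteq> {0<..}" and k: "convex_on S k"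
    and "\<And>x. x \<in> S \<Longrightarrow> k x \<le> g x" "\<And>x. x \<in> S \<Longrightarrow> k x \<le> u x"
    and "p \<in> S" "u p = k p" "x \<in> S"
  shows "u x = k x"
proof -
  have "- u x = - k x"
  proof (rule concave_touching_eq[OF S(1,2), where g = "\<lambda>x. - k x" and u = "\<lambda>x. - u x" and u' = "\<lambda>x. - u' x"
      and u'' = "\<lambda>x. - (diffusion_coeff b x * (u x - g x))" and c = "diffusion_coeff b"])
    show "concave_on S (\<lambda>x. - k x)" using k by (simp add: concave_on_def)
    fix y assume y: "y \<in> S"
    then have "0 < y" using S by auto
    then show "((\<lambda>x. - u x) has_real_derivative - u' y) (at y)"
      "((\<lambda>x. - u' x) has_real_derivative - (diffusion_coeff b y * (u y - g y))) (at y)" "0 \<le> diffusion_coeff b y"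
      "\<exists>C. \<forall>\<^sub>F x in nhds y. diffusion_coeff b x \<le> C"
      using DERIV_minus[OF u_deriv] DERIV_minus[OF u'_deriv] diffusion_coeff_pos[of y b] diffusion_coeff_locally_bounded by auto
    then have "diffusion_coeff b y * (g y - u y) \<ge> diffusion_coeff b y * (k y - u y)"
      using assms(5)[OF y] by (intro mult_left_mono) auto
    then show "diffusion_coeff b y * (- u y - - k y) \<le> - (diffusion_coeff b y * (u y - g y))"
      by (simp add: algebra_simps)
  qed (use assms in auto)
  then show ?thesis by simp
qed

text \<open>
  The constants \<open>0\<close> and \<open>1\<close> bound \<open>g\<close>, so \<open>u\<close> is concave where it is negative and convex where it exceeds \<open>1\<close>.
\<close>

lemma u_bounds_weak:
  assumes "0 \<le> x" shows "0 \<le> u x" "u x \<le> 1"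
proof -
  show "0 \<le> u x"
  proof (rule minimum_principle_at_top[OF u_cont assms _ u_lim])
    fix y assume "0 < y" "u y < 0"
    then show "\<exists>e>0. \<forall>t>0. t < e \<longrightarrow> u (y - t) + u (y + t) < 2 * u y"
      using g_nonneg[of y] by (intro u_local_concave) auto
  qed (simp_all add: u_0)
  have "0 \<le> 1 - u x"
  proof (rule minimum_principle_at_top[where f = "\<lambda>x. 1 - u x" and l = "1 - 1"])
    show "((\<lambda>x. 1 - u x) \<longlongrightarrow> 1 - 1) at_top" by (intro tendsto_intros u_lim)
    fix y assume "0 < y" "1 - u y < 0"
    then have "\<exists>e>0. \<forall>t>0. t < e \<longrightarrow> 2 * u y < u (y - t) + u (y + t)"
      using g_le_1[of y] by (intro u_local_convex) auto
    then show "\<exists>e>0. \<forall>t>0. t < e \<longrightarrow> (1 - u (y - t)) + (1 - u (y + t)) < 2 * (1 - u y)" by fastforce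
  qed (use assms u_0 u_cont in \<open>auto intro: continuous_intros\<close>)
  then show "u x \<le> 1" by simp
qed

text \<open>
  A zero of \<open>u\<close> would be a point of contact with the constant \<open>0\<close>; then \<open>u\<close> would vanish identically, against its
  limit at infinity.
\<close>

lemma u_pos:
  assumes "0 < x" shows "0 < u x"
proof (rule ccontr)
  assume "\<not> 0 < u x"
  then have "u x = 0" using u_bounds_weak[of x] assms by auto
  then have "u y = 0" if "y > 0" for y
    using touching_below[of "{0<..}" "\<lambda>_. 0" x y] that assms u_bounds_weak g_nonneg \<open>u x = 0\<close>
    by (simp add: convex_on_def)
  then have "eventually (\<lambda>y. u y = 0) at_top"
    by (intro eventually_mono[OF eventually_gt_at_top[of 0]])
  then have "(u \<longlongrightarrow> 0) at_top" by (rule tendsto_eventually)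
  then show False using tendsto_unique[OF _ u_lim] by force
qed

lemma u_less_1:
  assumes "0 \<le> x" shows "u x < 1"
proof (rule ccontr)
  assume "\<not> u x < 1"
  then have *: "u x = 1" "x > 0" using u_bounds_weak[of x] assms u_0 by (auto simp: order_le_less)
  then have "u y = 1" if "y > 0" for y
    using touching_above[of "{0<..}" "\<lambda>_. 1" x y] that * u_bounds_weak g_le_1
    by (simp add: concave_on_def convex_on_def flip: distrib_right)
  then have "eventually (\<lambda>y. u y = 1) (at_right 0)"
    by (auto simp: eventually_at_filter)
  then have "(u \<longlongrightarrow> 1) (at_right 0)" by (rule tendsto_eventually)
  then show False using tendsto_unique[OF _ u_lim_0] by force
qed

lemma w_cont: "continuous_on {0..} (\<lambda>x. u x - g x)"
  by (intro continuous_intros u_cont g_cont)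

text \<open>
  Where \<open>g\<close> is convex and \<open>u < g\<close>, the difference \<open>u - g\<close> is locally strictly concave and has no minimum.
\<close>

lemma ge_on_convex_part:
  assumes pq: "0 \<le> p" "q \<le> b0" and ends: "g p \<le> u p" "g q \<le> u q" and x: "p \<le> x" "x \<le> q"
  shows "g x \<le> u x"
proof -
  have "min 0 (min (u p - g p) (u q - g q)) \<le> u x - g x"
  proof (rule minimum_principle[where f = "\<lambda>x. u x - g x"])
    show "continuous_on {p..q} (\<lambda>x. u x - g x)" by (rule continuous_on_subset[OF w_cont]) (use pq in auto)
    fix y assume y: "p < y" "y < q" "u y - g y < 0"
    then obtain e where e: "e > 0" "\<And>t. 0 < t \<Longrightarrow> t < e \<Longrightarrow> u (y - t) + u (y + t) < 2 * u y"
      using u_local_concave[of y] pq by auto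
    obtain t where "0 < t" "t < min e (min (y - p) (q - y))"
      using dense[of 0 "min e (min (y - p) (q - y))"] e y by auto
    then have t: "0 < t" "t < e" "p < y - t" "y + t < q" by auto
    have "2 * g y \<le> g (y - t) + g (y + t)"
      using t pq by (intro convex_on_midpoint[OF g_convex]) auto
    then show "\<exists>t. p \<le> y - t \<and> y + t \<le> q \<and> 0 < t \<and>
          (u (y - t) - g (y - t)) + (u (y + t) - g (y + t)) < 2 * (u y - g y)"
      using e(2)[OF t(1,2)] t by (intro exI[of _ t]) auto
  qed (use x in auto)
  then show ?thesis using ends by simp
qed

lemma concave_part_local:
  assumes "b0 < y" "g y < u y"
  shows "\<exists>e>0. \<forall>t. 0 < t \<longrightarrow> t < e \<longrightarrow> (g (y - t) - u (y - t)) + (g (y + t) - u (y + t)) < 2 * (g y - u y)"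
proof -
  obtain e where e: "e > 0" "\<And>t. 0 < t \<Longrightarrow> t < e \<Longrightarrow> 2 * u y < u (y - t) + u (y + t)"
    using u_local_convex[of y] assms b0 by auto
  have "2 * - g y \<le> - g (y - t) + - g (y + t)" if "0 < t" "t < y - b0" for t
    using that by (intro convex_on_midpoint[OF g_concave[unfolded concave_on_def]]) auto
  then show ?thesis
    using e assms by (intro exI[of _ "min e (y - b0)"]) fastforce
qed

lemma le_on_concave_part:
  assumes pq: "b0 \<le> p" and ends: "u p \<le> g p" "u q \<le> g q" and x: "p \<le> x" "x \<le> q"
  shows "u x \<le> g x"
proof -
  have "min 0 (min (g p - u p) (g q - u q)) \<le> g x - u x"
  proof (rule minimum_principle[where f = "\<lambda>x. g x - u x"])
    show "continuous_on {p..q} (\<lambda>x. g x - u x)"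
      using pq b0 by (intro continuous_intros continuous_on_subset[OF u_cont] continuous_on_subset[OF g_cont]) auto
    fix y assume y: "p < y" "y < q" "g y - u y < 0"
    then obtain e where e: "e > 0" 
      "\<And>t. 0 < t \<Longrightarrow> t < e \<Longrightarrow> (g (y - t) - u (y - t)) + (g (y + t) - u (y + t)) < 2 * (g y - u y)"
      using concave_part_local[of y] pq by auto
    obtain t where "0 < t" "t < min e (min (y - p) (q - y))"
      using dense[of 0 "min e (min (y - p) (q - y))"] e y by auto
    then have t: "0 < t" "t < e" "p < y - t" "y + t < q" by auto
    show "\<exists>t. p \<le> y - t \<and> y + t \<le> q \<and> 0 < t \<and>
          (g (y - t) - u (y - t)) + (g (y + t) - u (y + t)) < 2 * (g y - u y)"
      using e(2)[OF t(1,2)] t by (intro exI[of _ t]) auto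
  qed (use x in auto)
  then show ?thesis using ends by simp
qed

lemma le_on_concave_tail:
  assumes p: "b0 \<le> p" "u p \<le> g p" and x: "p \<le> x"
  shows "u x \<le> g x"
proof -
  have "0 \<le> g x - u x"
  proof (rule minimum_principle_at_top[where f = "\<lambda>x. g x - u x" and l = "1 - 1"])
    show "continuous_on {p..} (\<lambda>x. g x - u x)"
      using p b0 by (intro continuous_intros continuous_on_subset[OF u_cont] continuous_on_subset[OF g_cont]) auto
    show "((\<lambda>x. g x - u x) \<longlongrightarrow> 1 - 1) at_top" by (intro tendsto_intros u_lim g_lim)
    fix y assume "p < y" "g y - u y < 0"
    then show "\<exists>e>0. \<forall>t>0. t < e \<longrightarrow> (g (y - t) - u (y - t)) + (g (y + t) - u (y + t)) < 2 * (g y - u y)"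
      using p by (intro concave_part_local) auto
  qed (use p x in auto)
  then show ?thesis by simp
qed

text \<open>
  Contact would make \<open>u = g\<close> on the whole tail, hence \<open>u'' = 0\<close> there. A bounded affine function is constant, so \<open>u\<close> would
  reach its limit \<open>1\<close>.
\<close>

lemma no_touching_on_concave_tail:
  assumes r: "b0 \<le> r" and le: "\<And>x. r < x \<Longrightarrow> u x \<le> g x" and p: "r < p"
  shows "u p \<noteq> g p"
proof
  assume "u p = g p"
  have conc: "concave_on {r<..} g" 
    using g_concave r unfolding concave_on_def by (rule_tac convex_on_subset) auto
  have eq: "u x = g x" if "r < x" for x
    by (rule touching_above[OF _ _ _ conc _ _ _ \<open>u p = g p\<close>]) (use le p that r b0 in auto)
  define m where "m = u' p"
  have "u' y - u' x = 0" if "r < x" "x < y" for x y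
    using MVT2[OF that(2) u'_deriv] that r b0 eq by fastforce
  then have m: "u' x = m" if "r < x" for x
    using that p unfolding m_def by (metis eq_iff_diff_eq_0 linorder_neqE_linordered_idom)
  have lin: "u (p + t) = u p + t * m" if "0 < t" for t
  proof -
    obtain z where "p < z" "u (p + t) - u p = (p + t - p) * u' z"
      using MVT2[OF _ u_deriv, of p "p + t"] \<open>0 < t\<close> p r b0 by auto
    then show ?thesis using m[of z] p by simp
  qed
  have "m = 0"
  proof (rule ccontr)
    assume "m \<noteq> 0"
    then have "2 / \<bar>m\<bar> > 0" by simp
    from lin[OF this] have "\<bar>u (p + 2 / \<bar>m\<bar>) - u p\<bar> = 2" using \<open>m \<noteq> 0\<close> by (simp add: abs_mult)
    moreover have "0 \<le> u (p + 2 / \<bar>m\<bar>)" "u (p + 2 / \<bar>m\<bar>) \<le> 1" "0 \<le> u p" "u p \<le> 1"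
      using u_bounds_weak p r b0 \<open>2 / \<bar>m\<bar> > 0\<close> by auto
    ultimately show False by linarith
  qed
  then have "eventually (\<lambda>x. u x = u p) at_top"
    using lin[of "x - p" for x] by (intro eventually_mono[OF eventually_gt_at_top[of p]]) auto
  then have "(u \<longlongrightarrow> u p) at_top" by (rule tendsto_eventually)
  then have "u p = 1" using tendsto_unique[OF _ u_lim] by force
  then show False using u_less_1[of p] p r b0 by simp
qed

text \<open>
  Contact would make \<open>u = g\<close> linear near \<open>0\<close>, which is incompatible with the decay of \<open>g x / x\<close>.
\<close>

lemma no_touching_on_convex_head:
  assumes r: "r \<le> b0" and ge: "\<And>x. 0 < x \<Longrightarrow> x < r \<Longrightarrow> g x \<le> u x" and p: "0 < p" "p < r"
  shows "u p \<noteq> g p"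
proof
  assume "u p = g p"
  have conv: "convex_on {0<..<r} g" 
    using g_convex r by (rule_tac convex_on_subset) auto
  have eq: "u x = g x" if "0 < x" "x < r" for x
    by (rule touching_below[OF _ _ _ conv _ _ _ \<open>u p = g p\<close>]) (use ge p that r b0 in auto)
  define m where "m = u' p"
  have "u' y - u' x = 0" if "0 < x" "x < y" "y < r" for x y
    using MVT2[OF that(2) u'_deriv] that eq by fastforce
  then have m: "u' x = m" if "0 < x" "x < r" for x
    using that p unfolding m_def by (metis eq_iff_diff_eq_0 linorder_neqE_linordered_idom)
  have lin: "u x = x * m" if x: "0 < x" "x < r" for x
  proof -
    have "continuous_on {0..x} u" by (rule continuous_on_subset[OF u_cont]) auto
    moreover have "u differentiable (at y)" if "0 < y" for y
      using u_deriv[OF that] real_differentiable_def by blast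
    ultimately obtain l z where z: "0 < z" "z < x" "DERIV u z :> l" "u x - u 0 = (x - 0) * l"
      using MVT[of 0 x u] x by blast
    then have "l = m" using DERIV_unique[OF z(3) u_deriv] m x by auto
    then show ?thesis using z u_0 by simp
  qed
  have "eventually (\<lambda>x. x < r) (at_right 0)"
    using p by (auto simp: eventually_at_right_field)
  then have "eventually (\<lambda>x. g x / x = m) (at_right 0)"
    unfolding eventually_at_filter
    by eventually_elim (metis eq lin greaterThan_iff less_irrefl nonzero_mult_div_cancel_left)
  then have "((\<lambda>x. g x / x) \<longlongrightarrow> m) (at_right 0)" by (rule tendsto_eventually)
  then have "m = 0" using tendsto_unique[OF _ g_sublinear] by force
  then show False using lin[OF p] u_pos[of p] p by simp
qed

text \<open>
  The fact \<open>tail\<close> in the proof carries the argument: a point \<open>y\<close> of \<open>[b0,b)\<close> with \<open>u y \<le> g y\<close> would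
  give \<open>u \<le> g\<close> on all of \<open>(y,\<infinity>)\<close>, with contact at the interior point \<open>b\<close>.
\<close>

lemma signs_if_root_right:
  assumes "b0 \<le> b"
  shows "0 < x \<Longrightarrow> x < b \<Longrightarrow> g x < u x" and "b < x \<Longrightarrow> u x < g x"
proof -
  have right: "u x \<le> g x" if "b \<le> x" for x
    using le_on_concave_tail[OF assms _ that] u_b by simp
  have tail: False if "b0 \<le> y" "y < b" "u y \<le> g y" for y
  proof -
    have "u x \<le> g x" if "y < x" for x
      using le_on_concave_part[of y b x] right[of x] that \<open>b0 \<le> y\<close> \<open>u y \<le> g y\<close> u_b by (cases "x \<le> b") auto
    then show False using no_touching_on_concave_tail[of y b] that u_b by auto
  qed
  have left: "g x \<le> u x" if "0 < x" "x < b0" for x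
  proof (rule ge_on_convex_part[of 0 b0])
    show "g b0 \<le> u b0" using tail[of b0] u_b assms by (cases "b0 = b") force+
  qed (use that u_0 g_0 in auto)
  show "g x < u x" if x: "0 < x" "x < b"
  proof (cases "x < b0")
    case True
    then show ?thesis
      using no_touching_on_convex_head[OF order_refl left x(1) True] left[of x] x by simp
  next
    case False
    then show ?thesis using tail[of x] x by force
  qed
  show "u x < g x" if "b < x"
    using no_touching_on_concave_tail[OF assms right that] right[of x] that by simp
qed

text \<open>
  The mirror image: a point \<open>y\<close> of \<open>(b,b0]\<close> with \<open>g y \<le> u y\<close> would give \<open>g \<le> u\<close> on all of \<open>(0,y)\<close>,
  with contact at the interior point \<open>b\<close>.
\<close>

lemma signs_if_root_left:
  assumes "b < b0"
  shows "0 < x \<Longrightarrow> x < b \<Longrightarrow> g x < u x" and "b < x \<Longrightarrow> u x < g x"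
proof -
  have left: "g x \<le> u x" if "0 \<le> x" "x \<le> b" for x
    using ge_on_convex_part[of 0 b x] that assms u_b u_0 g_0 by simp
  have head: False if "b < y" "y \<le> b0" "g y \<le> u y" for y
  proof -
    have "g x \<le> u x" if "0 < x" "x < y" for x
      using ge_on_convex_part[of b y x] left[of x] that \<open>y \<le> b0\<close> \<open>g y \<le> u y\<close> u_b b by (cases "x \<le> b") auto
    then show False using no_touching_on_convex_head[of y b] that u_b b by auto
  qed
  have right: "u x \<le> g x" if "b0 \<le> x" for x
    using le_on_concave_tail[of b0 x] head[of b0] assms that by force
  show "g x < u x" if x: "0 < x" "x < b"
    using no_touching_on_convex_head[OF less_imp_le[OF assms] left x] left[of x] x by simp
  show "u x < g x" if "b < x"
  proof (cases "b0 < x")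
    case True
    then show ?thesis using no_touching_on_concave_tail[OF order_refl right True] right[of x] by simp
  next
    case False
    then show ?thesis using head[of x] that by force
  qed
qed

lemma above_left: "0 < x \<Longrightarrow> x < b \<Longrightarrow> g x < u x"
  and below_right: "b < x \<Longrightarrow> u x < g x"
  using signs_if_root_right signs_if_root_left by (cases "b0 \<le> b"; force)+

lemma u''_pos: "0 < x \<Longrightarrow> x < b \<Longrightarrow> 0 < diffusion_coeff b x * (u x - g x)"
  using above_left diffusion_coeff_pos by simp

lemma u''_neg: "b < x \<Longrightarrow> diffusion_coeff b x * (u x - g x) < 0"
  using below_right diffusion_coeff_pos[of x b] b by (simp add: mult_pos_neg)

lemma u_strictly_convex: "strictly_convex_on {0<..<b} u"
  by (rule strictly_convex_onI[OF _ u_deriv u'_deriv]) (auto intro: u''_pos)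

lemma u_strictly_concave: "strictly_concave_on {b<..} u"
  by (rule strictly_concave_onI[OF _ u_deriv u'_deriv]) (use b u''_neg in auto)

text \<open>
  On \<open>(0,b]\<close> the slope increases from its mean value \<open>u x / x > 0\<close>. On \<open>(b,\<infinity>)\<close> it decreases, so a nonpositive slope
  would keep \<open>u\<close> below a value smaller than its limit \<open>1\<close>.
\<close>

lemma u'_pos:
  assumes x: "0 < x"
  shows "0 < u' x"
proof (cases "x \<le> b")
  case True
  have "continuous_on {0..x} u" by (rule continuous_on_subset[OF u_cont]) auto
  moreover have "u differentiable (at y)" if "0 < y" for y
    using u_deriv[OF that] real_differentiable_def by blast
  ultimately obtain l z where z: "0 < z" "z < x" "DERIV u z :> l" "u x - u 0 = (x - 0) * l"
    using MVT[of 0 x u] x by blast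
  then have "x * u' z > 0" using DERIV_unique[OF z(3) u_deriv] u_pos[OF x] u_0 by auto
  then have "u' z > 0" using x by (simp add: zero_less_mult_iff)
  moreover obtain y where "z < y" "y < x" "u' x - u' z = (x - z) * (diffusion_coeff b y * (u y - g y))"
    using MVT2[OF z(2) u'_deriv] z by auto
  then have "u' x > u' z" using u''_pos[of y] True z by (smt (verit) mult_pos_pos)
  ultimately show ?thesis by simp
next
  case False
  show ?thesis
  proof (rule ccontr)
    assume neg: "\<not> 0 < u' x"
    have "u y \<le> u x" if y: "x < y" for y
    proof -
      obtain z where z: "x < z" "z < y" "u y - u x = (y - x) * u' z"
        using MVT2[OF y u_deriv] x by auto
      obtain v where v: "x < v" "v < z" "u' z - u' x = (z - x) * (diffusion_coeff b v * (u v - g v))"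
        using MVT2[OF z(1) u'_deriv] x by auto
      then have "u' z - u' x < 0" using u''_neg[of v] False z by (simp add: mult_pos_neg)
      then have "(y - x) * u' z \<le> 0" using y neg by (intro mult_nonneg_nonpos) auto
      then show ?thesis using z by simp
    qed
    then have "eventually (\<lambda>y. u y \<le> u x) at_top"
      by (intro eventually_mono[OF eventually_gt_at_top[of x]])
    then have "1 \<le> u x" using tendsto_upperbound[OF u_lim] by simp
    then show False using u_less_1[of x] x by simp
  qed
qed

lemma u_strict_mono: "strict_mono_on {0..} u"
proof (rule strict_mono_onI)
  fix x y :: real assume xy: "x \<in> {0..}" "x < y"
  show "u x < u y"
  proof (rule DERIV_pos_imp_increasing_open[OF xy(2)])
    show "continuous_on {x..y} u" by (rule continuous_on_subset[OF u_cont]) (use xy in auto)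
    fix z assume "x < z" "z < y"
    then have "0 < z" using xy by simp
    then show "\<exists>l. DERIV u z :> l \<and> l > 0" using u_deriv u'_pos by blast
  qed
qed

lemma u_deriv_eq: "0 < x \<Longrightarrow> deriv u x = u' x"
  by (rule DERIV_imp_deriv[OF u_deriv])

lemma deriv_u_deriv:
  assumes "0 < x"
  shows "(deriv u has_real_derivative diffusion_coeff b x * (u x - g x)) (at x)"
proof -
  have "eventually (\<lambda>y. 0 < y) (nhds x)"
    using assms by (intro order_tendstoD[OF filterlim_ident]) auto
  then have "eventually (\<lambda>y. deriv u y = u' y) (nhds x)"
    by eventually_elim (rule u_deriv_eq)
  then show ?thesis using u'_deriv[OF assms] by (subst DERIV_cong_ev[OF refl _ refl]) auto
qed

lemma u_second_deriv: "0 < x \<Longrightarrow> deriv (deriv u) x = diffusion_coeff b x * (u x - g x)"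
  by (rule DERIV_imp_deriv[OF deriv_u_deriv])

lemma u_C2: "C2_on {0<..} u"
  unfolding C2_on_def
proof (intro conjI ballI)
  show "u differentiable (at x)" "deriv u differentiable (at x)" if "x \<in> {0<..}" for x
    using that u_deriv deriv_u_deriv real_differentiable_def by auto
  have cont: "continuous_on T (\<lambda>x. k / x\<^sup>2 * (u x - g x))" if "T \<subseteq> {0<..}" for k T
    using that by (intro continuous_intros continuous_on_subset[OF u_cont] continuous_on_subset[OF g_cont]) auto
  have "continuous_on {0<..}
      (\<lambda>x. if x \<le> b then \<gamma>2 * (\<gamma>2 - 1) / x\<^sup>2 * (u x - g x) else \<gamma>1 * (\<gamma>1 - 1) / x\<^sup>2 * (u x - g x))"
    by (intro continuous_on_cases_le cont continuous_on_id) (auto simp: u_b)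
  moreover have "deriv (deriv u) x = (if x \<le> b then \<gamma>2 * (\<gamma>2 - 1) / x\<^sup>2 * (u x - g x)
      else \<gamma>1 * (\<gamma>1 - 1) / x\<^sup>2 * (u x - g x))" if "x \<in> {0<..}" for x
    using that u_second_deriv[of x] by (simp add: diffusion_coeff_def)
  ultimately show "continuous_on {0<..} (deriv (deriv u))"
    by (simp only: cong: continuous_on_cong)
qed

end

text \<open>
  For two roots \<open>b < c\<close>, the difference \<open>d\<close> of the solutions satisfies \<open>d'' < 0\<close> wherever \<open>d < 0\<close>. Outside \<open>(b,c]\<close> both
  solutions obey the same equation, so \<open>d''\<close> is a positive multiple of \<open>d\<close>; inside, the first one is concave and the second one convex.
  Hence \<open>d \<ge> 0\<close>, although \<open>u < g < v\<close> between \<open>b\<close> and \<open>c\<close>.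
\<close>

lemma (in s_shaped) switched_solution_unique:
  assumes "switched_solution \<gamma>1 \<gamma>2 g b0 b u u'" "switched_solution \<gamma>1 \<gamma>2 g b0 c v v'"
  shows "b = c"
proof -
  have no: False if B: "switched_solution \<gamma>1 \<gamma>2 g b0 b u u'" and C: "switched_solution \<gamma>1 \<gamma>2 g b0 c v v'"
    and bc: "b < c" for b c u u' v v'
  proof -
    interpret B: switched_solution \<gamma>1 \<gamma>2 g b0 b u u' by fact
    interpret C: switched_solution \<gamma>1 \<gamma>2 g b0 c v v' by fact
    define x where "x = (b + c) / 2"
    have x: "b < x" "x < c" "0 < x" using bc B.b by (auto simp: x_def)
    define d where "d = (\<lambda>x. u x - v x)"
    define d'' where "d'' = (\<lambda>x. diffusion_coeff b x * (u x - g x) - diffusion_coeff c x * (v x - g x))"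
    have contd: "continuous_on {0..} d"
      unfolding d_def by (intro continuous_intros B.u_cont C.u_cont)
    have neg: "d'' y < 0" if "0 < y" "d y < 0" for y
    proof -
      have *: "diffusion_coeff b y > 0" "diffusion_coeff c y > 0" using that diffusion_coeff_pos by auto
      consider "y \<le> b" | "b < y" "y \<le> c" | "c < y" by linarith
      then show ?thesis
      proof cases
        case 1
        then have "diffusion_coeff b y = diffusion_coeff c y" using bc by (simp add: diffusion_coeff_def)
        then have "d'' y = diffusion_coeff b y * d y" by (simp add: d''_def d_def algebra_simps)
        then show ?thesis using * that by (simp add: mult_pos_neg)
      next
        case 2
        then have "diffusion_coeff b y * (u y - g y) < 0" "0 \<le> diffusion_coeff c y * (v y - g y)"
          using B.u''_neg[of y] C.u''_pos[of y] that C.u_b by (cases "y = c"; force)+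
        then show ?thesis by (simp add: d''_def)
      next
        case 3
        then have "diffusion_coeff b y = diffusion_coeff c y" using bc by (simp add: diffusion_coeff_def)
        then have "d'' y = diffusion_coeff b y * d y" by (simp add: d''_def d_def algebra_simps)
        then show ?thesis using * that by (simp add: mult_pos_neg)
      qed
    qed
    have "0 \<le> d x"
    proof (rule minimum_principle_at_top[OF contd, of x "1 - 1"])
      show "(d \<longlongrightarrow> 1 - 1) at_top" unfolding d_def by (intro tendsto_intros B.u_lim C.u_lim)
      fix y assume y: "0 < y" "d y < 0"
      have "open ({0<..} \<inter> d -` {..<0})"
        using contd by (intro continuous_open_preimage continuous_on_subset[OF contd]) auto
      then obtain e where e: "e > 0" "\<And>z. dist z y < e \<Longrightarrow> z \<in> {0<..} \<inter> d -` {..<0}"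
        using y unfolding open_dist by (metis IntI greaterThan_iff lessThan_iff vimageI)
      have "strictly_concave_on {y - e<..<y + e} d"
      proof (rule strictly_concave_onI[where f' = "\<lambda>x. u' x - v' x" and f'' = d''])
        fix z assume "z \<in> {y - e<..<y + e}"
        then have z: "0 < z" "d z < 0" using e(2)[of z] by (auto simp: dist_real_def)
        then show "d'' z < 0" by (rule neg)
        show "(d has_real_derivative u' z - v' z) (at z)"
          unfolding d_def using z by (intro DERIV_diff B.u_deriv C.u_deriv)
        show "((\<lambda>x. u' x - v' x) has_real_derivative d'' z) (at z)"
          unfolding d''_def using z by (intro DERIV_diff B.u'_deriv C.u'_deriv)
      qed simp
      then have "2 * (- d y) < - d (y - t) + - d (y + t)" if "0 < t" "t < e" for t
        using that unfolding strictly_concave_on_def by (rule_tac strictly_convex_on_midpoint) auto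
      then show "\<exists>e>0. \<forall>t>0. t < e \<longrightarrow> d (y - t) + d (y + t) < 2 * d y"
        using e(1) by (intro exI[of _ e]) fastforce
    qed (use x B.u_0 C.u_0 in \<open>auto simp: d_def\<close>)
    moreover have "u x < g x" "g x < v x" using B.below_right C.above_left x by auto
    ultimately show False by (simp add: d_def)
  qed
  show ?thesis
    using no[OF assms] no[OF assms(2,1)] by (cases b c rule: linorder_cases) auto
qed

section \<open>Power-logarithmic tails\<close>

lemma power_times_exp_neg_tendsto_0:
  fixes \<mu> :: real
  assumes "0 < \<mu>"
  shows "((\<lambda>t. t ^ j * exp (- \<mu> * t)) \<longlongrightarrow> 0) at_top"
proof -
  have "((\<lambda>t. (\<mu> * t) ^ j / exp (\<mu> * t)) \<longlongrightarrow> 0) at_top"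
    using assms by (intro filterlim_compose[OF tendsto_power_div_exp_0]
        filterlim_tendsto_pos_mult_at_top[OF tendsto_const _ filterlim_ident])
  then have "((\<lambda>t. (\<mu> * t) ^ j / exp (\<mu> * t) / \<mu> ^ j) \<longlongrightarrow> 0 / \<mu> ^ j) at_top"
    using assms by (intro tendsto_intros) auto
  then show ?thesis using assms by (simp add: power_mult_distrib exp_minus field_simps)
qed

text \<open>
  The switched equation near \<open>0\<close> or \<open>\<infinity>\<close> in logarithmic time \<open>t\<close>, where \<open>F\<close> and \<open>L\<close> are the
  deviations of \<open>u\<close> and \<open>g\<close> from their limit, divided by the decaying homogeneous solution. The condition \<open>decay\<close> excludes the other
  homogeneous solution, which grows like \<open>exp (\<mu> * t)\<close> relative to the first.
\<close>

locale resonant_tail =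
  fixes F G L :: "real \<Rightarrow> real" and \<mu> \<kappa> :: real
  assumes \<mu>: "0 < \<mu>" and \<kappa>: "0 < \<kappa>"
    and F: "eventually (\<lambda>t. (F has_real_derivative G t) (at t)) at_top"
    and G: "eventually (\<lambda>t. (G has_real_derivative \<mu> * G t - \<kappa> * L t) (at t)) at_top"
    and decay: "((\<lambda>t. exp (- \<mu> * t) * G t) \<longlongrightarrow> 0) at_top"
begin

lemma discounted_G:
  "eventually (\<lambda>t. ((\<lambda>t. exp (- \<mu> * t) * G t) has_real_derivative - \<kappa> * L t * exp (- \<mu> * t)) (at t)) at_top"
  using G
proof eventually_elim
  case (elim t)
  have "((\<lambda>t. exp (- \<mu> * t)) has_real_derivative exp (- \<mu> * t) * - \<mu>) (at t)"
    by (auto intro!: derivative_eq_intros)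
  from DERIV_mult[OF this elim] show ?case
    by (rule DERIV_cong) (simp add: algebra_simps)
qed

text \<open>
  Without forcing, \<open>exp (- \<mu> * t) * G t\<close> is eventually constant; as it decays, it is eventually zero.
\<close>

lemma flat:
  assumes "eventually (\<lambda>t. L t = 0) at_top"
  shows "\<exists>C. eventually (\<lambda>t. F t = C) at_top"
proof -
  obtain t0 where t0: "\<And>t. t0 \<le> t \<Longrightarrow> L t = 0 \<and> (F has_real_derivative G t) (at t) \<and>
     ((\<lambda>t. exp (- \<mu> * t) * G t) has_real_derivative - \<kappa> * L t * exp (- \<mu> * t)) (at t)"
    using eventually_conj[OF assms eventually_conj[OF F discounted_G]]
    unfolding eventually_at_top_linorder by blast
  define E where "E = (\<lambda>t. exp (- \<mu> * t) * G t)"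
  have "(E has_real_derivative 0) (at t)" if "t0 \<le> t" for t
  proof -
    have "(E has_real_derivative - \<kappa> * L t * exp (- \<mu> * t)) (at t)" "L t = 0"
      using t0[OF that] unfolding E_def by blast+
    then show ?thesis by simp
  qed
  then have Econst: "E t = E t0" if "t0 \<le> t" for t
    using MVT2[of t0 t E "\<lambda>_. 0"] that by (cases "t = t0") auto
  then have "(E \<longlongrightarrow> E t0) at_top"
    by (intro tendsto_eventually eventually_mono[OF eventually_ge_at_top[of t0]])
  then have "E t0 = 0"
    using tendsto_unique[OF _ decay[folded E_def]] by force
  then have G0: "G t = 0" if "t0 \<le> t" for t
    using Econst[OF that] unfolding E_def by simp
  have "F t = F t0" if "t0 \<le> t" for t
  proof (cases "t = t0")
    case False
    then obtain z where "t0 < z" "F t - F t0 = (t - t0) * G z"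
      using MVT2[of t0 t F G] t0 \<open>t0 \<le> t\<close> by auto
    then show ?thesis using G0[of z] by simp
  qed simp
  then show ?thesis
    by (intro exI[of _ "F t0"] eventually_mono[OF eventually_ge_at_top[of t0]])
qed

text \<open>
  L'Hopital's rule twice: \<open>G\<close> follows its forcing quasi-statically, \<open>G \<sim> \<kappa> L / \<mu>\<close>, and integrating \<open>F' = G\<close> gains
  the power of \<open>t\<close>.
\<close>

lemma resonant_growth:
  assumes lim: "((\<lambda>t. L t / t ^ j) \<longlongrightarrow> a) at_top"
  shows "((\<lambda>t. F t / t ^ Suc j) \<longlongrightarrow> \<kappa> * a / \<mu> / real (Suc j)) at_top"
proof -
  let ?D = "\<lambda>t. t ^ j * exp (- \<mu> * t)"
  let ?D' = "\<lambda>t. t ^ j * exp (- \<mu> * t) * (real j / t - \<mu>)"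
  have pos: "eventually (\<lambda>t::real. 0 < t) at_top" by (rule eventually_gt_at_top)
  have jt: "((\<lambda>t. real j / t) \<longlongrightarrow> 0) at_top"
    by (rule tendsto_divide_0[OF tendsto_const]) (rule filterlim_at_top_imp_at_infinity[OF filterlim_ident])
  then have "eventually (\<lambda>t. real j / t < \<mu>) at_top" using \<mu> by (intro order_tendstoD)
  then have D'0: "eventually (\<lambda>t. ?D' t \<noteq> 0) at_top"
    using pos by eventually_elim simp
  have D': "eventually (\<lambda>t. DERIV ?D t :> ?D' t) at_top"
    using pos
  proof eventually_elim
    case (elim t)
    have "real j * t ^ (j - 1) = t ^ j * (real j / t)" using elim by (cases j) auto
    then have "((\<lambda>t. t ^ j) has_real_derivative t ^ j * (real j / t)) (at t)"
      using DERIV_pow[of j t] by simp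
    moreover have "((\<lambda>t. exp (- \<mu> * t)) has_real_derivative exp (- \<mu> * t) * - \<mu>) (at t)"
      by (auto intro!: derivative_eq_intros)
    ultimately show ?case
      by (rule DERIV_cong[OF DERIV_mult]) (simp add: algebra_simps)
  qed
  have "((\<lambda>t. exp (- \<mu> * t) * G t / ?D t) \<longlongrightarrow> (- \<kappa> * a) / (0 - \<mu>)) at_top"
  proof (rule lhopital_at_top_zero[OF decay power_times_exp_neg_tendsto_0[OF \<mu>] _ D'0 discounted_G D'])
    have "((\<lambda>t. (- \<kappa> * (L t / t ^ j)) / (real j / t - \<mu>)) \<longlongrightarrow> (- \<kappa> * a) / (0 - \<mu>)) at_top"
      using \<mu> by (intro tendsto_intros lim jt) auto
    then show "((\<lambda>t. - \<kappa> * L t * exp (- \<mu> * t) / ?D' t) \<longlongrightarrow> (- \<kappa> * a) / (0 - \<mu>)) at_top"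
      by (rule Lim_transform_eventually) (use pos in \<open>eventually_elim, simp\<close>)
  qed (use pos in \<open>eventually_elim, simp\<close>)
  then have Glim: "((\<lambda>t. G t / t ^ j) \<longlongrightarrow> \<kappa> * a / \<mu>) at_top" using \<mu> by simp
  show ?thesis
  proof (rule lhospital_at_top_at_top[where f' = G and g' = "\<lambda>t. real (Suc j) * t ^ j"])
    show "LIM t at_top. (t::real) ^ Suc j :> at_top" by (intro filterlim_pow_at_top filterlim_ident) simp
    show "eventually (\<lambda>t. DERIV (\<lambda>t. t ^ Suc j) t :> real (Suc j) * t ^ j) at_top"
      using DERIV_pow[of "Suc j"] by simp
    have "((\<lambda>t. G t / t ^ j / real (Suc j)) \<longlongrightarrow> \<kappa> * a / \<mu> / real (Suc j)) at_top"
      by (intro tendsto_intros Glim) auto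
    then show "((\<lambda>t. G t / (real (Suc j) * t ^ j)) \<longlongrightarrow> \<kappa> * a / \<mu> / real (Suc j)) at_top"
      by (simp add: mult.commute)
    show "eventually (\<lambda>t. real (Suc j) * t ^ j \<noteq> 0) at_top"
      using pos by eventually_elim simp
  qed (rule F)
qed

end

definition grows_like_power :: "nat \<Rightarrow> (real \<Rightarrow> real) \<Rightarrow> bool" where
  "grows_like_power j L \<longleftrightarrow> (\<exists>a>0. ((\<lambda>t. L t / t ^ j) \<longlongrightarrow> a) at_top)"

lemma (in resonant_tail) grows_like_power_Suc:
  assumes "grows_like_power j L" shows "grows_like_power (Suc j) F"
  using assms resonant_growth[of j] \<mu> \<kappa> unfolding grows_like_power_def
  by (metis divide_pos_pos mult_pos_pos of_nat_0_less_iff zero_less_Suc)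

lemma (in resonant_tail) grows_like_power_0:
  assumes "eventually (\<lambda>t. L t = 0) at_top" and "eventually (\<lambda>t. F t > 0) at_top"
  shows "grows_like_power 0 F"
proof -
  obtain C where C: "eventually (\<lambda>t. F t = C) at_top" using flat[OF assms(1)] by blast
  then have "eventually (\<lambda>t::real. C > 0) at_top" using assms(2) by eventually_elim simp
  then have "C > 0" by simp
  moreover have "((\<lambda>t. F t / t ^ 0) \<longlongrightarrow> C) at_top"
    using tendsto_eventually[OF C] by simp
  ultimately show ?thesis unfolding grows_like_power_def by blast
qed

text \<open>
  In the original variable this is regular variation: a shift of \<open>t\<close> is a rescaling of \<open>x\<close>.
\<close>

lemma grows_like_power_shift:
  assumes "grows_like_power j L"
  shows "((\<lambda>t. L (t + c) / L t) \<longlongrightarrow> 1) at_top"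
proof -
  obtain a where a: "a > 0" "((\<lambda>t. L t / t ^ j) \<longlongrightarrow> a) at_top"
    using assms by (auto simp: grows_like_power_def)
  have shift: "filterlim (\<lambda>t. t + c) at_top (at_top :: real filter)"
    using filterlim_tendsto_add_at_top[OF tendsto_const[of c] filterlim_ident] by (simp add: add.commute)
  have "((\<lambda>t. c / t) \<longlongrightarrow> 0) at_top"
    by (rule tendsto_divide_0[OF tendsto_const]) (rule filterlim_at_top_imp_at_infinity[OF filterlim_ident])
  then have "((\<lambda>t. (L (t + c) / (t + c) ^ j) / (L t / t ^ j) * (1 + c / t) ^ j) \<longlongrightarrow> a / a * (1 + 0) ^ j) at_top"
    using a by (intro tendsto_intros filterlim_compose[OF a(2) shift]) auto
  then have "((\<lambda>t. (L (t + c) / (t + c) ^ j) / (L t / t ^ j) * (1 + c / t) ^ j) \<longlongrightarrow> 1) at_top"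
    using a by simp
  then show ?thesis
  proof (rule Lim_transform_eventually)
    show "eventually (\<lambda>t. (L (t + c) / (t + c) ^ j) / (L t / t ^ j) * (1 + c / t) ^ j = L (t + c) / L t) at_top"
      using eventually_gt_at_top[of "max 0 (- c)"]
    proof eventually_elim
      case (elim t)
      then have "1 + c / t = (t + c) / t" "t + c > 0" "t > 0" by (auto simp: field_simps)
      then show ?case by (simp add: power_divide)
    qed
  qed
qed

lemma tendsto_at_right_0_if_exp:
  "(f \<longlongrightarrow> l) (at_right 0)" if "((\<lambda>t. f (exp (- t))) \<longlongrightarrow> l) at_top" for f :: "real \<Rightarrow> real"
proof -
  have "filterlim (\<lambda>x. - ln x) at_top (at_right (0::real))"
    using ln_at_0 by (simp add: filterlim_uminus_at_top)
  from filterlim_compose[OF that this] show ?thesis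
    by (rule Lim_transform_eventually) (auto simp: eventually_at_filter)
qed

lemma tendsto_at_top_if_exp:
  "(f \<longlongrightarrow> l) at_top" if "((\<lambda>t. f (exp t)) \<longlongrightarrow> l) at_top" for f :: "real \<Rightarrow> real"
  using filterlim_compose[OF that ln_at_top]
  by (rule Lim_transform_eventually) (auto intro!: eventually_mono[OF eventually_gt_at_top[of 0]])

context euler_exponents
begin

text \<open>
  The deviation from \<open>1\<close> at \<open>x = exp t\<close>, divided by \<open>x powr \<gamma>1\<close>.
\<close>

definition tail_inf :: "(real \<Rightarrow> real) \<Rightarrow> real \<Rightarrow> real" where
  "tail_inf g t = exp (- \<gamma>1 * t) * (1 - g (exp t))"

text \<open>
  The value at \<open>x = exp (- t)\<close>, divided by \<open>x powr \<gamma>2\<close>.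
\<close>

definition tail_0 :: "(real \<Rightarrow> real) \<Rightarrow> real \<Rightarrow> real" where
  "tail_0 g t = exp (\<gamma>2 * t) * g (exp (- t))"

definition flat_tails :: "(real \<Rightarrow> real) \<Rightarrow> bool" where
  "flat_tails g \<longleftrightarrow> eventually (\<lambda>t. tail_inf g t = 0) at_top \<and> eventually (\<lambda>t. tail_0 g t = 0) at_top"

definition power_log_tails :: "nat \<Rightarrow> (real \<Rightarrow> real) \<Rightarrow> bool" where
  "power_log_tails j g \<longleftrightarrow> grows_like_power j (tail_inf g) \<and> grows_like_power j (tail_0 g)"

lemma power_log_tails_at_top:
  assumes "power_log_tails j g"
  shows "\<exists>a. (\<lambda>x. 1 - g x) \<sim>[at_top] (\<lambda>x. a * x powr \<gamma>1 * ln x powi (int j))"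
proof -
  obtain a where a: "a > 0" "((\<lambda>t. tail_inf g t / t ^ j) \<longlongrightarrow> a) at_top"
    using assms by (auto simp: power_log_tails_def grows_like_power_def)
  then have "((\<lambda>t. tail_inf g t / t ^ j / a) \<longlongrightarrow> a / a) at_top" by (intro tendsto_intros) auto
  then have "((\<lambda>t. tail_inf g t / t ^ j / a) \<longlongrightarrow> 1) at_top" using a by simp
  moreover have "eventually (\<lambda>t. tail_inf g t / t ^ j / a =
      (1 - g (exp t)) / (a * exp t powr \<gamma>1 * ln (exp t) powi (int j))) at_top"
    using eventually_gt_at_top[of 0]
    by eventually_elim (simp add: tail_inf_def powr_def exp_minus field_simps)
  ultimately have "((\<lambda>t. (1 - g (exp t)) / (a * exp t powr \<gamma>1 * ln (exp t) powi (int j))) \<longlongrightarrow> 1) at_top"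
    by (rule Lim_transform_eventually)
  then show ?thesis
    by (intro exI[of _ a] asymp_equivI') (rule tendsto_at_top_if_exp)
qed

text \<open>
  Here \<open>ln x = - t\<close> is negative, so the constant acquires the sign \<open>(- 1) ^ j\<close>.
\<close>

lemma power_log_tails_at_0:
  assumes "power_log_tails j g"
  shows "\<exists>a. g \<sim>[at_right 0] (\<lambda>x. a * x powr \<gamma>2 * ln x powi (int j))"
proof -
  obtain a where a: "a > 0" "((\<lambda>t. tail_0 g t / t ^ j) \<longlongrightarrow> a) at_top"
    using assms by (auto simp: power_log_tails_def grows_like_power_def)
  then have "((\<lambda>t. tail_0 g t / t ^ j / a) \<longlongrightarrow> a / a) at_top" by (intro tendsto_intros) auto
  then have "((\<lambda>t. tail_0 g t / t ^ j / a) \<longlongrightarrow> 1) at_top" using a by simp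
  moreover have "eventually (\<lambda>t. tail_0 g t / t ^ j / a =
      g (exp (- t)) / (((- 1) ^ j * a) * exp (- t) powr \<gamma>2 * ln (exp (- t)) powi (int j))) at_top"
    using eventually_gt_at_top[of 0]
  proof eventually_elim
    case (elim t)
    have "((- 1) ^ j * a) * exp (- t) powr \<gamma>2 * ln (exp (- t)) powi (int j)
        = a * exp (- (\<gamma>2 * t)) * ((- 1) ^ j * (- t) ^ j)"
      by (simp add: powr_def del: power_minus_mult)
    also have "(- 1) ^ j * (- t) ^ j = t ^ j" by (simp flip: power_mult_distrib)
    finally have "((- 1) ^ j * a) * exp (- t) powr \<gamma>2 * ln (exp (- t)) powi (int j) = a * exp (- (\<gamma>2 * t)) * t ^ j" .
    then show ?case unfolding tail_0_def using elim by (simp only:) (simp add: exp_minus field_simps)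
  qed
  ultimately have "((\<lambda>t. g (exp (- t)) / (((- 1) ^ j * a) * exp (- t) powr \<gamma>2 * ln (exp (- t)) powi (int j))) \<longlongrightarrow> 1) at_top"
    by (rule Lim_transform_eventually)
  then show ?thesis
    by (intro exI[of _ "(- 1) ^ j * a"] asymp_equivI') (rule tendsto_at_right_0_if_exp)
qed

lemma power_log_tails_sublinear:
  assumes "power_log_tails j g"
  shows "((\<lambda>x. g x / x) \<longlongrightarrow> 0) (at_right 0)"
proof (rule tendsto_at_right_0_if_exp)
  obtain a where a: "a > 0" "((\<lambda>t. tail_0 g t / t ^ j) \<longlongrightarrow> a) at_top"
    using assms by (auto simp: power_log_tails_def grows_like_power_def)
  have "((\<lambda>t. tail_0 g t / t ^ j * (t ^ j * exp (- (\<gamma>2 - 1) * t))) \<longlongrightarrow> a * 0) at_top"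
    using \<gamma>2 by (intro tendsto_mult a power_times_exp_neg_tendsto_0) auto
  then have "((\<lambda>t. tail_0 g t / t ^ j * (t ^ j * exp (- (\<gamma>2 - 1) * t))) \<longlongrightarrow> 0) at_top" by simp
  then show "((\<lambda>t. g (exp (- t)) / exp (- t)) \<longlongrightarrow> 0) at_top"
  proof (rule Lim_transform_eventually)
    show "eventually (\<lambda>t. tail_0 g t / t ^ j * (t ^ j * exp (- (\<gamma>2 - 1) * t)) = g (exp (- t)) / exp (- t)) at_top"
      using eventually_gt_at_top[of 0]
    proof eventually_elim
      case (elim t)
      have "exp (\<gamma>2 * t) * exp (- (\<gamma>2 - 1) * t) = exp t" by (simp add: algebra_simps flip: exp_add)
      then show ?case using elim by (simp add: tail_0_def exp_minus field_simps)
    qed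
  qed
qed

lemma power_log_tails_ratio_at_0:
  assumes "power_log_tails j g" and r: "r > 0"
  shows "(\<lambda>n. g (inverse (real (Suc n)) * r) / g (inverse (real (Suc n)))) \<longlonglongrightarrow> r powr \<gamma>2"
proof -
  have "((\<lambda>t. tail_0 g (t + - ln r) / tail_0 g t * r powr \<gamma>2) \<longlongrightarrow> 1 * r powr \<gamma>2) at_top"
    using assms by (intro tendsto_mult grows_like_power_shift[of j]) (auto simp: power_log_tails_def)
  moreover have "tail_0 g (t + - ln r) / tail_0 g t * r powr \<gamma>2 = g (exp (- t) * r) / g (exp (- t))" for t
  proof -
    have "exp (- (t + - ln r)) = exp (- t) * r"
      using exp_add[of "- t" "ln r"] r by simp
    moreover have "exp (\<gamma>2 * (t + - ln r)) * r powr \<gamma>2 = exp (\<gamma>2 * t)"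
      using r by (simp add: powr_def algebra_simps flip: exp_add)
    moreover have "tail_0 g (t + - ln r) / tail_0 g t * r powr \<gamma>2
        = (exp (\<gamma>2 * (t + - ln r)) * r powr \<gamma>2) * g (exp (- (t + - ln r))) / (exp (\<gamma>2 * t) * g (exp (- t)))"
      unfolding tail_0_def by simp
    ultimately show ?thesis by (simp only:) simp
  qed
  ultimately have "((\<lambda>t. g (exp (- t) * r) / g (exp (- t))) \<longlongrightarrow> r powr \<gamma>2) at_top" by simp
  moreover have "filterlim (\<lambda>n. ln (real (Suc n))) at_top sequentially"
    by (intro filterlim_compose[OF ln_at_top] filterlim_compose[OF filterlim_real_sequentially] filterlim_Suc)
  ultimately show ?thesis
    by (auto dest: filterlim_compose simp: exp_minus)
qed

lemma power_log_tails_ratio_at_top: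
  assumes "power_log_tails j g" and r: "r > 0"
  shows "(\<lambda>n. (1 - g (real (Suc n) * r)) / (1 - g (real (Suc n)))) \<longlonglongrightarrow> r powr \<gamma>1"
proof -
  have "((\<lambda>t. tail_inf g (t + ln r) / tail_inf g t * r powr \<gamma>1) \<longlongrightarrow> 1 * r powr \<gamma>1) at_top"
    using assms by (intro tendsto_mult grows_like_power_shift[of j]) (auto simp: power_log_tails_def)
  moreover have "tail_inf g (t + ln r) / tail_inf g t * r powr \<gamma>1 = (1 - g (exp t * r)) / (1 - g (exp t))" for t
  proof -
    have "exp (t + ln r) = exp t * r"
      using r by (simp add: exp_add)
    moreover have "exp (- \<gamma>1 * (t + ln r)) * r powr \<gamma>1 = exp (- \<gamma>1 * t)"
      using r by (simp add: powr_def algebra_simps flip: exp_add)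
    moreover have "tail_inf g (t + ln r) / tail_inf g t * r powr \<gamma>1
        = (exp (- \<gamma>1 * (t + ln r)) * r powr \<gamma>1) * (1 - g (exp (t + ln r))) / (exp (- \<gamma>1 * t) * (1 - g (exp t)))"
      unfolding tail_inf_def by simp
    ultimately show ?thesis by (simp only:) simp
  qed
  ultimately have "((\<lambda>t. (1 - g (exp t * r)) / (1 - g (exp t))) \<longlongrightarrow> r powr \<gamma>1) at_top" by simp
  moreover have "filterlim (\<lambda>n. ln (real (Suc n))) at_top sequentially"
    by (intro filterlim_compose[OF ln_at_top] filterlim_compose[OF filterlim_real_sequentially] filterlim_Suc)
  ultimately show ?thesis
    by (auto dest: filterlim_compose)
qed

end

context switched_solution
begin

text \<open>
  The slope is largest at the inflection point \<open>b\<close>; its boundedness yields the decay condition of the tail system.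
\<close>

lemma u'_le: 
  assumes x: "0 < x" shows "u' x \<le> u' b"
proof (cases x b rule: linorder_cases)
  case less
  then obtain z where "x < z" "z < b" "u' b - u' x = (b - x) * (diffusion_coeff b z * (u z - g z))"
    using MVT2[OF less u'_deriv] x by auto
  then show ?thesis using u''_pos[of z] x less by (smt (verit) mult_pos_pos)
next
  case greater
  then obtain z where "b < z" "z < x" "u' x - u' b = (x - b) * (diffusion_coeff b z * (u z - g z))"
    using MVT2[OF greater u'_deriv] b by auto
  then show ?thesis using u''_neg[of z] greater by (smt (verit) mult_pos_neg)
qed simp

text \<open>
  Differentiating \<open>tail_inf u\<close> twice and inserting the equation leaves no term in \<open>tail_inf u\<close> itself, because \<open>\<gamma>1\<close>
  is a root of the characteristic polynomial \<open>\<gamma> (\<gamma> - 1) = \<kappa>\<close>. This is the resonance that produces the logarithms.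
\<close>

lemma resonant_tail_inf:
  "resonant_tail (tail_inf u) (\<lambda>t. - \<gamma>1 * tail_inf u t - exp ((1 - \<gamma>1) * t) * u' (exp t)) (tail_inf g)
     (1 - 2 * \<gamma>1) (\<gamma>1 * (\<gamma>1 - 1))"
proof
  let ?G = "\<lambda>t. - \<gamma>1 * tail_inf u t - exp ((1 - \<gamma>1) * t) * u' (exp t)"
  show "0 < 1 - 2 * \<gamma>1" "0 < \<gamma>1 * (\<gamma>1 - 1)" using \<gamma>1 by (auto simp: mult_neg_neg)
  have F: "(tail_inf u has_real_derivative ?G t) (at t)" for t
  proof -
    have "((\<lambda>t. 1 - u (exp t)) has_real_derivative 0 - u' (exp t) * exp t) (at t)"
      by (intro DERIV_diff DERIV_const DERIV_chain2[OF u_deriv DERIV_exp]) simp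
    moreover have "((\<lambda>t. exp (- \<gamma>1 * t)) has_real_derivative exp (- \<gamma>1 * t) * - \<gamma>1) (at t)"
      by (auto intro!: derivative_eq_intros)
    moreover have "exp ((1 - \<gamma>1) * t) = exp (- \<gamma>1 * t) * exp t" by (simp add: algebra_simps flip: exp_add)
    ultimately show ?thesis
      unfolding tail_inf_def by (intro DERIV_cong[OF DERIV_mult]) (auto simp: algebra_simps)
  qed
  show "eventually (\<lambda>t. (tail_inf u has_real_derivative ?G t) (at t)) at_top" using F by simp
  show "eventually (\<lambda>t. (?G has_real_derivative (1 - 2 * \<gamma>1) * ?G t - \<gamma>1 * (\<gamma>1 - 1) * tail_inf g t) (at t)) at_top"
    using eventually_gt_at_top[of "ln b"]
  proof eventually_elim
    case (elim t)
    then have "b < exp t" using b by (metis exp_less_cancel_iff exp_ln)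
    then have c: "diffusion_coeff b (exp t) = \<gamma>1 * (\<gamma>1 - 1) / (exp t)\<^sup>2" by (simp add: diffusion_coeff_def)
    have "((\<lambda>t. u' (exp t)) has_real_derivative \<gamma>1 * (\<gamma>1 - 1) / (exp t)\<^sup>2 * (u (exp t) - g (exp t)) * exp t) (at t)"
      using DERIV_chain2[OF u'_deriv[of "exp t"] DERIV_exp] by (simp add: c)
    moreover have "((\<lambda>t. exp ((1 - \<gamma>1) * t)) has_real_derivative exp ((1 - \<gamma>1) * t) * (1 - \<gamma>1)) (at t)"
      by (auto intro!: derivative_eq_intros)
    ultimately have D: "(?G has_real_derivative - \<gamma>1 * ?G t - (exp ((1 - \<gamma>1) * t) * (1 - \<gamma>1) * u' (exp t)
        + \<gamma>1 * (\<gamma>1 - 1) / (exp t)\<^sup>2 * (u (exp t) - g (exp t)) * exp t * exp ((1 - \<gamma>1) * t))) (at t)"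
      by (intro DERIV_diff DERIV_cmult F DERIV_mult)
    have "exp ((1 - \<gamma>1) * t) = exp (- \<gamma>1 * t) * exp t" by (simp add: algebra_simps flip: exp_add)
    then have "\<gamma>1 * (\<gamma>1 - 1) / (exp t)\<^sup>2 * (u (exp t) - g (exp t)) * exp t * exp ((1 - \<gamma>1) * t)
        = \<gamma>1 * (\<gamma>1 - 1) * (tail_inf g t - tail_inf u t)"
      by (simp add: tail_inf_def power2_eq_square field_simps)
    from D[unfolded this] show ?case
      by (rule DERIV_cong) (simp add: algebra_simps)
  qed
  have "((\<lambda>t. - \<gamma>1 * (t ^ 0 * exp (- (1 - \<gamma>1) * t)) * (1 - u (exp t)) - (t ^ 0 * exp (- (- \<gamma>1) * t)) * u' (exp t)) \<longlongrightarrow> 0 - 0) at_top"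
  proof (intro tendsto_diff)
    have 1: "((\<lambda>t. 1 - u (exp t)) \<longlongrightarrow> 1 - 1) at_top"
      by (intro tendsto_intros filterlim_compose[OF u_lim exp_at_top])
    have "((\<lambda>t. - \<gamma>1 * (t ^ 0 * exp (- (1 - \<gamma>1) * t)) * (1 - u (exp t))) \<longlongrightarrow> - \<gamma>1 * 0 * (1 - 1)) at_top"
      using \<gamma>1 by (intro tendsto_mult tendsto_const 1 power_times_exp_neg_tendsto_0) auto
    then show "((\<lambda>t. - \<gamma>1 * (t ^ 0 * exp (- (1 - \<gamma>1) * t)) * (1 - u (exp t))) \<longlongrightarrow> 0) at_top" by simp
    show "((\<lambda>t. (t ^ 0 * exp (- (- \<gamma>1) * t)) * u' (exp t)) \<longlongrightarrow> 0) at_top"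
    proof (rule Lim_null_comparison)
      show "eventually (\<lambda>t. norm (t ^ 0 * exp (- (- \<gamma>1) * t) * u' (exp t)) \<le> t ^ 0 * exp (- (- \<gamma>1) * t) * u' b) at_top"
        using u'_le u'_pos by (intro always_eventually allI) (simp add: abs_mult less_imp_le)
      show "((\<lambda>t. t ^ 0 * exp (- (- \<gamma>1) * t) * u' b) \<longlongrightarrow> 0) at_top"
        using tendsto_mult_right[OF power_times_exp_neg_tendsto_0[of "- \<gamma>1" 0], of "u' b"] \<gamma>1 by simp
    qed
  qed
  moreover have "- \<gamma>1 * (t ^ 0 * exp (- (1 - \<gamma>1) * t)) * (1 - u (exp t)) - (t ^ 0 * exp (- (- \<gamma>1) * t)) * u' (exp t)
      = exp (- (1 - 2 * \<gamma>1) * t) * ?G t" for t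
  proof -
    have "exp (- (1 - 2 * \<gamma>1) * t) * exp (- \<gamma>1 * t) = exp (- (1 - \<gamma>1) * t)"
      "exp (- (1 - 2 * \<gamma>1) * t) * exp ((1 - \<gamma>1) * t) = exp (- (- \<gamma>1) * t)"
      by (simp_all add: algebra_simps flip: exp_add)
    then show ?thesis
      unfolding tail_inf_def by (simp only: right_diff_distrib) (simp add: mult_ac)
  qed
  ultimately show "((\<lambda>t. exp (- (1 - 2 * \<gamma>1) * t) * ?G t) \<longlongrightarrow> 0) at_top" by simp
qed

lemma resonant_tail_0:
  "resonant_tail (tail_0 u) (\<lambda>t. \<gamma>2 * tail_0 u t - exp ((\<gamma>2 - 1) * t) * u' (exp (- t))) (tail_0 g)
     (2 * \<gamma>2 - 1) (\<gamma>2 * (\<gamma>2 - 1))"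
proof
  let ?G = "\<lambda>t. \<gamma>2 * tail_0 u t - exp ((\<gamma>2 - 1) * t) * u' (exp (- t))"
  show "0 < 2 * \<gamma>2 - 1" "0 < \<gamma>2 * (\<gamma>2 - 1)" using \<gamma>2 by auto
  have exp: "((\<lambda>t. exp (- t)) has_real_derivative - exp (- t)) (at t)" for t :: real
    by (auto intro!: derivative_eq_intros)
  have F: "(tail_0 u has_real_derivative ?G t) (at t)" for t
  proof -
    have "((\<lambda>t. u (exp (- t))) has_real_derivative u' (exp (- t)) * - exp (- t)) (at t)"
      by (intro DERIV_chain2[OF u_deriv exp]) simp
    moreover have "((\<lambda>t. exp (\<gamma>2 * t)) has_real_derivative exp (\<gamma>2 * t) * \<gamma>2) (at t)"
      by (auto intro!: derivative_eq_intros)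
    moreover have "exp ((\<gamma>2 - 1) * t) = exp (\<gamma>2 * t) * exp (- t)" by (simp add: algebra_simps flip: exp_add)
    ultimately show ?thesis
      unfolding tail_0_def by (intro DERIV_cong[OF DERIV_mult]) (auto simp: algebra_simps)
  qed
  show "eventually (\<lambda>t. (tail_0 u has_real_derivative ?G t) (at t)) at_top" using F by simp
  show "eventually (\<lambda>t. (?G has_real_derivative (2 * \<gamma>2 - 1) * ?G t - \<gamma>2 * (\<gamma>2 - 1) * tail_0 g t) (at t)) at_top"
    using eventually_gt_at_top[of "- ln b"]
  proof eventually_elim
    case (elim t)
    then have "exp (- t) \<le> b" using b by (metis exp_ln exp_le_cancel_iff minus_less_iff less_imp_le)
    then have c: "diffusion_coeff b (exp (- t)) = \<gamma>2 * (\<gamma>2 - 1) / (exp (- t))\<^sup>2" by (simp add: diffusion_coeff_def)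
    have "((\<lambda>t. u' (exp (- t))) has_real_derivative \<gamma>2 * (\<gamma>2 - 1) / (exp (- t))\<^sup>2 * (u (exp (- t)) - g (exp (- t))) * - exp (- t)) (at t)"
      using DERIV_chain2[OF u'_deriv[of "exp (- t)"] exp] by (simp add: c)
    moreover have "((\<lambda>t. exp ((\<gamma>2 - 1) * t)) has_real_derivative exp ((\<gamma>2 - 1) * t) * (\<gamma>2 - 1)) (at t)"
      by (auto intro!: derivative_eq_intros)
    ultimately have D: "(?G has_real_derivative \<gamma>2 * ?G t - (exp ((\<gamma>2 - 1) * t) * (\<gamma>2 - 1) * u' (exp (- t))
        + \<gamma>2 * (\<gamma>2 - 1) / (exp (- t))\<^sup>2 * (u (exp (- t)) - g (exp (- t))) * - exp (- t) * exp ((\<gamma>2 - 1) * t))) (at t)"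
      by (intro DERIV_diff DERIV_cmult F DERIV_mult)
    have "exp ((\<gamma>2 - 1) * t) = exp (\<gamma>2 * t) * exp (- t)" by (simp add: algebra_simps flip: exp_add)
    then have "\<gamma>2 * (\<gamma>2 - 1) / (exp (- t))\<^sup>2 * (u (exp (- t)) - g (exp (- t))) * - exp (- t) * exp ((\<gamma>2 - 1) * t)
        = \<gamma>2 * (\<gamma>2 - 1) * (tail_0 g t - tail_0 u t)"
      by (simp add: tail_0_def power2_eq_square field_simps)
    from D[unfolded this] show ?case
      by (rule DERIV_cong) (simp add: algebra_simps)
  qed
  have "((\<lambda>t. \<gamma>2 * (t ^ 0 * exp (- (\<gamma>2 - 1) * t)) * u (exp (- t)) - (t ^ 0 * exp (- \<gamma>2 * t)) * u' (exp (- t))) \<longlongrightarrow> 0 - 0) at_top"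
  proof (intro tendsto_diff)
    have "filterlim (\<lambda>t. exp (- t)) (at_right 0) (at_top :: real filter)"
      unfolding filterlim_at using filterlim_compose[OF exp_at_bot filterlim_uminus_at_bot_at_top] by simp
    then have 1: "((\<lambda>t. u (exp (- t))) \<longlongrightarrow> 0) at_top"
      by (rule filterlim_compose[OF u_lim_0])
    have "((\<lambda>t. \<gamma>2 * (t ^ 0 * exp (- (\<gamma>2 - 1) * t)) * u (exp (- t))) \<longlongrightarrow> \<gamma>2 * 0 * 0) at_top"
      using \<gamma>2 by (intro tendsto_mult tendsto_const 1 power_times_exp_neg_tendsto_0) auto
    then show "((\<lambda>t. \<gamma>2 * (t ^ 0 * exp (- (\<gamma>2 - 1) * t)) * u (exp (- t))) \<longlongrightarrow> 0) at_top" by simp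
    show "((\<lambda>t. (t ^ 0 * exp (- \<gamma>2 * t)) * u' (exp (- t))) \<longlongrightarrow> 0) at_top"
    proof (rule Lim_null_comparison)
      show "eventually (\<lambda>t. norm (t ^ 0 * exp (- \<gamma>2 * t) * u' (exp (- t))) \<le> t ^ 0 * exp (- \<gamma>2 * t) * u' b) at_top"
        using u'_le u'_pos by (intro always_eventually allI) (simp add: abs_mult less_imp_le)
      show "((\<lambda>t. t ^ 0 * exp (- \<gamma>2 * t) * u' b) \<longlongrightarrow> 0) at_top"
        using tendsto_mult_right[OF power_times_exp_neg_tendsto_0[of \<gamma>2 0], of "u' b"] \<gamma>2 by simp
    qed
  qed
  moreover have "\<gamma>2 * (t ^ 0 * exp (- (\<gamma>2 - 1) * t)) * u (exp (- t)) - (t ^ 0 * exp (- \<gamma>2 * t)) * u' (exp (- t))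
      = exp (- (2 * \<gamma>2 - 1) * t) * ?G t" for t
  proof -
    have "exp (- (2 * \<gamma>2 - 1) * t) * exp (\<gamma>2 * t) = exp (- (\<gamma>2 - 1) * t)"
      "exp (- (2 * \<gamma>2 - 1) * t) * exp ((\<gamma>2 - 1) * t) = exp (- \<gamma>2 * t)"
      by (simp_all add: algebra_simps flip: exp_add)
    then show ?thesis
      unfolding tail_0_def by (simp only: right_diff_distrib) (simp add: mult_ac)
  qed
  ultimately show "((\<lambda>t. exp (- (2 * \<gamma>2 - 1) * t) * ?G t) \<longlongrightarrow> 0) at_top" by simp
qed

lemma power_log_tails_Suc: "power_log_tails j g \<Longrightarrow> power_log_tails (Suc j) u"
  unfolding power_log_tails_def
  using resonant_tail.grows_like_power_Suc[OF resonant_tail_inf] resonant_tail.grows_like_power_Suc[OF resonant_tail_0]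
  by blast

lemma power_log_tails_0: "flat_tails g \<Longrightarrow> power_log_tails 0 u"
  unfolding power_log_tails_def flat_tails_def
  using u_pos u_less_1
  by (intro conjI resonant_tail.grows_like_power_0[OF resonant_tail_inf] resonant_tail.grows_like_power_0[OF resonant_tail_0])
     (auto simp: tail_inf_def tail_0_def)

end

section \<open>Gluing the branches and iterating\<close>

text \<open>
  Used twice, for the glued function and for its derivative.
\<close>

lemma has_real_derivative_glue:
  fixes A B A' B' :: "real \<Rightarrow> real"
  assumes A: "(A has_real_derivative A' x) (at x)" and B: "(B has_real_derivative B' x) (at x)"
    and b: "A b = B b" "A' b = B' b"
  shows "((\<lambda>y. if b < y then A y else B y) has_real_derivative (if b < x then A' x else B' x)) (at x)"
proof -
  let ?f = "\<lambda>y. if b < y then A y else B y"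
  consider "b < x" | "x < b" | "x = b" by linarith
  then show ?thesis
  proof cases
    case 1
    then have "eventually (\<lambda>y. b < y) (nhds x)" by (intro order_tendstoD[OF filterlim_ident])
    then have "eventually (\<lambda>y. ?f y = A y) (nhds x)" by eventually_elim simp
    then show ?thesis using A 1 by (subst DERIV_cong_ev[OF refl _ refl]) auto
  next
    case 2
    then have "eventually (\<lambda>y. y < b) (nhds x)" by (intro order_tendstoD[OF filterlim_ident])
    then have "eventually (\<lambda>y. ?f y = B y) (nhds x)" by eventually_elim simp
    then show ?thesis using B 2 by (subst DERIV_cong_ev[OF refl _ refl]) auto
  next
    case 3
    have "((\<lambda>y. (?f y - ?f b) / (y - b)) \<longlongrightarrow> B' b) (at b)"
      unfolding filterlim_at_split
    proof
      have "((\<lambda>y. (B y - B b) / (y - b)) \<longlongrightarrow> B' b) (at_left b)"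
        using B 3 by (auto simp: has_field_derivative_iff intro: filterlim_mono at_le)
      then show "((\<lambda>y. (?f y - ?f b) / (y - b)) \<longlongrightarrow> B' b) (at_left b)"
        by (rule Lim_transform_eventually) (auto simp: eventually_at_filter)
      have "((\<lambda>y. (A y - A b) / (y - b)) \<longlongrightarrow> A' b) (at_right b)"
        using A 3 by (auto simp: has_field_derivative_iff intro: filterlim_mono at_le)
      then show "((\<lambda>y. (?f y - ?f b) / (y - b)) \<longlongrightarrow> B' b) (at_right b)"
        unfolding b(2) by (rule Lim_transform_eventually) (auto simp: eventually_at_filter b)
    qed
    then show ?thesis using 3 by (simp add: has_field_derivative_iff)
  qed
qed

context s_shaped
begin

lemma bounded_profile: "bounded_profile g 1"
proof
  show "continuous_on {0<..} g" using g_cont by (rule continuous_on_subset) auto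
  show "\<bar>g s\<bar> \<le> 1" if "0 < s" for s using g_nonneg[of s] g_le_1[of s] that by simp
qed

lemma bounded_profile_complement: "bounded_profile (\<lambda>x. 1 - g x) 1"
proof
  show "continuous_on {0<..} (\<lambda>x. 1 - g x)"
    by (intro continuous_intros bounded_profile.cont[OF bounded_profile])
  show "\<bar>1 - g s\<bar> \<le> 1" if "0 < s" for s using g_nonneg[of s] g_le_1[of s] that by simp
qed

text \<open>
  The decay of \<open>g x / x\<close> contains the limit.
\<close>

lemma g_lim_0: "(g \<longlongrightarrow> 0) (at_right 0)"
proof -
  have "((\<lambda>x. g x / x * x) \<longlongrightarrow> 0 * 0) (at_right 0)"
    by (intro tendsto_mult g_sublinear tendsto_ident_at)
  then have "((\<lambda>x. g x / x * x) \<longlongrightarrow> 0) (at_right 0)" by simp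
  then show ?thesis
    by (rule Lim_transform_eventually) (auto simp: eventually_at_filter)
qed

lemma T_op_switched_solution:
  assumes b: "0 < b" and root: "beta_op \<gamma>1 \<gamma>2 g b = g b"
  shows "switched_solution \<gamma>1 \<gamma>2 g b0 b (T_op \<gamma>1 \<gamma>2 b g)
    (\<lambda>x. if b < x then T_branch_deriv \<gamma>1 \<gamma>2 \<gamma>1 \<infinity> b g x else T_branch_deriv \<gamma>1 \<gamma>2 \<gamma>2 0 b g x)"
proof -
  let ?A = "T_branch \<gamma>1 \<gamma>2 \<gamma>1 \<infinity> b g" and ?A' = "T_branch_deriv \<gamma>1 \<gamma>2 \<gamma>1 \<infinity> b g"
  let ?B = "T_branch \<gamma>1 \<gamma>2 \<gamma>2 0 b g" and ?B' = "T_branch_deriv \<gamma>1 \<gamma>2 \<gamma>2 0 b g"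
  let ?u = "T_op \<gamma>1 \<gamma>2 b g"
  interpret P: bounded_profile g 1 by (rule bounded_profile)
  interpret S: bounded_profile "\<lambda>s. g (b * s)" 1
    using P.cont P.bounded b unfolding bounded_profile_def
    by (auto intro!: continuous_on_compose2[of "{0<..}" g] continuous_intros)
  have \<gamma>1': "\<gamma>1 < 1" using \<gamma>1 by simp
  have A: "(?A has_real_derivative ?A' x) (at x)"
    "(?A' has_real_derivative \<gamma>1 * (\<gamma>1 - 1) / x\<^sup>2 * (?A x - g x)) (at x)" if "0 < x" for x
    using T_branch_ode[OF b that P.cont S.moment_inf_deriv[OF \<gamma>1']] by auto
  have B: "(?B has_real_derivative ?B' x) (at x)"
    "(?B' has_real_derivative \<gamma>2 * (\<gamma>2 - 1) / x\<^sup>2 * (?B x - g x)) (at x)" if "0 < x" for x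
    using T_branch_ode[OF b that P.cont S.moment_0_deriv[OF \<gamma>2]] by auto
  have Ab: "?A b = g b" and Bb: "?B b = g b" and AB': "?A' b = ?B' b"
    using T_branch_at_base(1)[OF b] root T_branch_derivs_match[OF bounded_profile b] by auto
  have lim0: "(?B \<longlongrightarrow> 0) (at_right 0)"
    by (rule T_branch_tendsto_at_right_0[OF b \<gamma>2 bounded_profile g_lim_0])
  have u: "?u x = (if b < x then ?A x else ?B x)" if "0 < x" for x
    using that by (simp add: T_op_def)
  show ?thesis
  proof (unfold_locales)
    show "0 < b" by (rule b)
    show "?u 0 = 0" using b tendsto_Lim[OF _ lim0] by (simp add: T_op_def)
    show "?u b = g b" using b Bb by (simp add: T_op_def)
    have "eventually (\<lambda>x. x < b) (at_right 0)" using b by (auto simp: eventually_at_right_field)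
    then have "eventually (\<lambda>x. ?B x = ?u x) (at_right 0)"
      unfolding eventually_at_filter by eventually_elim (use u in auto)
    with lim0 show "(?u \<longlongrightarrow> 0) (at_right 0)" by (rule Lim_transform_eventually)
    have "eventually (\<lambda>x. ?A x = ?u x) at_top"
      using eventually_gt_at_top[of b] by eventually_elim (use u b in auto)
    with T_branch_tendsto_at_top[OF b \<gamma>1 bounded_profile g_lim] show "(?u \<longlongrightarrow> 1) at_top"
      by (rule Lim_transform_eventually)
    fix x :: real assume x: "0 < x"
    have "eventually (\<lambda>y. 0 < y) (nhds x)" using x by (intro order_tendstoD[OF filterlim_ident])
    then have "eventually (\<lambda>y. ?u y = (if b < y then ?A y else ?B y)) (nhds x)"
      by eventually_elim (rule u)
    then show "(?u has_real_derivative (if b < x then ?A' x else ?B' x)) (at x)"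
      using has_real_derivative_glue[of ?A ?A' x ?B ?B' b, OF A(1)[OF x] B(1)[OF x]] Ab Bb AB'
      by (subst DERIV_cong_ev[OF refl _ refl]) auto
    have "((\<lambda>x. if b < x then ?A' x else ?B' x) has_real_derivative
        (if b < x then \<gamma>1 * (\<gamma>1 - 1) / x\<^sup>2 * (?A x - g x) else \<gamma>2 * (\<gamma>2 - 1) / x\<^sup>2 * (?B x - g x))) (at x)"
      by (rule has_real_derivative_glue[where A = ?A' and B = ?B'
          and A' = "\<lambda>x. \<gamma>1 * (\<gamma>1 - 1) / x\<^sup>2 * (?A x - g x)" and B' = "\<lambda>x. \<gamma>2 * (\<gamma>2 - 1) / x\<^sup>2 * (?B x - g x)"])
        (use A(2)[OF x] B(2)[OF x] AB' Ab Bb in auto)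
    then show "((\<lambda>x. if b < x then ?A' x else ?B' x) has_real_derivative
        diffusion_coeff b x * (?u x - g x)) (at x)"
      by (rule DERIV_cong) (auto simp: u[OF x] diffusion_coeff_def)
  qed
qed

end

context euler_exponents
begin

text \<open>
  The density is positive on \<open>(0,\<infinity>)\<close>, so \<open>\<beta>\<close> sees every interval on which \<open>\<phi>\<close> is positive.
\<close>

lemma beta_op_pos:
  assumes \<phi>: "bounded_profile \<phi> M" and nonneg: "\<And>x. 0 < x \<Longrightarrow> 0 \<le> \<phi> x"
    and pq: "0 \<le> p" "p < q" and pos: "\<And>x. p < x \<Longrightarrow> x < q \<Longrightarrow> 0 < \<phi> x" and b: "0 < b"
  shows "0 < beta_op \<gamma>1 \<gamma>2 \<phi> b"
proof (rule ccontr)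
  assume contr: "\<not> ?thesis"
  define K where "K = (\<lambda>r. indicator {0<..} r *\<^sub>R (\<phi> (b * r) * dens \<gamma>1 \<gamma>2 r))"
  have int: "integrable lborel K"
    using integrable_mult_dens[OF \<phi> b] unfolding K_def set_integrable_def .
  have K0: "0 \<le> K r" for r
    using nonneg b dens_nonneg by (auto simp: K_def indicator_def)
  have "integral\<^sup>L lborel K \<le> 0"
    using contr unfolding beta_op_eq_set_integral set_lebesgue_integral_def K_def by simp
  then have "integral\<^sup>L lborel K = 0"
    using K0 by (intro antisym integral_nonneg_AE) auto
  then have AE: "AE r in lborel. K r = 0"
    using integral_nonneg_eq_0_iff_AE[OF int] K0 by simp
  have dens: "0 < dens \<gamma>1 \<gamma>2 r" if "0 < r" for r
    using that \<gamma>1 \<gamma>2 by (auto simp: dens_def indicator_def mult_neg_neg)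
  have "AE r in lborel. r \<notin> {p / b<..<q / b}"
    using AE
  proof eventually_elim
    case (elim r)
    show ?case
    proof
      assume r: "r \<in> {p / b<..<q / b}"
      moreover have "0 \<le> p / b" using pq b by simp
      ultimately have "0 < r" by (metis greaterThanLessThan_iff order.strict_trans1)
      have "p < b * r" "b * r < q" using r b by (auto simp: field_simps)
      then have "0 < K r" using pos dens \<open>0 < r\<close> by (simp add: K_def)
      then show False using elim by simp
    qed
  qed
  then have "emeasure lborel {p / b<..<q / b} = 0"
    by (subst (asm) AE_iff_measurable[of "{p / b<..<q / b}"]) auto
  moreover have "p / b < q / b" using pq b by (simp add: divide_strict_right_mono)
  ultimately show False using pq b by simp
qed

end

context s_shaped
begin

text \<open>
  Where \<open>g\<close> has reached one of its limits \<open>0\<close> and \<open>1\<close>, the average \<open>\<beta>[g]\<close> still lies strictly between them.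
\<close>

lemma root_exists_flat:
  assumes "flat_tails g"
  shows "\<exists>b>0. beta_op \<gamma>1 \<gamma>2 g b = g b"
proof -
  have "eventually (\<lambda>t. tail_inf g t = 0 \<and> tail_0 g t = 0 \<and> 0 < t) at_top"
    using assms eventually_gt_at_top[of "0::real"] unfolding flat_tails_def by (simp add: eventually_conj_iff)
  then obtain t where t: "0 < t" "g (exp t) = 1" "g (exp (- t)) = 0"
    unfolding eventually_at_top_linorder tail_inf_def tail_0_def by auto
  have "eventually (\<lambda>x. 0 < g x) at_top" using g_lim by (intro order_tendstoD) auto
  then obtain R where R: "\<And>x. R \<le> x \<Longrightarrow> 0 < g x" by (auto simp: eventually_at_top_linorder)
  have "0 < beta_op \<gamma>1 \<gamma>2 g (exp (- t))"
    by (rule beta_op_pos[OF bounded_profile, of "max 0 R" "max 0 R + 1"]) (auto intro: R g_nonneg)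
  moreover have "eventually (\<lambda>x. g x < 1) (at_right 0)" using g_lim_0 by (intro order_tendstoD) auto
  then obtain r where r: "0 < r" "\<And>x. 0 < x \<Longrightarrow> x < r \<Longrightarrow> g x < 1"
    by (auto simp: eventually_at_right_field)
  have "0 < beta_op \<gamma>1 \<gamma>2 (\<lambda>x. 1 - g x) (exp t)"
    by (rule beta_op_pos[OF bounded_profile_complement, of 0 r]) (use r g_le_1 in auto)
  ultimately show ?thesis
    using t beta_op_complement[OF bounded_profile, of "exp t"]
    by (intro beta_op_root[OF bounded_profile, of "exp (- t)" "exp t"]) auto
qed

lemma root_exists_power_log:
  assumes tails: "power_log_tails j g" and strict: "\<And>x. 0 < x \<Longrightarrow> 0 < g x \<and> g x < 1"
  shows "\<exists>b>0. beta_op \<gamma>1 \<gamma>2 g b = g b"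
proof -
  obtain n where n: "g (inverse (real (Suc n))) < beta_op \<gamma>1 \<gamma>2 g (inverse (real (Suc n)))"
    using beta_op_exceeds[OF bounded_profile _ _ _ _ power_log_tails_ratio_at_0[OF tails]]
      g_nonneg strict \<gamma>2 by auto
  obtain m where m: "1 - g (real (Suc m)) < beta_op \<gamma>1 \<gamma>2 (\<lambda>x. 1 - g x) (real (Suc m))"
    using beta_op_exceeds[OF bounded_profile_complement _ _ _ _ power_log_tails_ratio_at_top[OF tails]]
      g_le_1 strict \<gamma>1 by auto
  have "inverse (real (Suc n)) \<le> 1" by (simp add: inverse_le_1_iff)
  then show ?thesis
    using n m beta_op_complement[OF bounded_profile, of "real (Suc m)"]
    by (intro beta_op_root[OF bounded_profile, of "inverse (real (Suc n))" "real (Suc m)"]) auto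
qed

end

context euler_exponents
begin

text \<open>
  The induction hypothesis of the iteration. The initial function has flat tails; all later iterates have power-logarithmic
  ones and lie strictly between \<open>0\<close> and \<open>1\<close>, which the ratios in Fatou's lemma require.
\<close>

definition iterable :: "(real \<Rightarrow> real) \<Rightarrow> bool" where
  "iterable g \<longleftrightarrow> (\<exists>b0. s_shaped \<gamma>1 \<gamma>2 g b0) \<and>
     (flat_tails g \<or> (\<exists>j. power_log_tails j g) \<and> (\<forall>x>0. 0 < g x \<and> g x < 1))"

text \<open>
  The root is unique for iterable functions, so the choice is immaterial.
\<close>

definition switch_point :: "(real \<Rightarrow> real) \<Rightarrow> real" where
  "switch_point g = (SOME b. 0 < b \<and> beta_op \<gamma>1 \<gamma>2 g b = g b)"

lemma iterable_step:
  assumes "iterable g"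
  defines "b \<equiv> switch_point g" and "u \<equiv> T_op \<gamma>1 \<gamma>2 (switch_point g) g"
  shows "0 < b" "beta_op \<gamma>1 \<gamma>2 g b = g b"
    and "\<And>c. 0 < c \<Longrightarrow> beta_op \<gamma>1 \<gamma>2 g c = g c \<Longrightarrow> c = b"
    and "\<exists>b0 u'. switched_solution \<gamma>1 \<gamma>2 g b0 b u u'"
    and "\<exists>j. power_log_tails j u" and "iterable u"
proof -
  obtain b0 where "s_shaped \<gamma>1 \<gamma>2 g b0" using assms by (auto simp: iterable_def)
  then interpret s_shaped \<gamma>1 \<gamma>2 g b0 .
  have "\<exists>b. 0 < b \<and> beta_op \<gamma>1 \<gamma>2 g b = g b"
    using assms root_exists_flat root_exists_power_log unfolding iterable_def by blast
  from someI_ex[OF this] show b: "0 < b" "beta_op \<gamma>1 \<gamma>2 g b = g b"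
    unfolding b_def switch_point_def by auto
  note sol = T_op_switched_solution[OF b]
  show "c = b" if "0 < c" "beta_op \<gamma>1 \<gamma>2 g c = g c" for c
    using switched_solution_unique[OF T_op_switched_solution[OF that] sol] .
  show ex: "\<exists>b0 u'. switched_solution \<gamma>1 \<gamma>2 g b0 b u u'"
    using sol unfolding u_def b_def by blast
  from sol interpret switched_solution \<gamma>1 \<gamma>2 g b0 b u
      "\<lambda>x. if b < x then T_branch_deriv \<gamma>1 \<gamma>2 \<gamma>1 \<infinity> b g x else T_branch_deriv \<gamma>1 \<gamma>2 \<gamma>2 0 b g x"
    unfolding u_def b_def .
  show j: "\<exists>j. power_log_tails j u"
    using assms power_log_tails_0 power_log_tails_Suc unfolding iterable_def by blast
  then have "((\<lambda>x. u x / x) \<longlongrightarrow> 0) (at_right 0)" using power_log_tails_sublinear by blast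
  then have "s_shaped \<gamma>1 \<gamma>2 u b"
    using u_cont u_0 u_lim u_bounds_weak b strictly_convex_on_imp_convex_on[OF u_strictly_convex]
      strictly_concave_on_imp_concave_on[OF u_strictly_concave]
    by unfold_locales auto
  then show "iterable u"
    using j u_pos u_less_1 unfolding iterable_def by (auto simp: less_imp_le)
qed

text \<open>
  The bounds \<open>0 \<le> h \<le> 1\<close> come from the shape: on \<open>[0,b0]\<close> convexity compares \<open>h\<close> with its vanishing piece and with
  the chord to \<open>b0\<close>, on \<open>[b0,\<infinity>)\<close> concavity compares it with the piece where it equals \<open>1\<close>.
\<close>

lemma admissible_iterable:
  assumes "admissible h"
  shows "iterable h"
proof -
  obtain x0 b0 where x0: "0 < x0" "x0 < 1"
    and ends: "\<And>x. 0 < x \<Longrightarrow> x \<le> x0 \<Longrightarrow> h (inverse x) = 1 \<and> h x = 0"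
    and b0: "x0 < b0" "b0 < inverse x0"
    and conv: "convex_on {0..b0} h" and conc: "concave_on {b0..} h"
    and cont: "continuous_on {0..} h"
    using assms unfolding admissible_def by auto
  have one: "h x = 1" if "inverse x0 \<le> x" for x
  proof -
    have "0 < x" using that x0 by (metis inverse_positive_iff_positive order_less_le_trans)
    then show ?thesis using ends[of "inverse x"] that x0 by (simp add: inverse_le_imp_le)
  qed
  have ev0: "eventually (\<lambda>x. h x = 0) (at_right 0)"
    unfolding eventually_at_right_field using ends x0 by (intro exI[of _ x0]) auto
  have h0: "h 0 = 0"
  proof -
    have "(h \<longlongrightarrow> h 0) (at 0 within {0..})" using cont by (simp add: continuous_on_def)
    then have "(h \<longlongrightarrow> h 0) (at_right 0)" by (simp add: at_within_Ici_at_right)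
    then show ?thesis using tendsto_unique[OF _ _ tendsto_eventually[OF ev0]] by force
  qed
  have left_nonneg: "0 \<le> h x" if x: "0 \<le> x" "x \<le> b0" for x
  proof (cases "x \<le> x0")
    case True
    then show ?thesis using ends[of x] h0 x by (cases "x = 0") auto
  next
    case False
    define t where "t = x0 / x"
    have t: "0 < t" "t < 1" "t * x = x0" using False x0 by (auto simp: t_def)
    have "h ((1 - t) *\<^sub>R 0 + t *\<^sub>R x) \<le> (1 - t) * h 0 + t * h x"
      using convex_onD[OF conv, of t 0 x] t x b0 x0 by simp
    then have "0 \<le> t * h x" using t ends[of x0] x0 h0 by simp
    then show ?thesis using t by (simp add: zero_le_mult_iff)
  qed
  have concD: "(1 - t) * h x + t * h y \<le> h ((1 - t) * x + t * y)"
    if "0 \<le> t" "t \<le> 1" "b0 \<le> x" "b0 \<le> y" for t x y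
    using convex_onD[OF conc[unfolded concave_on_def], of t x y] that by simp
  have right_le: "h x \<le> 1" if x: "b0 \<le> x" for x
  proof (cases "inverse x0 \<le> x")
    case False
    \<comment> \<open>The reflection of \<open>x\<close> at \<open>inverse x0\<close>, so that \<open>inverse x0\<close> is the midpoint.\<close>
    define y where "y = 2 * inverse x0 - x"
    have "inverse x0 \<le> y" using False by (simp add: y_def)
    moreover have mid: "(1 - 1/2) * x + 1/2 * y = inverse x0" by (simp add: y_def diff_divide_distrib)
    ultimately have "(1 - 1/2) * h x + 1/2 * h y \<le> h (inverse x0)"
      using concD[of "1/2" x y] x b0 unfolding mid by simp
    then show ?thesis using one \<open>inverse x0 \<le> y\<close> by simp
  qed (use one in simp)
  have right_nonneg: "0 \<le> h x" if x: "b0 \<le> x" for x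
  proof (cases "inverse x0 \<le> x")
    case False
    \<comment> \<open>The position of \<open>x\<close> between \<open>b0\<close> and the start of the piece where \<open>h = 1\<close>.\<close>
    define t where "t = (x - b0) / (inverse x0 - b0)"
    have t: "0 \<le> t" "t \<le> 1" using False x by (auto simp: t_def field_simps)
    have "t * (inverse x0 - b0) = x - b0" using b0 by (simp add: t_def)
    then have "(1 - t) * b0 + t * inverse x0 = x" by (simp add: algebra_simps)
    then have "(1 - t) * h b0 + t * 1 \<le> h x"
      using concD[OF t, of b0 "inverse x0"] b0 one[of "inverse x0"] by simp
    moreover have "0 \<le> (1 - t) * h b0" using t left_nonneg[of b0] b0 x0 by simp
    ultimately show ?thesis using t by simp
  qed (use one in simp)
  have left_le: "h x \<le> 1" if x: "0 \<le> x" "x \<le> b0" for x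
  proof -
    define t where "t = x / b0"
    have t: "0 \<le> t" "t \<le> 1" "t * b0 = x" using x x0 b0 by (auto simp: t_def)
    then have "h x \<le> t * h b0" using convex_onD[OF conv, of t 0 b0] x0 b0 h0 by simp
    also have "\<dots> \<le> 1 * 1" using t right_le[of b0] left_nonneg[of b0] x0 b0 by (intro mult_mono) auto
    finally show ?thesis by simp
  qed
  have "s_shaped \<gamma>1 \<gamma>2 h b0"
  proof
    show "continuous_on {0..} h" "h 0 = 0" by fact+
    have "eventually (\<lambda>x. h x = 1) at_top"
      using eventually_ge_at_top[of "inverse x0"] by eventually_elim (rule one)
    then show "(h \<longlongrightarrow> 1) at_top" by (rule tendsto_eventually)
    show "0 \<le> h x" "h x \<le> 1" if "0 \<le> x" for x
      using that left_nonneg right_nonneg left_le right_le by (cases "x \<le> b0"; simp)+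
    show "0 < b0" using x0 b0 by simp
    show "convex_on {0<..<b0} h" by (rule convex_on_subset[OF conv]) auto
    show "concave_on {b0<..} h"
      using conc unfolding concave_on_def by (rule convex_on_subset) auto
    have "eventually (\<lambda>x. h x / x = 0) (at_right 0)" using ev0 by eventually_elim simp
    then show "((\<lambda>x. h x / x) \<longlongrightarrow> 0) (at_right 0)" by (rule tendsto_eventually)
  qed
  moreover have "flat_tails h"
    unfolding flat_tails_def
  proof
    show "eventually (\<lambda>t. tail_inf h t = 0) at_top"
      using eventually_ge_at_top[of "ln (inverse x0)"]
    proof eventually_elim
      case (elim t)
      then have "inverse x0 \<le> exp t" using x0 by (metis exp_le_cancel_iff exp_ln inverse_positive_iff_positive)
      then show ?case by (simp add: tail_inf_def one)
    qed
    show "eventually (\<lambda>t. tail_0 h t = 0) at_top"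
      using eventually_ge_at_top[of "- ln x0"]
    proof eventually_elim
      case (elim t)
      then have "exp (- t) \<le> x0" using x0 by (metis exp_le_cancel_iff exp_ln minus_le_iff)
      then show ?case using ends[of "exp (- t)"] by (simp add: tail_0_def)
    qed
  qed
  ultimately show ?thesis by (auto simp: iterable_def)
qed

end

text \<open>
  The exponents are the negative root and the root above \<open>1\<close> of \<open>\<gamma> (\<gamma> - 1) = 2 n / (T \<sigma>\<^sup>2)\<close>, each with
  its own volatility; this turns the Euler equation into the equation of the theorem.
\<close>

lemma gamma1_facts:
  assumes "0 < \<sigma>" "0 < T" "1 \<le> n"
  shows "gamma1 n T \<sigma> < 0" "gamma1 n T \<sigma> * (gamma1 n T \<sigma> - 1) = 2 * real n / (T * \<sigma>\<^sup>2)"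
proof -
  have m: "8 * real n / (T * \<sigma>\<^sup>2) > 0" using assms by simp
  then show "gamma1 n T \<sigma> < 0" by (simp add: gamma1_def)
  define s where "s = sqrt (1 + 8 * real n / (T * \<sigma>\<^sup>2))"
  have "s * s = 1 + 8 * real n / (T * \<sigma>\<^sup>2)" using m by (simp add: s_def)
  then show "gamma1 n T \<sigma> * (gamma1 n T \<sigma> - 1) = 2 * real n / (T * \<sigma>\<^sup>2)"
    unfolding gamma1_def s_def[symmetric] by (simp add: field_simps)
qed

lemma gamma2_facts:
  assumes "0 < \<sigma>" "0 < T" "1 \<le> n"
  shows "1 < gamma2 n T \<sigma>" "gamma2 n T \<sigma> * (gamma2 n T \<sigma> - 1) = 2 * real n / (T * \<sigma>\<^sup>2)"
proof -
  have m: "8 * real n / (T * \<sigma>\<^sup>2) > 0" using assms by simp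
  then show "1 < gamma2 n T \<sigma>" by (simp add: gamma2_def)
  define s where "s = sqrt (1 + 8 * real n / (T * \<sigma>\<^sup>2))"
  have "s * s = 1 + 8 * real n / (T * \<sigma>\<^sup>2)" using m by (simp add: s_def)
  then show "gamma2 n T \<sigma> * (gamma2 n T \<sigma> - 1) = 2 * real n / (T * \<sigma>\<^sup>2)"
    unfolding gamma2_def s_def[symmetric] by (simp add: field_simps)
qed

theorem proposition5p1:
  fixes n :: nat and T \<sigma>1 \<sigma>2 \<gamma>1 \<gamma>2 :: real and h :: "real \<Rightarrow> real"
  assumes "0 < \<sigma>1" and "\<sigma>1 < \<sigma>2" and "0 < T" and "1 \<le> n"
    and "\<gamma>1 = gamma1 n T \<sigma>1" and "\<gamma>2 = gamma2 n T \<sigma>2"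
    and "admissible h"
  shows "\<exists>(U :: nat \<Rightarrow> real \<Rightarrow> real) (b :: nat \<Rightarrow> real).
    U 0 = h \<and>
    (\<forall>k<n.
       0 < b (Suc k) \<and>
       beta_op \<gamma>1 \<gamma>2 (U k) (b (Suc k)) = U k (b (Suc k)) \<and>
       (\<forall>c>0. beta_op \<gamma>1 \<gamma>2 (U k) c = U k c \<longrightarrow> c = b (Suc k)) \<and>
       U (Suc k) = T_op \<gamma>1 \<gamma>2 (b (Suc k)) (U k) \<and>
       (\<forall>x. 0 < x \<and> x \<le> b (Suc k) \<longrightarrow>
          - (1 / 2) * x\<^sup>2 * \<sigma>2\<^sup>2 * deriv (deriv (U (Suc k))) x
            + real n / T * (U (Suc k) x - U k x) = 0) \<and>
       (\<forall>x. x > b (Suc k) \<longrightarrow>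
          - (1 / 2) * x\<^sup>2 * \<sigma>1\<^sup>2 * deriv (deriv (U (Suc k))) x
            + real n / T * (U (Suc k) x - U k x) = 0)) \<and>
    (\<forall>k\<in>{1..n}.
       strictly_convex_on {0<..<b k} (U k) \<and> strictly_concave_on {b k<..} (U k) \<and>
       (\<forall>x\<in>{0<..} - {b k}. (b k - x) * (U k x - U (k - 1) x) > 0) \<and>
       strict_mono_on {0..} (U k) \<and> U k ` {0..} \<subseteq> {0..<1} \<and> C2_on {0<..} (U k) \<and>
       (\<exists>(a1 :: real) (a2 :: real) (\<delta>1 :: int) (\<delta>2 :: int).
          (\<lambda>x. 1 - U k x) \<sim>[at_top] (\<lambda>x. a1 * x powr \<gamma>1 * ln x powi \<delta>1) \<and>
          U k \<sim>[at_right 0] (\<lambda>x. a2 * x powr \<gamma>2 * ln x powi \<delta>2)))"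
proof -
  have \<sigma>2: "0 < \<sigma>2" using assms by simp
  have exps: "\<gamma>1 < 0" "1 < \<gamma>2" "\<gamma>1 * (\<gamma>1 - 1) = 2 * real n / (T * \<sigma>1\<^sup>2)" "\<gamma>2 * (\<gamma>2 - 1) = 2 * real n / (T * \<sigma>2\<^sup>2)"
    using gamma1_facts[of \<sigma>1 T n] gamma2_facts[of \<sigma>2 T n] assms \<sigma>2 by auto
  interpret euler_exponents \<gamma>1 \<gamma>2 using exps by unfold_locales
  define U where "U = rec_nat h (\<lambda>_ g. T_op \<gamma>1 \<gamma>2 (switch_point g) g)"
  define b where "b = (\<lambda>k. switch_point (U (k - 1)))"
  have U0: "U 0 = h" and USuc: "U (Suc k) = T_op \<gamma>1 \<gamma>2 (switch_point (U k)) (U k)" for k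
    by (simp_all add: U_def)
  have it: "iterable (U k)" for k
  proof (induction k)
    case (Suc k)
    then show ?case unfolding USuc by (rule iterable_step(6))
  next
    case 0
    show ?case unfolding U0 by (rule admissible_iterable[OF assms(7)])
  qed
  have bSuc: "b (Suc k) = switch_point (U k)" for k by (simp add: b_def)
  note step = iterable_step[OF it, folded USuc, folded bSuc]
  have first: "0 < b (Suc k) \<and>
       beta_op \<gamma>1 \<gamma>2 (U k) (b (Suc k)) = U k (b (Suc k)) \<and>
       (\<forall>c>0. beta_op \<gamma>1 \<gamma>2 (U k) c = U k c \<longrightarrow> c = b (Suc k)) \<and>
       U (Suc k) = T_op \<gamma>1 \<gamma>2 (b (Suc k)) (U k) \<and>
       (\<forall>x. 0 < x \<and> x \<le> b (Suc k) \<longrightarrow>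
          - (1 / 2) * x\<^sup>2 * \<sigma>2\<^sup>2 * deriv (deriv (U (Suc k))) x
            + real n / T * (U (Suc k) x - U k x) = 0) \<and>
       (\<forall>x. x > b (Suc k) \<longrightarrow>
          - (1 / 2) * x\<^sup>2 * \<sigma>1\<^sup>2 * deriv (deriv (U (Suc k))) x
            + real n / T * (U (Suc k) x - U k x) = 0)" for k
  proof -
    obtain b0 u' where "switched_solution \<gamma>1 \<gamma>2 (U k) b0 (b (Suc k)) (U (Suc k)) u'"
      using step(4) by blast
    then interpret S: switched_solution \<gamma>1 \<gamma>2 "U k" b0 "b (Suc k)" "U (Suc k)" u' .
    \<comment> \<open>Both halves of the switched equation are the same identity with a different volatility.\<close>
    have cancel: "- (1 / 2) * x\<^sup>2 * \<sigma>\<^sup>2 * (2 * real n / (T * \<sigma>\<^sup>2) / x\<^sup>2 * w) + real n / T * w = 0"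
      if "0 < x" "0 < \<sigma>" for x \<sigma> w :: real
      using that \<open>0 < T\<close> by (simp add: field_simps)
    show ?thesis
    proof (intro conjI allI impI)
      fix x assume "0 < x \<and> x \<le> b (Suc k)"
      then show "- (1 / 2) * x\<^sup>2 * \<sigma>2\<^sup>2 * deriv (deriv (U (Suc k))) x + real n / T * (U (Suc k) x - U k x) = 0"
        using cancel[of x \<sigma>2] S.u_second_deriv[of x] exps \<sigma>2 by (simp add: diffusion_coeff_def)
    next
      fix x assume "b (Suc k) < x"
      moreover from this have "0 < x" using S.b by simp
      ultimately show "- (1 / 2) * x\<^sup>2 * \<sigma>1\<^sup>2 * deriv (deriv (U (Suc k))) x + real n / T * (U (Suc k) x - U k x) = 0"
        using cancel[of x \<sigma>1] S.u_second_deriv[of x] exps \<open>0 < \<sigma>1\<close> by (simp add: diffusion_coeff_def)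
    qed (use step(1-3) USuc bSuc in auto)
  qed
  have second: "strictly_convex_on {0<..<b k} (U k) \<and> strictly_concave_on {b k<..} (U k) \<and>
       (\<forall>x\<in>{0<..} - {b k}. (b k - x) * (U k x - U (k - 1) x) > 0) \<and>
       strict_mono_on {0..} (U k) \<and> U k ` {0..} \<subseteq> {0..<1} \<and> C2_on {0<..} (U k) \<and>
       (\<exists>(a1 :: real) (a2 :: real) (\<delta>1 :: int) (\<delta>2 :: int).
          (\<lambda>x. 1 - U k x) \<sim>[at_top] (\<lambda>x. a1 * x powr \<gamma>1 * ln x powi \<delta>1) \<and>
          U k \<sim>[at_right 0] (\<lambda>x. a2 * x powr \<gamma>2 * ln x powi \<delta>2))" if "k \<in> {1..n}" for k
  proof -
    obtain i where k: "k = Suc i" using \<open>k \<in> {1..n}\<close> by (cases k) auto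
    obtain b0 u' where "switched_solution \<gamma>1 \<gamma>2 (U i) b0 (b k) (U k) u'"
      using step(4)[of i] unfolding k by blast
    then interpret S: switched_solution \<gamma>1 \<gamma>2 "U i" b0 "b k" "U k" u' .
    obtain j where j: "power_log_tails j (U k)" using step(5)[of i] unfolding k by blast
    have "(b k - x) * (U k x - U (k - 1) x) > 0" if "x \<in> {0<..} - {b k}" for x
      using that S.above_left[of x] S.below_right[of x]
      by (cases x "b k" rule: linorder_cases) (auto simp: k mult_neg_neg)
    moreover have "U k ` {0..} \<subseteq> {0..<1}" using S.u_bounds_weak S.u_less_1 by auto
    ultimately show ?thesis
      using S.u_strictly_convex S.u_strictly_concave S.u_strict_mono S.u_C2
        power_log_tails_at_top[OF j] power_log_tails_at_0[OF j] by blast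
  qed
  show ?thesis
    using U0 first second by (intro exI[of _ U] exI[of _ b]) blast
qed

end
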